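(* Let $K$ be a discrete valuation field with valuation ring $\mathcal{O}_K$, normalised valuation $v$ and uniformiser $\pi$. Let $\Phi, \Phi' \in X_5(\mathcal{O}_K)$ be Pfaffian models with $v(\Delta(\Phi)) \le 1$ and $v(\Delta(\Phi')) \le 1$. If $\Phi' = [A,B]\Phi$ for some $A,B \in \mathrm{GL}_5(K)$, then $A,B \in K^\times \mathrm{GL}_5(\mathcal{O}_K)$. In particular: (i) if $\Phi$ and $\Phi'$ are $K$-equivalent then they are $\mathcal{O}_K$-equivalent; (ii) the stabiliser of $\Phi$ in $\mathrm{GL}_5(K)\times\mathrm{GL}_5(K)$ is contained in the subgroup generated by $\mathrm{GL}_5(\mathcal{O}_K)\times\mathrm{GL}_5(\mathcal{O}_K)$ and $[\pi^{-1}I_5, \pi^2 I_5]$.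
   Context: A Pfaffian model over a commutative ring $R$ is a $5\times5$ alternating matrix $\Phi=(\Phi_{ij})$ whose entries are linear forms in $R[x_1,\dots,x_5]$; $X_5(R)$ denotes the set of these. For $A,B\in\mathrm{GL}_5(R)$, the model $[A,B]\Phi$ is obtained by replacing $\Phi$ by $A\Phi A^T$ and substituting $x_j' = \sum_{i=1}^5 B_{ij}x_i$ for $x_j$, i.e. $(\Phi_{ij}(x_1,\dots,x_5))\mapsto(\Phi_{ij}(x_1',\dots,x_5'))$. We set $\det[A,B]=(\det A)^2\det B$. Two models are $R$-equivalent if one is $[A,B]$ applied to the other with $A,B\in\mathrm{GL}_5(R)$. For a field $F$ and $\Phi\in X_5(F)$, $C_\Phi\subset\mathbb{P}^4_F$ is the subscheme defined by the $4\times4$ Pfaffians of $\Phi$, and $\Phi$ is nonsingular if $C_\Phi$ is a smooth curve of genus one. The discriminant $\Delta\in\mathbb{Z}[X_5]$ is the standard discriminant invariant of Pfaffian models (as normalised by Fisher): an integer-coefficient polynomial of degree $60$ in the $50$ coefficients of a model, satisfying $\Delta(g\Phi)=(\det g)^{12}\Delta(\Phi)$, with $\Delta(\Phi)\neq0$ iff $\Phi$ is nonsingular, and such that for nonsingular $\Phi$ over a field $\Delta(\Phi)$ is the discriminant of a Weierstrass equation for the Jacobian of $C_\Phi$ (with $c_4^3-c_6^2=1728\Delta$ for companion invariants $c_4,c_6$ of degrees $20,30$). Here $v(0)=+\infty$. *)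

theory Defs
  imports
    "HOL-Analysis.Analysis"
    "HOL-Algebra.Generated_Groups"
    "HOL-Library.Poly_Mapping"
    "HOL-Library.Extended"
    "HOL-Computational_Algebra.Polynomial"
    "HOL-Computational_Algebra.Fundamental_Theorem_Algebra"
begin

section \<open>Multivariate polynomials\<close>

type_synonym ('x, 'a) mvpoly = "('x \<Rightarrow>\<^sub>0 nat) \<Rightarrow>\<^sub>0 'a"

definition eval_mvpoly :: "('a::zero \<Rightarrow> 'b::comm_semiring_1) \<Rightarrow> ('x \<Rightarrow> 'b) \<Rightarrow> ('x, 'a) mvpoly \<Rightarrow> 'b"
  where "eval_mvpoly h x p =
    (\<Sum>m\<in>Poly_Mapping.keys p. h (Poly_Mapping.lookup p m) * (\<Prod>i\<in>Poly_Mapping.keys m. x i ^ Poly_Mapping.lookup m i))"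

definition homogeneous :: "nat \<Rightarrow> ('x, 'a::zero) mvpoly \<Rightarrow> bool"
  where "homogeneous d p \<longleftrightarrow> (\<forall>m\<in>Poly_Mapping.keys p. (\<Sum>i\<in>Poly_Mapping.keys m. Poly_Mapping.lookup m i) = d)"

definition partial_deriv :: "'x \<Rightarrow> ('x, 'a::comm_semiring_1) mvpoly \<Rightarrow> ('x, 'a) mvpoly"
  where "partial_deriv k p =
    (\<Sum>m\<in>Poly_Mapping.keys p. Poly_Mapping.single (m - Poly_Mapping.single k 1) (of_nat (Poly_Mapping.lookup m k) * Poly_Mapping.lookup p m))"

definition scale_mvpoly :: "'a::comm_semiring_1 \<Rightarrow> ('x, 'a) mvpoly \<Rightarrow> ('x, 'a) mvpoly"
  where "scale_mvpoly c p = Poly_Mapping.single 0 c * p"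


section \<open>Pfaffian models and the group action\<close>

text \<open>The index type 5 has the elements 0, 1, 2, 3, 4 (with arithmetic modulo 5), so indices
  and variables are numbered from 0. A linear form is its vector of coefficients:
  \<open>\<Phi> $ i $ j $ k\<close> is the coefficient of \<open>x\<^sub>k\<close> in the entry \<open>\<Phi>\<^sub>i\<^sub>j\<close>.\<close>

type_synonym 'a linear_form = "'a^5"
type_synonym 'a model = "'a linear_form^5^5"

text \<open>In the following, \<open>R\<close> is the carrier of a subring of the ambient ring.\<close>

definition pfaffian_models :: "'a::comm_ring_1 set \<Rightarrow> 'a model set"  (\<open>X\<^sub>5\<close>)
  where "X\<^sub>5 R = {\<Phi>. (\<forall>i. \<Phi> $ i $ i = 0) \<and> (\<forall>i j. \<Phi> $ j $ i = - (\<Phi> $ i $ j)) \<and>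
                  (\<forall>i j k. \<Phi> $ i $ j $ k \<in> R)}"

definition GL5 :: "'a::comm_ring_1 set \<Rightarrow> ('a^5^5) set"
  where "GL5 R = {A. (\<forall>i j. A $ i $ j \<in> R) \<and>
     (\<exists>A'. (\<forall>i j. A' $ i $ j \<in> R) \<and> A ** A' = mat 1 \<and> A' ** A = mat 1)}"

definition GL5_group :: "'a::comm_ring_1 set \<Rightarrow> ('a^5^5) monoid"
  where "GL5_group R = \<lparr>carrier = GL5 R, mult = (**), one = mat 1\<rparr>"

text \<open>Substituting \<open>\<Sum>\<^sub>i B\<^sub>i\<^sub>j x\<^sub>i\<close> for \<open>x\<^sub>j\<close> in the linear form with coefficient vector \<open>c\<close>
  gives the linear form with coefficient vector \<open>B *v c\<close>.\<close>

definition act :: "'a::comm_ring_1^5^5 \<Rightarrow> 'a^5^5 \<Rightarrow> 'a model \<Rightarrow> 'a model"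
  where "act A B \<Phi> = (\<chi> i j. B *v (\<Sum>r\<in>UNIV. \<Sum>s\<in>UNIV. (A $ i $ r * A $ j $ s) *s (\<Phi> $ r $ s)))"

definition act_det :: "'a::comm_ring_1^5^5 \<Rightarrow> 'a^5^5 \<Rightarrow> 'a"
  where "act_det A B = (det A)\<^sup>2 * det B"

definition equivalent_over :: "'a::comm_ring_1 set \<Rightarrow> 'a model \<Rightarrow> 'a model \<Rightarrow> bool"
  where "equivalent_over R \<Phi> \<Phi>' \<longleftrightarrow> (\<exists>A\<in>GL5 R. \<exists>B\<in>GL5 R. \<Phi>' = act A B \<Phi>)"

definition stabiliser :: "'a::comm_ring_1 set \<Rightarrow> 'a model \<Rightarrow> (('a^5^5) \<times> ('a^5^5)) set"
  where "stabiliser R \<Phi> = {(A, B) \<in> GL5 R \<times> GL5 R. act A B \<Phi> = \<Phi>}"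


section \<open>The curve defined by a model\<close>

definition form_poly :: "'a::comm_ring_1 linear_form \<Rightarrow> (5, 'a) mvpoly"
  where "form_poly c = (\<Sum>k\<in>UNIV. Poly_Mapping.single (Poly_Mapping.single k 1) (c $ k))"

text \<open>The Pfaffian of the submatrix obtained by deleting row and column \<open>i\<close>; the remaining
  indices are taken in the cyclic order \<open>i+1, i+2, i+3, i+4\<close>, which affects at most its sign.\<close>

definition pfaffian :: "'a::comm_ring_1 model \<Rightarrow> 5 \<Rightarrow> (5, 'a) mvpoly"
  where "pfaffian \<Phi> i =
    (let F = (\<lambda>r s. form_poly (\<Phi> $ (i + r) $ (i + s)))
     in F 1 2 * F 3 4 - F 1 3 * F 2 4 + F 1 4 * F 2 3)"

text \<open>Homogeneous coordinate vectors of the points of \<open>C\<^sub>\<Phi>\<close> over an algebraically closed field.\<close>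

definition curve_points :: "'a::alg_closed_field model \<Rightarrow> ('a^5) set"
  where "curve_points \<Phi> = {x. x \<noteq> 0 \<and> (\<forall>i. eval_mvpoly id (($) x) (pfaffian \<Phi> i) = 0)}"

definition jacobian_matrix :: "'a::alg_closed_field model \<Rightarrow> 'a^5 \<Rightarrow> 'a^5^5"
  where "jacobian_matrix \<Phi> x = (\<chi> i k. eval_mvpoly id (($) x) (partial_deriv k (pfaffian \<Phi> i)))"

definition irreducible_curve :: "'a::alg_closed_field model \<Rightarrow> bool"
  where "irreducible_curve \<Phi> \<longleftrightarrow> curve_points \<Phi> \<noteq> {} \<and>
    (\<forall>f g. (\<forall>x\<in>curve_points \<Phi>. eval_mvpoly id (($) x) (f * g) = 0) \<longrightarrow>
       (\<forall>x\<in>curve_points \<Phi>. eval_mvpoly id (($) x) f = 0) \<or>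
       (\<forall>x\<in>curve_points \<Phi>. eval_mvpoly id (($) x) g = 0))"

text \<open>The Hilbert function of the homogeneous coordinate ring of \<open>C\<^sub>\<Phi>\<close>.\<close>

definition hilbert_function :: "'a::alg_closed_field model \<Rightarrow> nat \<Rightarrow> int"
  where "hilbert_function \<Phi> d =
    int (vector_space.dim scale_mvpoly {f :: (5, 'a) mvpoly. homogeneous d f}) -
    int (vector_space.dim scale_mvpoly
      {f. homogeneous d f \<and> (\<exists>q. f = (\<Sum>i\<in>UNIV. q i * pfaffian \<Phi> i))})"

text \<open>A projective scheme is a curve of arithmetic genus \<open>g\<close> iff its Hilbert polynomial is
  \<open>n d + 1 - g\<close> for some \<open>n > 0\<close> (its degree).\<close>

definition has_arithmetic_genus :: "'a::alg_closed_field model \<Rightarrow> int \<Rightarrow> bool"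
  where "has_arithmetic_genus \<Phi> g \<longleftrightarrow>
    (\<exists>n>0. \<forall>\<^sub>F d in sequentially. hilbert_function \<Phi> d = n * int d + 1 - g)"

text \<open>Smoothness is the projective Jacobian criterion: the rank is the codimension 3 of a curve
  in projective 4-space at every point.\<close>

definition nonsingular :: "'a::alg_closed_field model \<Rightarrow> bool"
  where "nonsingular \<Phi> \<longleftrightarrow>
    irreducible_curve \<Phi> \<and> has_arithmetic_genus \<Phi> 1 \<and>
    (\<forall>x\<in>curve_points \<Phi>. rank (jacobian_matrix \<Phi> x) = 3)"


section \<open>Invariants and the discriminant\<close>

text \<open>The variable \<open>(i, j, k)\<close>, for \<open>i < j\<close>, stands for the coefficient of \<open>x\<^sub>k\<close> in \<open>\<Phi>\<^sub>i\<^sub>j\<close>.\<close>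

type_synonym model_poly = "(5 \<times> 5 \<times> 5, int) mvpoly"

definition model_polys :: "model_poly set" 
  where "model_polys = {p. \<forall>m\<in>Poly_Mapping.keys p. Poly_Mapping.keys m \<subseteq> {(i, j, k). i < j}}"

definition eval_model :: "model_poly \<Rightarrow> 'a::comm_ring_1 model \<Rightarrow> 'a"
  where "eval_model p \<Phi> = eval_mvpoly of_int (\<lambda>(i, j, k). \<Phi> $ i $ j $ k) p"

text \<open>An identity between integer polynomials holds over every commutative ring as soon as it
  holds over the complex numbers.\<close>

definition invariant_of_weight :: "nat \<Rightarrow> model_poly \<Rightarrow> bool"
  where "invariant_of_weight w p \<longleftrightarrow>
    (\<forall>\<Phi> \<in> X\<^sub>5 (UNIV :: complex set). \<forall>A\<in>GL5 UNIV. \<forall>B\<in>GL5 UNIV.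
       eval_model p (act A B \<Phi>) = act_det A B ^ w * eval_model p \<Phi>)"

text \<open>The Pfaffian model of the curve
  \<open>y\<^sup>2 + a\<^sub>1xy + a\<^sub>3y = x\<^sup>3 + a\<^sub>2x\<^sup>2 + a\<^sub>4x + a\<^sub>6\<close> embedded by
  \<open>(x\<^sub>0 : x\<^sub>1 : x\<^sub>2 : x\<^sub>3 : x\<^sub>4) = (1 : x : y : x\<^sup>2 : xy)\<close>. Its Pfaffians are, up to sign,
  the minors of \<open>(x\<^sub>0, x\<^sub>1, x\<^sub>2; x\<^sub>1, x\<^sub>3, x\<^sub>4)\<close>, the Weierstrass equation, and \<open>x\<close> times it.\<close>

definition weierstrass_model :: "'a::comm_ring_1 \<Rightarrow> 'a \<Rightarrow> 'a \<Rightarrow> 'a \<Rightarrow> 'a \<Rightarrow> 'a model"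
  where "weierstrass_model a1 a2 a3 a4 a6 =
    (let x = (\<lambda>k::5. axis k (1::'a));
         U = (\<lambda>(i::5) (j::5).
           if (i, j) = (0, 2) then x 0
           else if (i, j) = (0, 3) then x 1
           else if (i, j) = (0, 4) then x 2
           else if (i, j) = (1, 2) then x 1
           else if (i, j) = (1, 3) then x 3
           else if (i, j) = (1, 4) then x 4
           else if (i, j) = (2, 3) then x 2 + a1 *s x 1 + a3 *s x 0
           else if (i, j) = (2, 4) then x 3 + a2 *s x 1 + a4 *s x 0
           else if (i, j) = (3, 4) then - (a6 *s x 0)
           else 0)
     in \<chi> i j. U i j - U j i)"

definition weierstrass_discriminant :: "'a::comm_ring_1 \<Rightarrow> 'a \<Rightarrow> 'a \<Rightarrow> 'a \<Rightarrow> 'a \<Rightarrow> 'a"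
  where "weierstrass_discriminant a1 a2 a3 a4 a6 =
    (let b2 = a1\<^sup>2 + 4 * a2;
         b4 = 2 * a4 + a1 * a3;
         b6 = a3\<^sup>2 + 4 * a6;
         b8 = a1\<^sup>2 * a6 + 4 * a2 * a6 - a1 * a3 * a4 + a2 * a3\<^sup>2 - a4\<^sup>2
     in - (b2\<^sup>2 * b8) - 8 * b4 ^ 3 - 27 * b6\<^sup>2 + 9 * b2 * b4 * b6)"

text \<open>The following properties determine the discriminant of Pfaffian models uniquely. The
  invariants of degree 60 over the complex numbers are the linear combinations of \<open>c\<^sub>4\<^sup>3\<close> and
  \<open>c\<^sub>6\<^sup>2\<close>; vanishing on singular models leaves one up to a scalar, and its values on the models
  of Weierstrass equations fix the scalar.\<close>

definition is_discriminant :: "model_poly \<Rightarrow> bool"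
  where "is_discriminant D \<longleftrightarrow>
    D \<in> model_polys \<and> homogeneous 60 D \<and> invariant_of_weight 12 D \<and>
    (\<forall>\<Phi> \<in> X\<^sub>5 (UNIV :: complex set). eval_model D \<Phi> \<noteq> 0 \<longleftrightarrow> nonsingular \<Phi>) \<and>
    (\<forall>a1 a2 a3 a4 a6 :: complex.
       eval_model D (weierstrass_model a1 a2 a3 a4 a6) = weierstrass_discriminant a1 a2 a3 a4 a6) \<and>
    (\<exists>c4\<in>model_polys. \<exists>c6\<in>model_polys.
       homogeneous 20 c4 \<and> invariant_of_weight 4 c4 \<and>
       homogeneous 30 c6 \<and> invariant_of_weight 6 c6 \<and>
       c4 ^ 3 - c6 ^ 2 = 1728 * D)"


section \<open>Discrete valuations\<close>

definition normalised_discrete_valuation :: "('k::field \<Rightarrow> int extended) \<Rightarrow> bool"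
  where "normalised_discrete_valuation v \<longleftrightarrow>
    (\<forall>x. v x = Pinf \<longleftrightarrow> x = 0) \<and> (\<forall>x. v x \<noteq> Minf) \<and>
    (\<forall>x y. v (x * y) = v x + v y) \<and>
    (\<forall>x y. min (v x) (v y) \<le> v (x + y)) \<and>
    (\<exists>x. v x = Fin 1)"

definition valuation_ring :: "('k::field \<Rightarrow> int extended) \<Rightarrow> 'k set"
  where "valuation_ring v = {x. Fin 0 \<le> v x}"

definition scalar_GL5 :: "'k::field set \<Rightarrow> ('k^5^5) set"
  where "scalar_GL5 R = {mat c ** A | c A. c \<noteq> 0 \<and> A \<in> GL5 R}"

end

theory Submission
  imports Defs
begin

text \<open>By the Smith normal form we may assume \<open>A = diag(\<pi>\<^bsup>r\<^sub>i\<^esup>)\<close> and \<open>B = diag(\<pi>\<^bsup>s\<^sub>k\<^esup>)\<close>, where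
  \<open>2 \<Sum> r + \<Sum> s = 0\<close> because both discriminants have valuation 0 or 1. Integrality of both models says that the
  coefficient of \<open>x\<^sub>k\<close> in \<open>\<Phi>\<^sub>i\<^sub>j\<close> has valuation at least \<open>max(0, -t)\<close> with \<open>t = r\<^sub>i + r\<^sub>j + s\<^sub>k\<close>. It suffices
  that every monomial of the discriminant has total weight at least 2 with respect to \<open>max(0, -t)\<close> unless \<open>r\<close> and
  \<open>s\<close> are constant. This is a statement about integer polynomials, hence about complex models.

  If \<open>c\<^sub>4\<close> or \<open>c\<^sub>6\<close> has a monomial in coefficients with \<open>t = 0\<close> only, then invariance under the two general linear
  groups yields, after permutations of the rows and of the variables, a pentagon: \<open>r\<^sub>i + r\<^sub>i\<^sub>+\<^sub>1 + s\<^sub>i = 0\<close> for all \<open>i\<close>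
  modulo 5. Otherwise all monomials of \<open>c\<^sub>4\<close> and \<open>c\<^sub>6\<close> have positive weight, and \<open>1728 \<Delta> = c\<^sub>4\<^sup>3 - c\<^sub>6\<^sup>2\<close>
  gives the claim.

  In the presence of a pentagon we expand the discriminant at the model \<open>\<Phi>\<^sub>i\<^sub>,\<^sub>i\<^sub>+\<^sub>1 = x\<^sub>i\<close> of a cycle of five lines,
  which is stabilised by the one-parameter subgroup \<open>(r, s)\<close>. The tangent space of its orbit is
  complemented by five coordinate directions \<open>q\<^sub>i\<close>, one for each node, and invariance reduces the claim to monomials in
  the \<open>q\<^sub>i\<close>, which must be powers of \<open>\<Prod> q\<^sub>i\<close>. The weights \<open>e\<^sub>i\<close> of the \<open>q\<^sub>i\<close> satisfy \<open>\<Sum> e\<^sub>i = 0\<close>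
  and \<open>\<Sum> i e\<^sub>i \<equiv> 0\<close> modulo 5, so \<open>\<Sum> |e\<^sub>i| \<ge> 4\<close> unless all \<open>e\<^sub>i\<close> vanish.\<close>

section \<open>Evaluation of multivariate polynomials\<close>

text \<open>Invariance is given for complex models, while the valuation lives on an arbitrary field.
  What carries over is a statement about the support of integer polynomials: if every monomial has
  weight at least 2, the value has valuation at least 2, in every characteristic. The number 2 is
  the first one excluded by the hypothesis on the discriminants. The case distinction reflects the
  geometry of the pentagon. There \<open>c4\<close> and \<open>c6\<close> can be units, so writing
  the discriminant through them gains nothing, and the gain has to come from the vanishing of the
  discriminant at the pentagon itself. No single coefficient is responsible for it: a direction
  \<open>q_i\<close> may well have weight 0 or -1, and only the relations that the diagonal matrices
  impose on the five exponents push the total up.\<close>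

definition mono_eval :: "('x \<Rightarrow> 'b::comm_semiring_1) \<Rightarrow> ('x \<Rightarrow>\<^sub>0 nat) \<Rightarrow> 'b"
  where "mono_eval x m = (\<Prod>i\<in>Poly_Mapping.keys m. x i ^ Poly_Mapping.lookup m i)"

lemma mono_eval_superset:
  assumes "finite S" "Poly_Mapping.keys m \<subseteq> S"
  shows "mono_eval x m = (\<Prod>i\<in>S. x i ^ Poly_Mapping.lookup m i)"
  unfolding mono_eval_def by (rule prod.mono_neutral_left) (use assms in \<open>auto simp: in_keys_iff\<close>)

lemma mono_eval_0 [simp]: "mono_eval x 0 = 1"
  by (simp add: mono_eval_def)

lemma mono_eval_single [simp]: "mono_eval x (Poly_Mapping.single i n) = x i ^ n"
  by (simp add: mono_eval_def)

lemma mono_eval_add: "mono_eval x (m + n) = mono_eval x m * mono_eval x n"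
proof -
  let ?S = "Poly_Mapping.keys m \<union> Poly_Mapping.keys n"
  have "mono_eval x (m + n) = (\<Prod>i\<in>?S. x i ^ Poly_Mapping.lookup (m + n) i)"
    by (rule mono_eval_superset) (use keys_add[of m n] in auto)
  also have "\<dots> = (\<Prod>i\<in>?S. x i ^ Poly_Mapping.lookup m i) * (\<Prod>i\<in>?S. x i ^ Poly_Mapping.lookup n i)"
    by (simp add: lookup_add power_add prod.distrib)
  also have "\<dots> = mono_eval x m * mono_eval x n"
    by (simp add: mono_eval_superset[of ?S])
  finally show ?thesis .
qed

lemma mono_eval_mult: "mono_eval (\<lambda>i. x i * y i) m = mono_eval x m * mono_eval y m"
  by (simp add: mono_eval_def power_mult_distrib prod.distrib)

abbreviation int_eval :: "('x \<Rightarrow> 'b::comm_ring_1) \<Rightarrow> ('x, int) mvpoly \<Rightarrow> 'b"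
  where "int_eval \<equiv> eval_mvpoly of_int"

lemma int_eval_superset:
  assumes "finite S" "Poly_Mapping.keys p \<subseteq> S"
  shows "int_eval x p = (\<Sum>m\<in>S. of_int (Poly_Mapping.lookup p m) * mono_eval x m)"
  unfolding eval_mvpoly_def mono_eval_def[symmetric]
  by (rule sum.mono_neutral_left) (use assms in \<open>auto simp: in_keys_iff\<close>)

lemma int_eval_alt: "int_eval x p = (\<Sum>m\<in>Poly_Mapping.keys p. of_int (Poly_Mapping.lookup p m) * mono_eval x m)"
  by (simp add: int_eval_superset)

lemma int_eval_0 [simp]: "int_eval x 0 = 0"
  by (simp add: int_eval_alt)

lemma int_eval_single: "int_eval x (Poly_Mapping.single m c) = of_int c * mono_eval x m"
  by (simp add: int_eval_alt)

lemma int_eval_1 [simp]: "int_eval x 1 = 1"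
  using int_eval_single[of x 0 1] by simp

lemma int_eval_add [simp]: "int_eval x (p + q) = int_eval x p + int_eval x q"
proof -
  let ?S = "Poly_Mapping.keys p \<union> Poly_Mapping.keys q"
  have "int_eval x (p + q) = (\<Sum>m\<in>?S. of_int (Poly_Mapping.lookup (p + q) m) * mono_eval x m)"
    by (rule int_eval_superset) (use keys_add[of p q] in auto)
  also have "\<dots> = int_eval x p + int_eval x q"
    by (simp add: int_eval_superset[of ?S] lookup_add distrib_right sum.distrib)
  finally show ?thesis .
qed

lemma int_eval_sum [simp]: "int_eval x (\<Sum>i\<in>A. f i) = (\<Sum>i\<in>A. int_eval x (f i))"
  by (induction A rule: infinite_finite_induct) auto

lemma poly_mapping_sum_singles: "p = (\<Sum>m\<in>Poly_Mapping.keys p. Poly_Mapping.single m (Poly_Mapping.lookup p m))"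
proof (rule poly_mapping_eqI)
  fix k
  have "(\<Sum>m\<in>Poly_Mapping.keys p. Poly_Mapping.lookup (Poly_Mapping.single m (Poly_Mapping.lookup p m)) k) =
    (\<Sum>m\<in>Poly_Mapping.keys p. if m = k then Poly_Mapping.lookup p m else 0)"
    by (intro sum.cong) (auto simp: lookup_single)
  then show "Poly_Mapping.lookup p k = Poly_Mapping.lookup (\<Sum>m\<in>Poly_Mapping.keys p. Poly_Mapping.single m (Poly_Mapping.lookup p m)) k"
    by (auto simp: lookup_sum in_keys_iff)
qed

lemma int_eval_mult [simp]: "int_eval x (p * q) = int_eval x p * int_eval x q"
proof -
  have "p * q = (\<Sum>m\<in>Poly_Mapping.keys p. Poly_Mapping.single m (Poly_Mapping.lookup p m)) *
     (\<Sum>n\<in>Poly_Mapping.keys q. Poly_Mapping.single n (Poly_Mapping.lookup q n))"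
    by (simp flip: poly_mapping_sum_singles)
  then have "int_eval x (p * q) = (\<Sum>m\<in>Poly_Mapping.keys p. \<Sum>n\<in>Poly_Mapping.keys q.
     int_eval x (Poly_Mapping.single m (Poly_Mapping.lookup p m) * Poly_Mapping.single n (Poly_Mapping.lookup q n)))"
    by (simp add: sum_product)
  also have "\<dots> = (\<Sum>m\<in>Poly_Mapping.keys p. \<Sum>n\<in>Poly_Mapping.keys q.
     (of_int (Poly_Mapping.lookup p m) * mono_eval x m) * (of_int (Poly_Mapping.lookup q n) * mono_eval x n))"
    by (simp add: mult_single int_eval_single mono_eval_add algebra_simps)
  also have "\<dots> = int_eval x p * int_eval x q"
    by (simp add: int_eval_alt sum_product)
  finally show ?thesis .
qed

lemma int_eval_power [simp]: "int_eval x (p ^ n) = int_eval x p ^ n"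
  by (induction n) auto

lemma int_eval_uminus [simp]: "int_eval x (- p) = - int_eval x p"
  using int_eval_add[of x p "- p"] by (simp add: eq_neg_iff_add_eq_0 add.commute)

lemma int_eval_diff [simp]: "int_eval x (p - q) = int_eval x p - int_eval x q"
  using int_eval_add[of x p "- q"] by simp

lemma of_int_mvpoly: "(of_int c :: ('x, int) mvpoly) = Poly_Mapping.single 0 c"
  by (metis of_int_eq_id id_apply single_of_int)

lemma int_eval_of_int [simp]: "int_eval x (of_int c) = of_int c"
  by (simp add: of_int_mvpoly int_eval_single)

definition var :: "'x \<Rightarrow> ('x, int) mvpoly"
  where "var v = Poly_Mapping.single (Poly_Mapping.single v 1) 1"

lemma int_eval_var [simp]: "int_eval x (var v) = x v"
  by (simp add: var_def int_eval_single)

lemma int_eval_prod [simp]: "int_eval x (\<Prod>i\<in>A. f i) = (\<Prod>i\<in>A. int_eval x (f i))"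
  by (induction A rule: infinite_finite_induct) auto

lemma int_eval_compose: "int_eval y (int_eval f p) = int_eval (\<lambda>v. int_eval y (f v)) p"
  unfolding int_eval_alt[of f] by (simp add: int_eval_alt[of "\<lambda>v. int_eval y (f v)"] mono_eval_def)

lemma mono_eval_var: "mono_eval var m = Poly_Mapping.single m 1"
proof -
  have *: "var v ^ n = Poly_Mapping.single (Poly_Mapping.single v n) 1" for v :: 'a and n
    by (induction n) (auto simp: var_def mult_single single_add[symmetric])
  have "(\<Prod>v\<in>S. Poly_Mapping.single (f v) (1::int)) = Poly_Mapping.single (sum f S) 1" for S :: "'a set" and f :: "'a \<Rightarrow> 'a \<Rightarrow>\<^sub>0 nat"
    by (induction S rule: infinite_finite_induct) (auto simp: mult_single)
  then show ?thesis
    by (simp add: mono_eval_def * flip: poly_mapping_sum_singles)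
qed

lemma int_eval_var_id: "int_eval var p = p"
proof -
  have "of_int c * Poly_Mapping.single m 1 = Poly_Mapping.single m c" for c :: int and m :: "'a \<Rightarrow>\<^sub>0 nat"
    by (simp add: of_int_mvpoly mult_single)
  then show ?thesis
    by (simp add: int_eval_alt mono_eval_var flip: poly_mapping_sum_singles)
qed

section \<open>Independence of monomials\<close>

text \<open>Look at the nonzero digit with the smallest exponent: modulo the next power of
  \<open>N\<close> it is the only term left, so \<open>N\<close> divides it, against its
  size.\<close>

lemma base_expansion_zero:
  fixes d :: "'x \<Rightarrow> int" and e :: "'x \<Rightarrow> nat" and N :: int
  assumes "finite V" "inj_on e V" "\<And>v. v \<in> V \<Longrightarrow> \<bar>d v\<bar> < N" "(\<Sum>v\<in>V. d v * N ^ e v) = 0" "v \<in> V"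
  shows "d v = 0"
proof (rule ccontr)
  assume "d v \<noteq> 0"
  define W where "W = {v\<in>V. d v \<noteq> 0}"
  have W: "finite W" "W \<noteq> {}" using assms \<open>d v \<noteq> 0\<close> by (auto simp: W_def)
  define u where "u = arg_min_on e W"
  have u: "u \<in> W" and umin: "\<And>w. w \<in> W \<Longrightarrow> e u \<le> e w"
    using W arg_min_if_finite[of W e] unfolding u_def by (auto simp: not_less)
  have *: "N ^ (e u + 1) dvd d w * N ^ e w" if "w \<in> V - {u}" for w
  proof (cases "w \<in> W")
    case True
    moreover have "e u \<noteq> e w" using that u assms(2) by (auto simp: W_def inj_on_def)
    ultimately have "e u < e w" using umin[of w] by simp
    then show ?thesis by (intro dvd_mult le_imp_power_dvd) auto
  qed (use that in \<open>auto simp: W_def\<close>)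
  have "(\<Sum>v\<in>V. d v * N ^ e v) = d u * N ^ e u + (\<Sum>v\<in>V-{u}. d v * N ^ e v)"
    using u assms(1) by (intro sum.remove) (auto simp: W_def)
  moreover have "N ^ (e u + 1) dvd (\<Sum>v\<in>V-{u}. d v * N ^ e v)"
    by (rule dvd_sum) (rule *)
  ultimately have "N ^ (e u + 1) dvd d u * N ^ e u"
    using assms(4) by (metis dvd_0_right dvd_add_left_iff)
  moreover have "N > 0" using assms(3)[of u] u by (auto simp: W_def)
  ultimately have "N dvd d u" by simp
  then have "\<bar>N\<bar> \<le> \<bar>d u\<bar>" using u by (intro dvd_imp_le_int) (auto simp: W_def)
  with assms(3)[of u] u show False by (auto simp: W_def)
qed

text \<open>Kronecker substitution: sending the variables to sufficiently sparse powers of one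
  variable separates finitely many monomials.\<close>

lemma monomials_independent:
  fixes a :: "('x \<Rightarrow>\<^sub>0 nat) \<Rightarrow> complex"
  assumes "finite F" and zero: "\<And>x. (\<Sum>m\<in>F. a m * mono_eval x m) = 0" and "m \<in> F"
  shows "a m = 0"
proof -
  define V where "V = (\<Union>m\<in>F. Poly_Mapping.keys m)"
  have finV: "finite V" using assms(1) by (simp add: V_def)
  obtain e :: "'x \<Rightarrow> nat" where e: "inj_on e V"
    using finite_imp_inj_to_nat_seg[OF finV] by blast
  \<comment> \<open>\<open>N\<close> exceeds every exponent, so the exponents of \<open>m\<close>
    are the base \<open>N\<close> digits of \<open>L m\<close>, and \<open>L\<close> is injective on
    \<open>F\<close>.\<close>
  define N :: nat where "N = Suc (\<Sum>m\<in>F. \<Sum>v\<in>V. Poly_Mapping.lookup m v)"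
  have N: "Poly_Mapping.lookup m v < N" if "m \<in> F" "v \<in> V" for m v
  proof -
    have "Poly_Mapping.lookup m v \<le> (\<Sum>v\<in>V. Poly_Mapping.lookup m v)"
      using that finV by (intro member_le_sum) auto
    also have "\<dots> \<le> (\<Sum>m\<in>F. \<Sum>v\<in>V. Poly_Mapping.lookup m v)"
      using that assms(1) by (intro member_le_sum[where f = "\<lambda>m. \<Sum>v\<in>V. Poly_Mapping.lookup m v"]) auto
    finally show ?thesis by (simp add: N_def)
  qed
  define L where "L m = (\<Sum>v\<in>V. Poly_Mapping.lookup m v * N ^ e v)" for m :: "'x \<Rightarrow>\<^sub>0 nat"
  have sub: "Poly_Mapping.keys m \<subseteq> V" if "m \<in> F" for m using that by (auto simp: V_def)
  have inj: "inj_on L F"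
  proof (rule inj_onI)
    fix m n assume mn: "m \<in> F" "n \<in> F" "L m = L n"
    have "int (L m) = int (L n)" using mn by simp
    then have *: "(\<Sum>v\<in>V. (int (Poly_Mapping.lookup m v) - int (Poly_Mapping.lookup n v)) * int N ^ e v) = 0"
      by (simp add: L_def left_diff_distrib sum_subtractf)
    have "int (Poly_Mapping.lookup m v) - int (Poly_Mapping.lookup n v) = 0" if "v \<in> V" for v
    proof (rule base_expansion_zero[OF finV e _ * that])
      show "\<bar>int (Poly_Mapping.lookup m v) - int (Poly_Mapping.lookup n v)\<bar> < int N" if "v \<in> V" for v
        using N[OF mn(1) that] N[OF mn(2) that] by linarith
    qed
    moreover have "Poly_Mapping.lookup m v = 0 \<and> Poly_Mapping.lookup n v = 0" if "v \<notin> V" for v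
      using sub[OF mn(1)] sub[OF mn(2)] that by (auto simp: in_keys_iff)
    ultimately show "m = n" by (intro poly_mapping_eqI) force
  qed
  define P :: "complex poly" where "P = (\<Sum>m\<in>F. monom (a m) (L m))"
  have "poly P u = 0" for u
  proof -
    have "mono_eval (\<lambda>v. u ^ (N ^ e v)) m = u ^ L m" if "m \<in> F" for m
      using sub[OF that] finV
      by (simp add: mono_eval_superset L_def power_sum power_mult[symmetric] mult.commute)
    then show ?thesis
      using zero[of "\<lambda>v. u ^ (N ^ e v)"] by (simp add: P_def poly_sum poly_monom)
  qed
  then have "P = 0" using poly_all_0_iff_0[of P] by blast
  then have "coeff P (L m) = 0" by simp
  also have "coeff P (L m) = (\<Sum>n\<in>F. if n = m then a n else 0)"
    unfolding P_def coeff_sum by (intro sum.cong) (use inj \<open>m \<in> F\<close> in \<open>auto simp: inj_on_def\<close>)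
  finally show ?thesis using assms by simp
qed

lemma int_eval_complex_eq_0:
  fixes p :: "('x, int) mvpoly"
  assumes "\<And>x :: 'x \<Rightarrow> complex. int_eval x p = 0"
  shows "p = 0"
proof -
  have "of_int (Poly_Mapping.lookup p m) = (0::complex)" if "m \<in> Poly_Mapping.keys p" for m
    by (rule monomials_independent[OF finite_keys _ that]) (use assms in \<open>simp add: int_eval_alt\<close>)
  then show ?thesis by (intro poly_mapping_eqI) (force simp: in_keys_iff)
qed

section \<open>Models in coordinates\<close>

definition coord_model :: "(5 \<times> 5 \<times> 5 \<Rightarrow> 'a::comm_ring_1) \<Rightarrow> 'a model"
  where "coord_model \<psi> = (\<chi> i j k. if i < j then \<psi> (i, j, k) else if j < i then - \<psi> (j, i, k) else 0)"

lemma coord_model_nth [simp]: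
  "coord_model \<psi> $ i $ j $ k = (if i < j then \<psi> (i, j, k) else if j < i then - \<psi> (j, i, k) else 0)"
  by (simp add: coord_model_def)

lemma coord_model_in [simp]: "coord_model \<psi> \<in> X\<^sub>5 UNIV"
  by (auto simp: pfaffian_models_def vec_eq_iff)

lemma X5_alternating:
  assumes "\<Phi> \<in> X\<^sub>5 R"
  shows "\<Phi> $ i $ i $ k = 0" "\<Phi> $ j $ i $ k = - (\<Phi> $ i $ j $ k)"
proof -
  have "\<Phi> $ i $ i = 0" and "\<Phi> $ j $ i = - (\<Phi> $ i $ j)"
    using assms unfolding pfaffian_models_def by blast+
  then show "\<Phi> $ i $ i $ k = 0" and "\<Phi> $ j $ i $ k = - (\<Phi> $ i $ j $ k)" by simp_all
qed

lemma coord_model_coords: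
  assumes "\<Phi> \<in> X\<^sub>5 R"
  shows "coord_model (\<lambda>(i, j, k). \<Phi> $ i $ j $ k) = \<Phi>"
proof -
  have "coord_model (\<lambda>(i, j, k). \<Phi> $ i $ j $ k) $ i $ j $ k = \<Phi> $ i $ j $ k" for i j k
    using X5_alternating(1)[OF assms, of i k] X5_alternating(2)[OF assms, of i j k]
    by (cases i j rule: linorder_cases) auto
  then show ?thesis unfolding vec_eq_iff by blast
qed

lemma eval_model_coord:
  assumes "p \<in> model_polys"
  shows "eval_model p (coord_model \<psi>) = int_eval \<psi> p"
proof -
  have "mono_eval (\<lambda>(i, j, k). coord_model \<psi> $ i $ j $ k) m = mono_eval \<psi> m" if "m \<in> Poly_Mapping.keys p" for m
    unfolding mono_eval_def by (intro prod.cong) (use assms that in \<open>force simp: model_polys_def\<close>)+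
  then show ?thesis by (simp add: eval_model_def int_eval_alt)
qed

lemma eval_model_alt:
  "eval_model p \<Phi> = int_eval (\<lambda>(i, j, k). \<Phi> $ i $ j $ k) p"
  by (simp add: eval_model_def)

lemma act_nth:
  "act A B \<Phi> $ i $ j $ k = (\<Sum>l\<in>UNIV. B $ k $ l * (\<Sum>a\<in>UNIV. \<Sum>b\<in>UNIV. A $ i $ a * A $ j $ b * \<Phi> $ a $ b $ l))"
  by (simp add: act_def matrix_vector_mult_def)

lemma act_in_X5:
  assumes "\<Phi> \<in> X\<^sub>5 R"
  shows "act A B \<Phi> \<in> X\<^sub>5 UNIV"
proof -
  have neg: "A $ j $ b * A $ i $ a * \<Phi> $ b $ a $ l = - (A $ i $ a * A $ j $ b * \<Phi> $ a $ b $ l)" for i j a b l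
    using X5_alternating(2)[OF assms, of b a l] by (simp add: mult_ac)
  have alt: "act A B \<Phi> $ j $ i $ k = - act A B \<Phi> $ i $ j $ k" for i j k
  proof -
    have "(\<Sum>a\<in>UNIV. \<Sum>b\<in>UNIV. A $ j $ a * A $ i $ b * \<Phi> $ a $ b $ l) =
        - (\<Sum>a\<in>UNIV. \<Sum>b\<in>UNIV. A $ i $ a * A $ j $ b * \<Phi> $ a $ b $ l)" for l
      by (subst sum.swap, unfold sum_negf[symmetric], intro sum.cong refl neg)
    then show ?thesis by (simp add: act_nth sum_negf)
  qed
  \<comment> \<open>In characteristic 2 antisymmetry does not make the diagonal vanish, so the terms
    for \<open>(a, b)\<close> and \<open>(b, a)\<close> are cancelled in pairs.\<close>
  have diag: "act A B \<Phi> $ i $ i $ k = 0" for i k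
  proof -
    have "(\<Sum>a\<in>UNIV. \<Sum>b\<in>UNIV. A $ i $ a * A $ i $ b * \<Phi> $ a $ b $ l) = 0" for l
    proof -
      let ?f = "\<lambda>(a, b). A $ i $ a * A $ i $ b * \<Phi> $ a $ b $ l"
      have "(\<Sum>a\<in>UNIV. \<Sum>b\<in>UNIV. A $ i $ a * A $ i $ b * \<Phi> $ a $ b $ l) = sum ?f (UNIV \<times> UNIV)"
        by (simp add: sum.cartesian_product)
      also have "\<dots> = sum ?f ({(a, b). a < b} \<union> {(a, b). b < a} \<union> {(a, b). a = b})"
        by (rule sum.cong) auto
      also have "\<dots> = sum ?f {(a, b). a < b} + sum ?f {(a, b). b < a} + sum ?f {(a, b). a = b}"
        by (subst sum.union_disjoint; (subst sum.union_disjoint)?) auto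
      also have "sum ?f {(a, b). a = b} = 0"
        by (rule sum.neutral) (auto simp: X5_alternating(1)[OF assms])
      also have "sum ?f {(a, b). b < a} = sum (\<lambda>(a, b). ?f (b, a)) {(a, b). a < b}"
        by (rule sum.reindex_bij_witness[of _ prod.swap prod.swap]) auto
      also have "\<dots> = sum (\<lambda>(a, b). - ?f (a, b)) {(a, b). a < b}"
        by (rule sum.cong) (auto intro!: neg simp del: minus_mult_right minus_mult_left)
      finally show ?thesis by (simp add: sum_negf case_prod_unfold)
    qed
    then show ?thesis by (simp add: act_nth)
  qed
  show ?thesis unfolding pfaffian_models_def vec_eq_iff zero_index vector_uminus_component
    using alt diag by blast
qed

lemma sum_rotate4:
  "(\<Sum>a\<in>S. \<Sum>b\<in>T. \<Sum>c\<in>U. \<Sum>d\<in>V. f a b c d) = (\<Sum>c\<in>U. \<Sum>d\<in>V. \<Sum>a\<in>S. \<Sum>b\<in>T. f a b c d)"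
proof -
  have "(\<Sum>a\<in>S. \<Sum>b\<in>T. \<Sum>c\<in>U. \<Sum>d\<in>V. f a b c d) = (\<Sum>c\<in>U. \<Sum>a\<in>S. \<Sum>b\<in>T. \<Sum>d\<in>V. f a b c d)"
    by (simp only: sum.swap[of _ U])
  also have "\<dots> = (\<Sum>c\<in>U. \<Sum>d\<in>V. \<Sum>a\<in>S. \<Sum>b\<in>T. f a b c d)"
    by (simp only: sum.swap[of _ V])
  finally show ?thesis .
qed

text \<open>Row operations (\<open>N\<close>) combine the entries linearly, changes of variables act
  inside each entry. The two commute, and each is multiplicative by itself.\<close>

lemma act_act: "act A B (act A' B' \<Phi>) = act (A ** A') (B ** B') \<Phi>"
proof -
  define N where "N A \<Phi> = ((\<chi> (i::5) (j::5). \<Sum>a\<in>UNIV. \<Sum>b\<in>UNIV. (A $ i $ a * A $ j $ b) *s (\<Phi> $ a $ b)) :: 'a model)" for A :: "'a^5^5" and \<Phi> :: "'a model"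
  have N: "act A B \<Phi> = (\<chi> i j. B *v N A \<Phi> $ i $ j)" for A B \<Phi>
    by (simp add: act_def vec_eq_iff N_def)
  have mv_sum: "(\<Sum>x\<in>S. B *v f x) = B *v (\<Sum>x\<in>S. f x)" for B :: "'a^5^5" and f :: "5 \<Rightarrow> 'a^5" and S
    by (induction S rule: infinite_finite_induct) (auto simp: matrix_vector_right_distrib)
  have mv_scale: "c *s (B *v x) = B *v (c *s x)" for B :: "'a^5^5" and c x
    by (simp add: vec_eq_iff matrix_vector_mult_def sum_distrib_left mult_ac)
  have 1: "N A (\<chi> i j. B *v \<Phi> $ i $ j) = (\<chi> i j. B *v N A \<Phi> $ i $ j)" for A B \<Phi>
    by (simp add: vec_eq_iff N_def mv_sum mv_scale)
  have 2: "N A (N A' \<Phi>) = N (A ** A') \<Phi>"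
  proof -
    have prod_sum: "(\<Sum>a\<in>UNIV. f a) * (\<Sum>b\<in>UNIV. g b) * x = (\<Sum>a\<in>UNIV. \<Sum>b\<in>UNIV. f a * g b * x)"
      for f g :: "5 \<Rightarrow> 'a" and x
      by (subst sum_product) (simp only: sum_distrib_right)
    have "(\<Sum>a\<in>UNIV. \<Sum>b\<in>UNIV. A $ i $ a * A $ j $ b * (\<Sum>c\<in>UNIV. \<Sum>d\<in>UNIV. A' $ a $ c * A' $ b $ d * \<Phi> $ c $ d $ l)) =
      (\<Sum>c\<in>UNIV. \<Sum>d\<in>UNIV. (\<Sum>a\<in>UNIV. A $ i $ a * A' $ a $ c) * (\<Sum>b\<in>UNIV. A $ j $ b * A' $ b $ d) * \<Phi> $ c $ d $ l)" for i j l
      unfolding prod_sum unfolding sum_distrib_left by (subst sum_rotate4) (simp add: mult_ac)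
    then show ?thesis
      by (simp add: N_def vec_eq_iff matrix_matrix_mult_def)
  qed
  have "act A B (act A' B' \<Phi>) = (\<chi> i j. B *v (B' *v N A (N A' \<Phi>) $ i $ j))"
    by (simp add: N 1)
  also have "\<dots> = act (A ** A') (B ** B') \<Phi>"
    by (simp add: N 2 matrix_vector_mul_assoc)
  finally show ?thesis .
qed

definition diag_mat :: "(5 \<Rightarrow> 'a::comm_ring_1) \<Rightarrow> 'a^5^5"
  where "diag_mat d = (\<chi> i j. if i = j then d i else 0)"

lemma act_diag: "act (diag_mat a) (diag_mat b) \<Phi> $ i $ j $ k = a i * a j * b k * \<Phi> $ i $ j $ k"
proof -
  have "(\<Sum>x\<in>UNIV. \<Sum>y\<in>UNIV. (if i = x then a i else 0) * (if j = y then a j else 0) * \<Phi> $ x $ y $ l) = a i * a j * \<Phi> $ i $ j $ l" for l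
  proof -
    have "(\<Sum>y\<in>UNIV. (if i = x then a i else 0) * (if j = y then a j else 0) * \<Phi> $ x $ y $ l) =
      (if i = x then a i * a j * \<Phi> $ i $ j $ l else 0)" for x
      by (simp add: if_distrib[of "\<lambda>u. u * _"] if_distrib[of "\<lambda>u. _ * u"] cong: if_cong)
    then show ?thesis by simp
  qed
  then have "act (diag_mat a) (diag_mat b) \<Phi> $ i $ j $ k = (\<Sum>l\<in>UNIV. (if k = l then b k else 0) * (a i * a j * \<Phi> $ i $ j $ l))"
    by (simp add: act_nth diag_mat_def)
  also have "\<dots> = b k * (a i * a j * \<Phi> $ i $ j $ k)"
    by (simp add: if_distrib[of "\<lambda>u. u * _"] cong: if_cong)
  finally show ?thesis by (simp add: mult_ac)
qed

lemma det_diag_mat: "det (diag_mat d) = (\<Prod>i\<in>UNIV. d i)"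
  unfolding diag_mat_def by (subst det_diagonal) auto

lemma GL5_UNIV_iff_det: "A \<in> GL5 (UNIV :: 'k::field set) \<longleftrightarrow> det A \<noteq> 0"
  unfolding invertible_det_nz[symmetric] by (simp add: GL5_def invertible_def)

section \<open>Transfer of invariance\<close>

lemma int_eval_det: "int_eval x (det A) = det (\<chi> i j. int_eval x (A $ i $ j))"
  by (simp add: det_def)

lemma int_eval_eval_model:
  "int_eval x (eval_model p \<Phi>) = eval_model p (\<chi> i j k. int_eval x (\<Phi> $ i $ j $ k))"
  by (simp add: eval_model_alt int_eval_compose case_prod_unfold)

lemma int_eval_act:
  "(\<chi> i j k. int_eval x (act A B \<Phi> $ i $ j $ k)) =
    act (\<chi> i j. int_eval x (A $ i $ j)) (\<chi> i j. int_eval x (B $ i $ j)) (\<chi> i j k. int_eval x (\<Phi> $ i $ j $ k))"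
  by (simp add: vec_eq_iff act_nth)

text \<open>The identity is proved once for generic matrices and a generic model with polynomial
  entries and then specialised. It thus covers singular matrices and polynomial rings, as the
  first-order expansions require.\<close>

theorem invariance_any_ring:
  fixes \<Phi> :: "'a::comm_ring_1 model"
  assumes inv: "invariant_of_weight w p" and \<Phi>: "\<Phi> \<in> X\<^sub>5 R"
  shows "eval_model p (act A B \<Phi>) = act_det A B ^ w * eval_model p \<Phi>"
proof -
  \<comment> \<open>Numbering the variables by natural numbers gives the monomials a linear order,
    so that the polynomial ring is a domain and factors can be cancelled.\<close>
  define x :: "(5 \<times> 5) + (5 \<times> 5) + (5 \<times> 5 \<times> 5) \<Rightarrow> (nat, int) mvpoly" where "x v = var (to_nat v)" for v
  define gA :: "(nat, int) mvpoly^5^5" where "gA = (\<chi> i j. x (Inl (i, j)))"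
  define gB :: "(nat, int) mvpoly^5^5" where "gB = (\<chi> i j. x (Inr (Inl (i, j))))"
  define g\<Phi> :: "(nat, int) mvpoly model" where "g\<Phi> = coord_model (\<lambda>v. x (Inr (Inr v)))"
  define P where "P = eval_model p (act gA gB g\<Phi>) - act_det gA gB ^ w * eval_model p g\<Phi>"
  have P: "int_eval y P = eval_model p (act (\<chi> i j. int_eval y (gA $ i $ j)) (\<chi> i j. int_eval y (gB $ i $ j)) (\<chi> i j k. int_eval y (g\<Phi> $ i $ j $ k)))
      - act_det (\<chi> i j. int_eval y (gA $ i $ j)) (\<chi> i j. int_eval y (gB $ i $ j)) ^ w * eval_model p (\<chi> i j k. int_eval y (g\<Phi> $ i $ j $ k))" for y :: "nat \<Rightarrow> 'c::comm_ring_1"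
    by (simp add: P_def int_eval_eval_model int_eval_act act_det_def int_eval_det)
  have g\<Phi>: "(\<chi> i j k. int_eval y (g\<Phi> $ i $ j $ k)) \<in> X\<^sub>5 UNIV" for y :: "nat \<Rightarrow> 'c::comm_ring_1"
    by (auto simp: g\<Phi>_def pfaffian_models_def vec_eq_iff)
  \<comment> \<open>The determinants take care of the points with a singular matrix. They are
    cancelled afterwards, being nonzero at the identity matrix.\<close>
  have "P * (det gA * det gB) = 0"
  proof (rule int_eval_complex_eq_0)
    fix y :: "nat \<Rightarrow> complex"
    show "int_eval y (P * (det gA * det gB)) = 0"
    proof (cases "int_eval y (det gA) = 0 \<or> int_eval y (det gB) = 0")
      case False
      then have "(\<chi> i j. int_eval y (gA $ i $ j)) \<in> GL5 UNIV" "(\<chi> i j. int_eval y (gB $ i $ j)) \<in> GL5 UNIV"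
        by (simp_all add: GL5_UNIV_iff_det int_eval_det)
      then have "int_eval y P = 0"
        using inv g\<Phi>[of y] unfolding P invariant_of_weight_def by simp
      then show ?thesis by simp
    qed auto
  qed
  moreover have "det gA \<noteq> 0"
  proof
    assume "det gA = 0"
    then have "int_eval (\<lambda>n. case from_nat n :: (5 \<times> 5) + (5 \<times> 5) + (5 \<times> 5 \<times> 5) of Inl (i, j) \<Rightarrow> if i = j then (1 :: complex) else 0 | _ \<Rightarrow> 0) (det gA) = 0"
      by simp
    then have "det (mat 1 :: complex^5^5) = 0"
      by (simp add: int_eval_det gA_def x_def mat_def)
    then show False by simp
  qed
  moreover have "det gB \<noteq> 0"
  proof
    assume "det gB = 0"
    then have "int_eval (\<lambda>n. case from_nat n :: (5 \<times> 5) + (5 \<times> 5) + (5 \<times> 5 \<times> 5) of Inr (Inl (i, j)) \<Rightarrow> if i = j then (1 :: complex) else 0 | _ \<Rightarrow> 0) (det gB) = 0"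
      by simp
    then have "det (mat 1 :: complex^5^5) = 0"
      by (simp add: int_eval_det gB_def x_def mat_def)
    then show False by simp
  qed
  ultimately have "P = 0" by simp
  define y :: "nat \<Rightarrow> 'a" where "y n = (case from_nat n :: (5 \<times> 5) + (5 \<times> 5) + (5 \<times> 5 \<times> 5) of
    Inl (i, j) \<Rightarrow> A $ i $ j | Inr (Inl (i, j)) \<Rightarrow> B $ i $ j | Inr (Inr (i, j, k)) \<Rightarrow> \<Phi> $ i $ j $ k)" for n
  have "(\<chi> i j. int_eval y (gA $ i $ j)) = A" "(\<chi> i j. int_eval y (gB $ i $ j)) = B"
    by (simp_all add: vec_eq_iff gA_def gB_def x_def y_def)
  moreover have "(\<chi> i j k. int_eval y (g\<Phi> $ i $ j $ k)) = coord_model (\<lambda>(i, j, k). \<Phi> $ i $ j $ k)"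
    by (simp add: vec_eq_iff g\<Phi>_def x_def y_def)
  ultimately show ?thesis
    using \<open>P = 0\<close> P[of y] coord_model_coords[OF \<Phi>] by simp
qed

section \<open>Monomial weights\<close>

definition mono_weight :: "('x \<Rightarrow> int) \<Rightarrow> ('x \<Rightarrow>\<^sub>0 nat) \<Rightarrow> int"
  where "mono_weight t m = (\<Sum>v\<in>Poly_Mapping.keys m. int (Poly_Mapping.lookup m v) * t v)"

lemma mono_weight_superset:
  assumes "finite S" "Poly_Mapping.keys m \<subseteq> S"
  shows "mono_weight t m = (\<Sum>v\<in>S. int (Poly_Mapping.lookup m v) * t v)"
  unfolding mono_weight_def by (rule sum.mono_neutral_left) (use assms in \<open>auto simp: in_keys_iff\<close>)

lemma mono_weight_add: "mono_weight t (m + n) = mono_weight t m + mono_weight t n"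
proof -
  let ?S = "Poly_Mapping.keys m \<union> Poly_Mapping.keys n"
  have "mono_weight t (m + n) = (\<Sum>i\<in>?S. int (Poly_Mapping.lookup (m + n) i) * t i)"
    by (rule mono_weight_superset) (use keys_add[of m n] in auto)
  then show ?thesis
    by (simp add: mono_weight_superset[of ?S] lookup_add distrib_right sum.distrib)
qed

lemma mono_weight_single [simp]: "mono_weight t (Poly_Mapping.single v n) = int n * t v"
  by (simp add: mono_weight_def)

lemma mono_eval_powi:
  fixes z :: "'a::field"
  assumes "z \<noteq> 0"
  shows "mono_eval (\<lambda>v. z powi t v) m = z powi mono_weight t m"
proof -
  have "z powi (\<Sum>v\<in>S. f v) = (\<Prod>v\<in>S. z powi f v)" for S :: "'b set" and f
    by (induction S rule: infinite_finite_induct) (use assms in \<open>auto simp: power_int_add\<close>)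
  moreover have "(z powi t v) ^ n = z powi (int n * t v)" for n v
    by (simp add: power_int_mult power_int_power' mult.commute)
  ultimately show ?thesis by (simp add: mono_eval_def mono_weight_def)
qed

lemma powi_two_inject:
  assumes "(2 :: complex) powi a = 2 powi b" shows "a = b"
proof (rule ccontr)
  assume "a \<noteq> b"
  have "norm ((2 :: complex) powi a) = norm ((2 :: complex) powi b)" by (simp only: assms)
  then have "(2::real) powi a = 2 powi b" by (simp add: norm_power_int)
  with \<open>a \<noteq> b\<close> show False
    using power_int_strict_increasing[of a b "2::real"] power_int_strict_increasing[of b a "2::real"] by linarith
qed

text \<open>The scaling multiplies \<open>m\<close> by \<open>2 powi mono_weight t m\<close>. By
  independence of monomials this factor is \<open>2 powi N\<close>, and 2 has infinite
  order.\<close>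

lemma weight_of_semi_invariant:
  fixes p :: "('x, int) mvpoly"
  assumes "\<And>x :: 'x \<Rightarrow> complex. int_eval (\<lambda>v. 2 powi t v * x v) p = 2 powi N * int_eval x p"
    and "m \<in> Poly_Mapping.keys p"
  shows "mono_weight t m = N"
proof -
  have "of_int (Poly_Mapping.lookup p m) * (2 powi mono_weight t m - 2 powi N) = (0 :: complex)"
  proof (rule monomials_independent[OF finite_keys _ assms(2)])
    fix x :: "'x \<Rightarrow> complex"
    show "(\<Sum>m\<in>Poly_Mapping.keys p. of_int (Poly_Mapping.lookup p m) * (2 powi mono_weight t m - 2 powi N) * mono_eval x m) = 0"
      using assms(1)[of x] by (simp add: int_eval_alt mono_eval_mult mono_eval_powi algebra_simps sum_subtractf sum_distrib_left)
  qed
  then show ?thesis using assms(2) by (auto simp: in_keys_iff dest: powi_two_inject)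
qed

definition coord_weight :: "(5 \<Rightarrow> int) \<Rightarrow> (5 \<Rightarrow> int) \<Rightarrow> 5 \<times> 5 \<times> 5 \<Rightarrow> int"
  where "coord_weight r s = (\<lambda>(i, j, k). r i + r j + s k)"

lemma torus_action:
  fixes z :: "'a::field"
  assumes inv: "invariant_of_weight w p" "p \<in> model_polys" and "z \<noteq> 0"
  shows "int_eval (\<lambda>v. z powi coord_weight r s v * \<psi> v) p =
     z powi (int w * (2 * sum r UNIV + sum s UNIV)) * int_eval \<psi> p"
proof -
  let ?A = "diag_mat (\<lambda>i. z powi r i)" and ?B = "diag_mat (\<lambda>i. z powi s i)"
  have sum_powi: "(\<Prod>v\<in>S. z powi f v) = z powi (\<Sum>v\<in>S. f v)" for S :: "5 set" and f
    by (induction S rule: infinite_finite_induct) (use assms in \<open>auto simp: power_int_add\<close>)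
  have "coord_model (\<lambda>v. z powi coord_weight r s v * \<psi> v) = act ?A ?B (coord_model \<psi>)"
    using assms(3) by (simp add: vec_eq_iff act_diag coord_weight_def power_int_add mult_ac)
  moreover have "act_det ?A ?B ^ w = z powi (int w * (2 * sum r UNIV + sum s UNIV))"
  proof -
    have "act_det ?A ?B = z powi (2 * sum r UNIV + sum s UNIV)"
      using assms(3) by (simp add: act_det_def det_diag_mat sum_powi power_int_add mult.commute[of 2] power_int_mult)
    then show ?thesis by (simp add: power_int_mult mult.commute[of "int w"])
  qed
  ultimately show ?thesis
    using invariance_any_ring[OF inv(1) coord_model_in[of \<psi>], of ?A ?B]
    by (simp flip: eval_model_coord[OF inv(2)])
qed

text \<open>Taking an indicator function for \<open>r\<close> or \<open>s\<close> shows that every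
  row index occurs \<open>2 * w\<close> times and every variable \<open>w\<close> times in each
  monomial.\<close>

lemma invariant_weight:
  assumes "invariant_of_weight w p" "p \<in> model_polys" "m \<in> Poly_Mapping.keys p"
  shows "mono_weight (coord_weight r s) m = int w * (2 * sum r UNIV + sum s UNIV)"
  by (rule weight_of_semi_invariant[OF torus_action[OF assms(1,2)] assms(3)]) simp

section \<open>Selecting edges\<close>

text \<open>Choose five rows of the coefficient matrix of a model with nonzero determinant and maximal
  weight; the standard basis vectors serve as rows of weight \<open>-N\<close> so that a choice exists.
  After the change of variables making these rows the standard basis, exchanging one row shows that
  every coefficient in the variable \<open>k\<close> belongs to a row of weight at most that of the \<open>k\<close>-th chosen row.\<close>

lemma row_selection:
  fixes \<psi> :: "5 \<times> 5 \<times> 5 \<Rightarrow> complex" and y :: "5 \<Rightarrow> int"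
  assumes inv: "invariant_of_weight w p" "p \<in> model_polys" and w: "w > 0"
    and nz: "int_eval \<psi> p \<noteq> 0"
  obtains H :: "5 \<Rightarrow> 5 \<times> 5"
  where "\<And>k. fst (H k) < snd (H k)" "det (\<chi> k l. \<psi> (fst (H k), snd (H k), l)) \<noteq> 0"
    "(\<Sum>k\<in>UNIV. y (fst (H k)) + y (snd (H k))) \<ge> 2 * sum y UNIV"
proof -
  \<comment> \<open>Every weight \<open>y i + y j\<close> exceeds \<open>- N\<close>, so a standard
    basis row weighs less than any row of the model.\<close>
  define N where "N = 1 + 2 * (\<Sum>i\<in>UNIV. \<bar>y i\<bar>)"
  define row_of :: "(5 \<times> 5) + 5 \<Rightarrow> complex^5" where
    "row_of x = (case x of Inl (i, j) \<Rightarrow> \<chi> l. \<psi> (i, j, l) | Inr k \<Rightarrow> axis k 1)" for x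
  define wt :: "(5 \<times> 5) + 5 \<Rightarrow> int" where
    "wt x = (case x of Inl (i, j) \<Rightarrow> y i + y j | Inr k \<Rightarrow> - N)" for x
  define valid :: "(5 \<times> 5) + 5 \<Rightarrow> bool" where
    "valid x = (case x of Inl (i, j) \<Rightarrow> i < j | Inr k \<Rightarrow> True)" for x
  define M :: "(5 \<Rightarrow> (5 \<times> 5) + 5) \<Rightarrow> complex^5^5" where "M H = (\<chi> k. row_of (H k))" for H
  define S where "S = {H. (\<forall>k. valid (H k)) \<and> det (M H) \<noteq> 0}"
  define f where "f H = (\<Sum>k\<in>UNIV. wt (H k))" for H :: "5 \<Rightarrow> (5 \<times> 5) + 5"
  have "M Inr = mat 1" by (simp add: M_def row_of_def mat_def axis_def vec_eq_iff eq_commute)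
  then have "Inr \<in> S" by (simp add: S_def valid_def)
  have fin: "finite S" by simp
  then have "Max (f ` S) \<in> f ` S" using \<open>Inr \<in> S\<close> by (intro Max_in) auto
  then obtain H where H: "H \<in> S" and fH: "f H = Max (f ` S)" by auto
  have max: "f H' \<le> f H" if "H' \<in> S" for H'
    unfolding fH using that fin by (intro Max_ge) auto
  have detH: "det (M H) \<noteq> 0" and validH: "\<And>k. valid (H k)" using H by (auto simp: S_def)
  have wt_real: "- N < y i + y j" for i j
  proof -
    have "\<bar>y i\<bar> \<le> (\<Sum>i\<in>UNIV. \<bar>y i\<bar>)" "\<bar>y j\<bar> \<le> (\<Sum>i\<in>UNIV. \<bar>y i\<bar>)"
      by (rule member_le_sum; simp)+
    then show ?thesis unfolding N_def by linarith
  qed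
  \<comment> \<open>The columns of \<open>Q\<close> are the chosen rows; its inverse
    \<open>B\<close> gives coordinates with respect to them.\<close>
  define Q where "Q = transpose (M H)"
  have "invertible Q" using detH by (simp add: Q_def invertible_det_nz)
  then obtain B where B: "Q ** B = mat 1" "B ** Q = mat 1" by (auto simp: invertible_def)
  have bound: "y i + y j \<le> wt (H k)" if "i < j" "(B *v row_of (Inl (i, j))) $ k \<noteq> 0" for i j k
  proof -
    define x where "x = B *v row_of (Inl (i, j))"
    have "row_of (Inl (i, j)) = Q *v x"
      by (simp add: x_def matrix_vector_mul_assoc B)
    also have "\<dots> = (\<Sum>l\<in>UNIV. x $ l *s row l (M H))"
      by (simp add: Q_def matrix_mult_sum column_transpose)
    finally have "M (H(k := Inl (i, j))) = (\<chi> l. if l = k then \<Sum>l\<in>UNIV. x $ l *s row l (M H) else row l (M H))"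
      by (simp add: M_def row_def vec_eq_iff)
    \<comment> \<open>By Cramer's rule the exchange multiplies the determinant by the coordinate
      \<open>x $ k\<close>. If this is nonzero, the new choice is admissible and cannot have larger
      weight.\<close>
    then have "det (M (H(k := Inl (i, j)))) = x $ k * det (M H)"
      by (simp add: cramer_lemma_transpose)
    then have "H(k := Inl (i, j)) \<in> S"
      using that detH validH by (auto simp: S_def x_def valid_def)
    from max[OF this] show ?thesis
      by (simp add: f_def wt_def sum.remove[of UNIV k])
  qed
  define \<psi>' where "\<psi>' = (\<lambda>(i, j, k). (B *v row_of (Inl (i, j))) $ k)"
  have "act (mat 1) B (coord_model \<psi>) = coord_model \<psi>'"
  proof -
    have "act (mat 1) B \<Phi> $ i $ j = B *v \<Phi> $ i $ j" for \<Phi> :: "complex model" and i j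
    proof -
      have "(\<Sum>b\<in>UNIV. (if i = a then 1 else 0) * (if j = b then 1 else 0) * \<Phi> $ a $ b $ l) = (if i = a then \<Phi> $ i $ j $ l else 0)" for a l
        by (simp add: if_distrib[of "\<lambda>u. u * _"] cong: if_cong)
      then show ?thesis by (simp add: vec_eq_iff act_nth mat_def matrix_vector_mult_def)
    qed
    then show ?thesis
      by (simp add: vec_eq_iff \<psi>'_def row_of_def matrix_vector_mult_def sum_negf)
  qed
  moreover have "det B \<noteq> 0" using B(2) by (metis det_I det_mul mult_zero_left zero_neq_one)
  ultimately have "int_eval \<psi>' p \<noteq> 0"
    using invariance_any_ring[OF inv(1) coord_model_in[of \<psi>], of "mat 1" B] nz
    by (simp add: eval_model_coord[OF inv(2)] act_det_def)
  then obtain m where m: "m \<in> Poly_Mapping.keys p" "mono_eval \<psi>' m \<noteq> 0"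
    unfolding int_eval_alt by (metis (mono_tags, lifting) mult_zero_right sum.neutral)
  have supp: "i < j \<and> y i + y j \<le> wt (H k)" if "(i, j, k) \<in> Poly_Mapping.keys m" for i j k
  proof -
    have "i < j" using that m(1) inv(2) by (auto simp: model_polys_def)
    moreover have "\<psi>' (i, j, k) \<noteq> 0"
      using m(2) that by (auto simp: mono_eval_def in_keys_iff)
    ultimately show ?thesis using bound[of i j k] by (simp add: \<psi>'_def)
  qed
  \<comment> \<open>One monomial is weighed in two ways: by \<open>y\<close> on its rows, which
    gives \<open>w * (2 * sum y UNIV)\<close>, and by the weights of the chosen rows on its
    variables, which gives \<open>w * f H\<close>. Factor by factor the first weight is at most the
    second.\<close>
  have "mono_weight (coord_weight y (\<lambda>_. 0)) m \<le> mono_weight (coord_weight (\<lambda>_. 0) (\<lambda>k. wt (H k))) m"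
    unfolding mono_weight_def
    by (intro sum_mono mult_left_mono) (auto simp: coord_weight_def dest: supp)
  then have "int w * (2 * sum y UNIV) \<le> int w * f H"
    by (simp add: invariant_weight[OF inv m(1)] f_def)
  then have le: "2 * sum y UNIV \<le> f H" using w by simp
  \<comment> \<open>If row \<open>k\<close> were a standard basis row, its weight would be below
    that of all rows in \<open>m\<close>, so the variable \<open>k\<close> would be missing from
    \<open>m\<close>, although it must occur \<open>w\<close> times.\<close>
  have "\<exists>i j. H k = Inl (i, j)" for k
  proof (rule ccontr)
    assume "\<nexists>i j. H k = Inl (i, j)"
    then have "wt (H k) = - N" by (auto simp: wt_def split: sum.splits)
    then have "k' \<noteq> k" if "(i, j, k') \<in> Poly_Mapping.keys m" for i j k'
      using supp[OF that] wt_real[of i j] by auto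
    then have "mono_weight (coord_weight (\<lambda>_. 0) (\<lambda>k'. of_bool (k' = k))) m = 0"
      unfolding mono_weight_def by (intro sum.neutral) (auto simp: coord_weight_def)
    then show False using w by (simp add: invariant_weight[OF inv m(1)])
  qed
  then have "\<forall>k. \<exists>e. H k = Inl e" by blast
  then obtain h where "\<forall>k. H k = Inl (h k)" by (rule choice[THEN exE])
  then have h: "\<And>k. H k = Inl (h k)" by blast
  show thesis
  proof (rule that[of h])
    show "fst (h k) < snd (h k)" for k
      using validH[of k] by (simp add: h valid_def case_prod_unfold)
    have "M H = (\<chi> k l. \<psi> (fst (h k), snd (h k), l))"
      by (simp add: M_def row_of_def h case_prod_unfold)
    then show "det (\<chi> k l. \<psi> (fst (h k), snd (h k), l)) \<noteq> 0" using detH by simp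
    show "(\<Sum>k\<in>UNIV. y (fst (h k)) + y (snd (h k))) \<ge> 2 * sum y UNIV"
      using le by (simp add: f_def wt_def h case_prod_unfold)
  qed
qed

text \<open>A nonvanishing term of the determinant assigns five different variables with nonzero
  coefficients to the chosen rows. These are distinct because the determinant is nonzero.\<close>

lemma edge_selection:
  fixes \<psi> :: "5 \<times> 5 \<times> 5 \<Rightarrow> complex" and y :: "5 \<Rightarrow> int"
  assumes "invariant_of_weight w p" "p \<in> model_polys" "w > 0" "int_eval \<psi> p \<noteq> 0"
  obtains H :: "5 \<Rightarrow> 5 \<times> 5"
  where "inj H" "\<And>k. fst (H k) < snd (H k)" "\<And>k. \<psi> (fst (H k), snd (H k), k) \<noteq> 0"
    "(\<Sum>k\<in>UNIV. y (fst (H k)) + y (snd (H k))) \<ge> 2 * sum y UNIV"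
proof -
  obtain H :: "5 \<Rightarrow> 5 \<times> 5" where H: "\<And>k. fst (H k) < snd (H k)"
    "det (\<chi> k l. \<psi> (fst (H k), snd (H k), l)) \<noteq> 0"
    "(\<Sum>k\<in>UNIV. y (fst (H k)) + y (snd (H k))) \<ge> 2 * sum y UNIV"
    by (rule row_selection[OF assms, of y]) blast
  have "\<exists>q. q permutes UNIV \<and> (\<Prod>i\<in>UNIV. \<psi> (fst (H i), snd (H i), q i)) \<noteq> 0"
  proof (rule ccontr)
    assume "\<nexists>q. q permutes UNIV \<and> (\<Prod>i\<in>UNIV. \<psi> (fst (H i), snd (H i), q i)) \<noteq> 0"
    then have "det (\<chi> k l. \<psi> (fst (H k), snd (H k), l)) = 0"
      unfolding det_def by (intro sum.neutral) auto
    with H(2) show False by simp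
  qed
  then obtain q where q: "bij q" "\<And>i. \<psi> (fst (H i), snd (H i), q i) \<noteq> 0"
    by (auto dest: permutes_bij)
  have inj: "inj H"
  proof (rule injI, rule ccontr)
    fix a b assume "H a = H b" "a \<noteq> b"
    then have "det (\<chi> k l. \<psi> (fst (H k), snd (H k), l)) = 0"
      by (intro det_identical_rows[of a b]) (auto simp: row_def)
    with H(2) show False by simp
  qed
  define q' where "q' = Hilbert_Choice.inv q"
  have bij: "bij q'" unfolding q'_def using q(1) by (rule bij_imp_bij_inv)
  show thesis
  proof (rule that[of "H \<circ> q'"])
    show "inj (H \<circ> q')" using inj bij by (simp add: inj_compose bij_is_inj)
    show "fst ((H \<circ> q') k) < snd ((H \<circ> q') k)" for k using H(1) by simp
    show "\<psi> (fst ((H \<circ> q') k), snd ((H \<circ> q') k), k) \<noteq> 0" for k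
      using q(2)[of "q' k"] q(1) by (simp add: q'_def bij_is_surj surj_f_inv_f)
    have "(\<Sum>k\<in>UNIV. y (fst (H (q' k))) + y (snd (H (q' k)))) = (\<Sum>k\<in>UNIV. y (fst (H k)) + y (snd (H k)))"
      by (rule sum.reindex_bij_betw[OF bij])
    then show "(\<Sum>k\<in>UNIV. y (fst ((H \<circ> q') k)) + y (snd ((H \<circ> q') k))) \<ge> 2 * sum y UNIV"
      using H(3) by simp
  qed
qed

text \<open>Setting the variables outside \<open>S\<close> to zero removes exactly the monomials
  that involve them. What remains still contains \<open>m\<close>, so it is a nonzero
  polynomial.\<close>

lemma exists_supported_nonzero:
  fixes p :: "('x, int) mvpoly"
  assumes "m \<in> Poly_Mapping.keys p" "Poly_Mapping.keys m \<subseteq> S"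
  obtains \<psi> :: "'x \<Rightarrow> complex" where "\<And>v. v \<notin> S \<Longrightarrow> \<psi> v = 0" "int_eval \<psi> p \<noteq> 0"
proof (rule ccontr)
  assume "\<not> thesis"
  then have zero: "int_eval (\<lambda>v. if v \<in> S then x v else 0) p = 0" for x :: "'x \<Rightarrow> complex"
    using that[of "\<lambda>v. if v \<in> S then x v else 0"] by auto
  let ?F = "{m \<in> Poly_Mapping.keys p. Poly_Mapping.keys m \<subseteq> S}"
  have "of_int (Poly_Mapping.lookup p m) = (0 :: complex)"
  proof (rule monomials_independent[of ?F])
    fix x :: "'x \<Rightarrow> complex"
    have "(\<Sum>m\<in>?F. of_int (Poly_Mapping.lookup p m) * mono_eval x m) =
       (\<Sum>m\<in>?F. of_int (Poly_Mapping.lookup p m) * mono_eval (\<lambda>v. if v \<in> S then x v else 0) m)"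
      by (intro sum.cong refl arg_cong2[of _ _ _ _ "(*)"]) (auto simp: mono_eval_def intro!: prod.cong)
    also have "\<dots> = int_eval (\<lambda>v. if v \<in> S then x v else 0) p"
      unfolding int_eval_alt
    proof (rule sum.mono_neutral_left)
      show "\<forall>m\<in>Poly_Mapping.keys p - ?F. of_int (Poly_Mapping.lookup p m) * mono_eval (\<lambda>v. if v \<in> S then x v else 0) m = 0"
        by (auto simp: mono_eval_def in_keys_iff)
    qed auto
    finally show "(\<Sum>m\<in>?F. of_int (Poly_Mapping.lookup p m) * mono_eval x m) = 0"
      by (simp add: zero)
  qed (use assms in auto)
  then show False using assms(1) by (simp add: in_keys_iff)
qed

section \<open>Pentagons\<close>

lemma UNIV_5: "(UNIV :: 5 set) = {0, 1, 2, 3, 4}"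
proof -
  have "{0, 1, 2, 3, 4} = (UNIV :: 5 set)" by (rule card_subset_eq) auto
  then show ?thesis by simp
qed

lemma mset_set_UNIV_5: "mset_set (UNIV :: 5 set) = {# 0, 1, 2, 3, 4 #}"
  unfolding UNIV_5 by simp

lemma UNIV_distinct5:
  assumes "distinct [a, b, c, d, e :: 5]"
  shows "UNIV = {a, b, c, d, e}"
proof -
  have "{a, b, c, d, e} = (UNIV :: 5 set)" by (rule card_subset_eq) (use assms in auto)
  then show ?thesis by simp
qed

lemma sum_UNIV_5:
  fixes f :: "5 \<Rightarrow> int"
  assumes "distinct [a, b, c, d, e]"
  shows "sum f UNIV = f a + f b + f c + f d + f e"
  unfolding UNIV_distinct5[OF assms] using assms by (simp add: add_ac)

definition has_pentagon :: "(5 \<Rightarrow> int) \<Rightarrow> (5 \<Rightarrow> int) \<Rightarrow> bool"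
  where "has_pentagon r s \<longleftrightarrow> (\<exists>(\<sigma> :: 5 \<Rightarrow> 5) (\<tau> :: 5 \<Rightarrow> 5). bij \<sigma> \<and> bij \<tau> \<and> (\<forall>i. r (\<sigma> i) + r (\<sigma> (i + 1)) + s (\<tau> i) = 0))"

text \<open>The permutation of the variables in \<open>has_pentagon\<close> is free, so only the
  multiset of the numbers \<open>- s k\<close> matters; an equality of multisets supplies the
  permutation.\<close>

definition label_values :: "(5 \<Rightarrow> int) \<Rightarrow> int multiset"
  where "label_values s = image_mset (\<lambda>k. - s k) (mset_set UNIV)"

lemma has_pentagonI:
  assumes "distinct [a, b, c, d, e]"
    and "label_values s = {# r a + r b, r b + r c, r c + r d, r d + r e, r e + r a #}"
  shows "has_pentagon r s"
proof -
  define \<sigma> :: "5 \<Rightarrow> 5" where "\<sigma> i = (if i = 0 then a else if i = 1 then b else if i = 2 then c else if i = 3 then d else e)" for i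
  have "UNIV = range \<sigma>"
  proof -
    have "range \<sigma> = {a, b, c, d, e}" by (subst UNIV_5) (auto simp: \<sigma>_def)
    then show ?thesis using UNIV_distinct5[OF assms(1)] by simp
  qed
  then have bij: "bij \<sigma>" by (simp add: bij_def finite_UNIV_surj_inj)
  have "image_mset (\<lambda>i. r (\<sigma> i) + r (\<sigma> (i + 1))) (mset_set UNIV) = label_values s"
    unfolding assms(2) mset_set_UNIV_5 by (simp add: \<sigma>_def)
  then have "image_mset (\<lambda>i. r (\<sigma> i) + r (\<sigma> (i + 1))) (mset_set UNIV) = image_mset (\<lambda>k. - s k) (mset_set UNIV)"
    by (simp add: label_values_def)
  then obtain \<tau> where "\<tau> permutes UNIV" "\<forall>i\<in>UNIV. r (\<sigma> i) + r (\<sigma> (i + 1)) = - s (\<tau> i)"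
    by (rule image_mset_eq_implies_permutes[rotated]) auto
  then show ?thesis
    unfolding has_pentagon_def using bij by (intro exI[of _ \<sigma>] exI[of _ \<tau>]) (auto dest: permutes_bij)
qed

lemma has_pentagonI2:
  assumes "distinct [a, b, c, d, e]" "label_values s = {# v1, v2, v3, v4, v5 #}"
    and "v1 = r a + r b" "v2 = r b + r c" "v3 = r c + r d" "v4 = r d + r e" "v5 = r e + r a"
  shows "has_pentagon r s"
  using has_pentagonI[OF assms(1)] assms(2-) by blast

lemma card_2_memE:
  assumes "card X = 2" "v \<in> X"
  obtains w where "X = {v, w}" "w \<noteq> v"
proof -
  from assms(1) obtain p q where pq: "X = {p, q}" "p \<noteq> q" by (auto simp: card_2_iff)
  show thesis
  proof (cases "v = p")
    case True then show ?thesis using that[of q] pq by auto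
  next
    case False then show ?thesis using that[of p] pq assms(2) by auto
  qed
qed

text \<open>The rows are the vertices of a complete graph, and \<open>U k\<close> is the edge of an entry \<open>\<Phi>\<^sub>i\<^sub>j\<close> in which
  the variable \<open>x\<^sub>k\<close> has weight \<open>r\<^sub>i + r\<^sub>j + s\<^sub>k = 0\<close>. An edge may be exchanged for any unused one with the same
  sum \<open>r\<^sub>i + r\<^sub>j\<close>; the aim is to reach a 5-cycle.\<close>

locale edge_labelling =
  fixes r s :: "5 \<Rightarrow> int" and U :: "5 \<Rightarrow> 5 set"
  assumes inj: "inj U" and card2: "card (U k) = 2" and val: "sum r (U k) = - s k"
    and total: "2 * sum r UNIV + sum s UNIV = 0"
begin

section \<open>The graph with five edges on five vertices and its degrees\<close>

definition nbs :: "5 \<Rightarrow> 5 set" where "nbs v = {w. {v, w} \<in> range U}"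

lemma nbs_sym: "w \<in> nbs v \<longleftrightarrow> v \<in> nbs w"
  by (simp add: nbs_def insert_commute)

lemma nbs_irrefl: "v \<notin> nbs v"
proof
  assume "v \<in> nbs v"
  then obtain k where "U k = {v}" by (auto simp: nbs_def)
  then show False using card2[of k] by simp
qed

lemma card_nbs: "card (nbs v) = card {k. v \<in> U k}"
proof -
  have "bij_betw (\<lambda>w. {v, w}) (nbs v) {X \<in> range U. v \<in> X}"
  proof (rule bij_betwI')
    show "({v, x} = {v, y}) = (x = y)" for x y by (auto simp: doubleton_eq_iff)
    show "\<exists>x\<in>nbs v. y = {v, x}" if "y \<in> {X \<in> range U. v \<in> X}" for y
    proof -
      from that obtain k where "y = U k" "v \<in> U k" by auto
      moreover obtain w where "U k = {v, w}" using card_2_memE[OF card2 \<open>v \<in> U k\<close>] by blast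
      ultimately show ?thesis by (auto simp: nbs_def)
    qed
  qed (auto simp: nbs_def)
  then have "card (nbs v) = card {X \<in> range U. v \<in> X}" by (rule bij_betw_same_card)
  also have "{X \<in> range U. v \<in> X} = U ` {k. v \<in> U k}" by auto
  also have "card \<dots> = card {k. v \<in> U k}"
    by (intro card_image) (use inj in \<open>auto simp: inj_on_def\<close>)
  finally show ?thesis .
qed

text \<open>Double counting of incident pairs of a vertex and an edge.\<close>

lemma sum_edges: "(\<Sum>k\<in>UNIV. sum y (U k)) = (\<Sum>v\<in>UNIV. int (card (nbs v)) * y v)"
proof -
  have "(\<Sum>k\<in>UNIV. sum y (U k)) = (\<Sum>k\<in>UNIV. \<Sum>v\<in>UNIV. of_bool (v \<in> U k) * y v)"
    by (simp add: sum.If_cases Int_def of_bool_def if_distrib[of "\<lambda>u. u * _"] cong: if_cong)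
  also have "\<dots> = (\<Sum>v\<in>UNIV. \<Sum>k\<in>UNIV. of_bool (v \<in> U k) * y v)" by (rule sum.swap)
  also have "\<dots> = (\<Sum>v\<in>UNIV. int (card (nbs v)) * y v)"
    by (simp add: card_nbs sum_distrib_right[symmetric] of_bool_def sum.If_cases Int_def)
  finally show ?thesis .
qed

lemma values_eq: "label_values s = image_mset (sum r) (mset_set (range U))"
  using inj by (simp add: label_values_def val[symmetric] image_mset_mset_set[symmetric] multiset.map_comp comp_def)

lemma values_of_edges:
  assumes "set Es \<subseteq> range U" "distinct Es" "length Es = 5"
  shows "label_values s = image_mset (sum r) (mset Es)"
proof -
  have "set Es = range U"
    using assms inj by (intro card_subset_eq) (auto simp: distinct_card card_image)
  then show ?thesis using assms(2) by (simp add: values_eq mset_set_set[symmetric])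
qed

lemma sum_degree: "(\<Sum>v\<in>UNIV. int (card (nbs v))) = 10"
  using sum_edges[of "\<lambda>_. 1"] by (simp add: card2)

text \<open>Equivalently, the sum of \<open>(card (nbs v) - 2) * r v\<close> is zero. This is the
  relation on \<open>r\<close> that the case distinctions by degree sequences draw on: it makes the
  sums before and after an exchange of edges agree.\<close>

lemma sum_degree_weighted: "(\<Sum>v\<in>UNIV. int (card (nbs v)) * r v) = 2 * sum r UNIV"
  using sum_edges[of r] total by (simp add: val sum_negf)

lemma degree_le_4: "card (nbs v) \<le> 4"
proof -
  have "card (nbs v) \<le> card (UNIV - {v})" by (intro card_mono) (use nbs_irrefl in auto)
  then show ?thesis by simp
qed

text \<open>A 2-regular graph on five vertices is a 5-cycle: a triangle would leave two vertices
  with at most one neighbour each.\<close>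

lemma two_regular:
  assumes deg: "\<And>v. card (nbs v) = 2"
  shows "has_pentagon r s"
proof -
  obtain b e where be: "nbs 0 = {b, e}" "b \<noteq> e" using deg[of 0] by (auto simp: card_2_iff)
  have b0: "b \<noteq> 0" "e \<noteq> 0" using nbs_irrefl[of 0] be by auto
  have "0 \<in> nbs b" using be nbs_sym by auto
  then obtain c where c: "nbs b = {0, c}" "c \<noteq> 0" using card_2_memE[OF deg] by metis
  have cb: "c \<noteq> b" using nbs_irrefl[of b] c by auto
  have "0 \<in> nbs e" "b \<in> nbs c" using be c nbs_sym by auto
  obtain d' where e: "nbs e = {0, d'}" "d' \<noteq> 0" using card_2_memE[OF deg \<open>0 \<in> nbs e\<close>] by metis
  have ce: "c \<noteq> e"
  proof
    assume ce: "c = e"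
    then have nbe: "nbs e = {0, b}" using e \<open>b \<in> nbs c\<close> b0 by auto
    have "card (UNIV - {0, b, e}) = 2" using b0 be by (simp add: card_Diff_subset)
    then obtain p q where pq: "UNIV - {0, b, e} = {p, q}" "p \<noteq> q" by (auto simp: card_2_iff)
    then have p: "p \<notin> {0, b, e}" by auto
    then have "0 \<notin> nbs p" and "b \<notin> nbs p" and "e \<notin> nbs p" using nbs_sym[of _ p] be c ce nbe by auto
    have "nbs p \<subseteq> {q}"
    proof
      fix x assume x: "x \<in> nbs p"
      have "x \<in> UNIV - {0, b, e}" using x \<open>0 \<notin> nbs p\<close> \<open>b \<notin> nbs p\<close> \<open>e \<notin> nbs p\<close> by auto
      then have "x \<in> {p, q}" by (simp only: pq(1))
      then show "x \<in> {q}" using x nbs_irrefl[of p] by auto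
    qed
    then have "card (nbs p) \<le> 1" using card_mono[of "{q}" "nbs p"] by simp
    then show False using deg[of p] by simp
  qed
  have "card (UNIV - {0, b, c, e}) = 1" using b0 be c cb ce by (simp add: card_Diff_subset)
  then obtain d where d: "UNIV - {0, b, c, e} = {d}" by (auto simp: card_1_singleton_iff)
  then have dn: "d \<notin> {0, b, c, e}" by auto
  then have d0: "0 \<notin> nbs d" "b \<notin> nbs d" using nbs_sym[of _ d] be c by auto
  have "nbs d \<subseteq> {c, e}"
  proof
    fix x assume x: "x \<in> nbs d"
    show "x \<in> {c, e}"
    proof (rule ccontr)
      assume "x \<notin> {c, e}"
      then have "x \<in> UNIV - {0, b, c, e}" using x d0 by auto
      then have "x = d" by (simp only: d singleton_iff)
      then show False using x nbs_irrefl[of d] by simp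
    qed
  qed
  then have "nbs d = {c, e}" using deg[of d] ce by (intro card_subset_eq) auto
  then have "b \<in> nbs 0" "c \<in> nbs b" "d \<in> nbs c" "e \<in> nbs d" "0 \<in> nbs e"
    using be c nbs_sym by auto
  then have "set [{0, b}, {b, c}, {c, d}, {d, e}, {e, 0}] \<subseteq> range U"
    by (simp add: nbs_def)
  moreover have dist: "distinct [0, b, c, d, e]" using b0 be c cb ce dn by auto
  ultimately have "label_values s = image_mset (sum r) (mset [{0, b}, {b, c}, {c, d}, {d, e}, {e, 0}])"
    by (intro values_of_edges) (auto simp: doubleton_eq_iff)
  then show ?thesis
    using dist by (intro has_pentagonI[OF dist]) simp
qed

lemma swap_edge:
  assumes "{a, b} \<in> range U" "{c, d} \<notin> range U" "c \<noteq> d" "a \<noteq> b" "r a + r b = r c + r d"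
  obtains U' where "edge_labelling r s U'" "range U' = insert {c, d} (range U - {{a, b}})"
proof -
  obtain k where k: "U k = {a, b}" using assms(1) by auto
  show thesis
  proof (rule that[of "U(k := {c, d})"])
    show "edge_labelling r s (U(k := {c, d}))"
    proof
      show "inj (U(k := {c, d}))" using inj assms(2) by (simp add: inj_on_fun_updI)
      show "card ((U(k := {c, d})) l) = 2" for l using card2 assms(3) by simp
      show "sum r ((U(k := {c, d})) l) = - s l" for l
        using val[of l] k assms(3,4,5) by auto
    qed (rule total)
    show "range (U(k := {c, d})) = insert {c, d} (range U - {{a, b}})"
      using inj k by (auto simp: inj_def)
  qed
qed

text \<open>The weighted degree relation becomes \<open>r i = r j\<close>. Hence an edge from
  \<open>i\<close> to a vertex \<open>w\<close> not yet joined to \<open>j\<close> may be replaced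
  by the edge from \<open>j\<close> to \<open>w\<close>, after which all degrees are 2.\<close>

lemma degrees_3_1_2_2_2:
  assumes dist: "distinct [i, j, p, q, l]"
    and deg: "card (nbs i) = 3" "card (nbs j) = 1" "card (nbs p) = 2" "card (nbs q) = 2" "card (nbs l) = 2"
  shows "has_pentagon r s"
proof -
  have rij: "r i = r j"
    using sum_degree_weighted deg unfolding sum_UNIV_5[OF dist] by simp
  have "\<exists>w\<in>nbs i. w \<noteq> j \<and> w \<notin> nbs j"
  proof (cases "j \<in> nbs i")
    case True
    then have "nbs j = {i}" using deg(2) nbs_sym by (metis card_1_singletonE singletonD)
    moreover have "\<exists>w\<in>nbs i. w \<noteq> j"
      using deg(1) card_mono[of "{j}" "nbs i"] by (cases "nbs i \<subseteq> {j}") auto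
    ultimately show ?thesis using nbs_irrefl[of i] by auto
  next
    case False
    have "\<not> nbs i \<subseteq> nbs j" using deg card_mono[of "nbs j" "nbs i"] by auto
    then show ?thesis using False by auto
  qed
  then obtain w where w: "w \<in> nbs i" "w \<noteq> j" "w \<notin> nbs j" by blast
  have wi: "w \<noteq> i" using w nbs_irrefl by auto
  obtain U' where U': "edge_labelling r s U'" "range U' = insert {j, w} (range U - {{i, w}})"
    by (rule swap_edge[of i w j w]) (use w wi rij in \<open>auto simp: nbs_def\<close>)
  interpret U': edge_labelling r s U' by fact
  have nb: "U'.nbs v = {x. {v, x} = {j, w} \<or> x \<in> nbs v \<and> {v, x} \<noteq> {i, w}}" for v
    by (auto simp: U'.nbs_def U'(2) nbs_def)
  have ij: "i \<noteq> j" using dist by simp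
  have 1: "U'.nbs i = nbs i - {w}" using ij wi w(2) unfolding nb by (auto simp: doubleton_eq_iff)
  have 2: "U'.nbs j = insert w (nbs j)" using ij wi w(2) unfolding nb by (auto simp: doubleton_eq_iff)
  have 3: "U'.nbs w = insert j (nbs w - {i})" using ij wi w(2) unfolding nb by (auto simp: doubleton_eq_iff)
  have 4: "U'.nbs v = nbs v" if "v \<notin> {i, j, w}" for v
    using that unfolding nb by (auto simp: doubleton_eq_iff)
  have degw: "card (nbs w) = 2"
    using deg w(2) wi UNIV_distinct5[OF dist] by (cases "w = p"; cases "w = q"; cases "w = l") auto
  show ?thesis
  proof (rule U'.two_regular)
    fix v
    have d2: "card (nbs v) = 2" if "v \<notin> {i, j}"
      using that deg UNIV_distinct5[OF dist] by (cases "v = p"; cases "v = q"; cases "v = l") auto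
    consider "v = i" | "v = j" | "v = w" | "v \<notin> {i, j, w}" by blast
    then show "card (U'.nbs v) = 2"
    proof cases
      case c1: 1 then show ?thesis using 1 w deg(1) by (simp add: card_Diff_singleton)
    next
      case c2: 2 then show ?thesis using 2 w deg(2) by (simp add: card_insert_if)
    next
      case c3: 3
      have "i \<in> nbs w" "j \<notin> nbs w" using w nbs_sym by auto
      then show ?thesis using 3 c3 degw by (simp add: card_insert_if card_Diff_singleton)
    next
      case c4: 4 then show ?thesis using 4 d2 by simp
    qed
  qed
qed

text \<open>The weighted degree relation becomes \<open>r i + r p = r j + r q\<close>, so the edge
  between the vertices of degree 3 may be exchanged for the one between the vertices of degree 1.
  Counting neighbours shows that the former is present and the latter absent.\<close>

lemma degrees_3_1_3_1_2:
  assumes dist: "distinct [i, j, p, q, l]"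
    and deg: "card (nbs i) = 3" "card (nbs j) = 1" "card (nbs p) = 3" "card (nbs q) = 1" "card (nbs l) = 2"
  shows "has_pentagon r s"
proof -
  have V: "x \<in> {i, j, p, q, l}" for x using UNIV_distinct5[OF dist] by (metis UNIV_I)
  have sub: "nbs v \<subseteq> X" if "\<And>x. x \<in> {i, j, p, q, l} \<Longrightarrow> x \<in> nbs v \<Longrightarrow> x \<in> X" for v X
    using V that by blast
  have rr: "r i + r p = r j + r q"
    using sum_degree_weighted deg unfolding sum_UNIV_5[OF dist] by simp
  have ip: "{i, p} \<in> range U"
  proof (rule ccontr)
    assume "{i, p} \<notin> range U"
    then have "p \<notin> nbs i" "i \<notin> nbs p" by (auto simp: nbs_def insert_commute)
    then have "nbs i \<subseteq> {j, q, l}" and "nbs p \<subseteq> {j, q, l}"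
      using nbs_irrefl[of i] nbs_irrefl[of p] by (auto intro!: sub)
    then have "nbs i = {j, q, l}"
      by (intro card_subset_eq) (use deg dist in simp_all)
    moreover from \<open>nbs p \<subseteq> {j, q, l}\<close> have "nbs p = {j, q, l}"
      by (intro card_subset_eq) (use deg dist in simp_all)
    ultimately have "{i, p} \<subseteq> nbs j" using nbs_sym by auto
    then have "card {i, p} \<le> card (nbs j)" by (intro card_mono) auto
    then show False using deg dist by simp
  qed
  have jq: "{j, q} \<notin> range U"
  proof
    assume "{j, q} \<in> range U"
    then have "q \<in> nbs j" "j \<in> nbs q" by (auto simp: nbs_def insert_commute)
    then have "nbs j = {q}" "nbs q = {j}" using deg by (metis card_1_singletonE singletonD)+
    then have "j \<notin> nbs i" "q \<notin> nbs i" using nbs_sym[of _ i] dist by auto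
    then have "nbs i \<subseteq> {p, l}" using nbs_irrefl[of i] by (auto intro!: sub)
    then have "card (nbs i) \<le> card {p, l}" by (intro card_mono) auto
    then show False using deg dist by simp
  qed
  obtain U' where U': "edge_labelling r s U'" "range U' = insert {j, q} (range U - {{i, p}})"
    by (rule swap_edge[of i p j q]) (use ip jq rr dist in auto)
  interpret U': edge_labelling r s U' by fact
  have nb: "U'.nbs v = {x. {v, x} = {j, q} \<or> x \<in> nbs v \<and> {v, x} \<noteq> {i, p}}" for v
    by (auto simp: U'.nbs_def U'(2) nbs_def)
  have nbs: "U'.nbs i = nbs i - {p}" "U'.nbs p = nbs p - {i}" "U'.nbs j = insert q (nbs j)"
    "U'.nbs q = insert j (nbs q)" "U'.nbs l = nbs l"
    using dist unfolding nb by (auto simp: doubleton_eq_iff)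
  have mem: "p \<in> nbs i" "i \<in> nbs p" "q \<notin> nbs j" "j \<notin> nbs q"
    using ip jq by (auto simp: nbs_def insert_commute)
  show ?thesis
  proof (rule U'.two_regular)
    fix v
    have "v \<in> {i, j, p, q, l}" by (rule V)
    then show "card (U'.nbs v) = 2"
      using nbs mem deg by (auto simp: card_Diff_singleton card_insert_if)
  qed
qed

text \<open>The deviations from degree 2 are at most 1 in absolute value and sum to zero. So there
  are equally many vertices of degree 3 and of degree 1, and at most two of each.\<close>

lemma middle_degrees:
  assumes deg: "\<And>v. 1 \<le> card (nbs v)" "\<And>v. card (nbs v) \<le> 3"
  shows "has_pentagon r s"
proof (cases "\<forall>v. card (nbs v) = 2")
  case True
  then show ?thesis using two_regular by blast
next
  case False
  have sum0: "(\<Sum>v\<in>UNIV. 2 - int (card (nbs v))) = 0"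
    using sum_degree by (simp add: sum_subtractf)
  have "\<exists>i. card (nbs i) = 3"
  proof (rule ccontr)
    assume "\<nexists>i. card (nbs i) = 3"
    then have "card (nbs v) \<le> 2" for v using deg(2)[of v] by (metis le_Suc_eq numeral_2_eq_2 numeral_3_eq_3)
    then have "\<forall>v\<in>UNIV. 2 - int (card (nbs v)) = 0"
      using sum0 by (subst (asm) sum_nonneg_eq_0_iff) auto
    then show False using False by auto
  qed
  then obtain i where i: "card (nbs i) = 3" by blast
  have "\<exists>j. card (nbs j) = 1"
  proof (rule ccontr)
    assume none: "\<nexists>j. card (nbs j) = 1"
    have "2 \<le> card (nbs v)" for v using deg(1)[of v] none by (metis One_nat_def Suc_1 le_antisym not_less_eq_eq)
    then have "\<forall>v\<in>UNIV. int (card (nbs v)) - 2 = 0"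
      using sum0 by (subst sum_nonneg_eq_0_iff[symmetric]) (auto simp: sum_subtractf)
    then show False using False by auto
  qed
  then obtain j where j: "card (nbs j) = 1" by blast
  have ij: "i \<noteq> j" using i j by auto
  then have "card (UNIV - {i, j}) = 3" by (simp add: card_Diff_subset)
  then obtain p q l where pql: "UNIV - {i, j} = {p, q, l}" "p \<noteq> q" "q \<noteq> l" "p \<noteq> l"
    by (auto simp: card_3_iff)
  then have "p \<notin> {i, j}" "q \<notin> {i, j}" "l \<notin> {i, j}" by blast+
  then have dist: "distinct [i, j, p, q, l]" using pql ij by auto
  have six: "card (nbs p) + card (nbs q) + card (nbs l) = 6"
    using sum_degree i j unfolding sum_UNIV_5[OF dist] by simp
  have three: "card (nbs v) = 1 \<or> card (nbs v) = 2 \<or> card (nbs v) = 3" for v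
    using deg[of v] by linarith
  consider "card (nbs p) = 2" "card (nbs q) = 2" "card (nbs l) = 2"
    | "card (nbs p) = 3" "card (nbs q) = 1" "card (nbs l) = 2"
    | "card (nbs p) = 3" "card (nbs q) = 2" "card (nbs l) = 1"
    | "card (nbs p) = 1" "card (nbs q) = 3" "card (nbs l) = 2"
    | "card (nbs p) = 2" "card (nbs q) = 3" "card (nbs l) = 1"
    | "card (nbs p) = 1" "card (nbs q) = 2" "card (nbs l) = 3"
    | "card (nbs p) = 2" "card (nbs q) = 1" "card (nbs l) = 3"
    using three[of p] three[of q] three[of l] six by (elim disjE) simp_all
  then show ?thesis
  proof cases
    case 1 then show ?thesis by (rule degrees_3_1_2_2_2[OF dist i j])
  next
    case 2 then show ?thesis by (rule degrees_3_1_3_1_2[OF dist i j])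
  next
    case 3 then show ?thesis using dist i j by (intro degrees_3_1_3_1_2[of i j p l q]) auto
  next
    case 4 then show ?thesis using dist i j by (intro degrees_3_1_3_1_2[of i j q p l]) auto
  next
    case 5 then show ?thesis using dist i j by (intro degrees_3_1_3_1_2[of i j q l p]) auto
  next
    case 6 then show ?thesis using dist i j by (intro degrees_3_1_3_1_2[of i j l p q]) auto
  next
    case 7 then show ?thesis using dist i j by (intro degrees_3_1_3_1_2[of i j l q p]) auto
  qed
qed

end

section \<open>Vertices of degree 0 and 4\<close>

context edge_labelling begin

lemma label_mem:
  assumes "w \<in> nbs v" shows "r v + r w \<in># label_values s"
proof -
  obtain k where "U k = {v, w}" using assms by (auto simp: nbs_def)
  moreover have "v \<noteq> w" using assms nbs_irrefl by auto
  ultimately have "r v + r w = - s k" using val[of k] by simp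
  then show ?thesis by (simp add: label_values_def)
qed

text \<open>All five edges lie among the four other vertices, which span six. The graph is the
  complete graph on \<open>a, b, c, d\<close> without the edge between \<open>c\<close> and
  \<open>d\<close>.\<close>

lemma isolated_vertex:
  assumes e: "nbs e = {}"
  obtains a b c d where "distinct [a, b, c, d, e]"
    "label_values s = {# r a + r b, r a + r c, r a + r d, r b + r c, r b + r d #}"
proof -
  define P where "P = {X. X \<subseteq> UNIV - {e} \<and> card X = 2}"
  have "card P = 6"
    using n_subsets[of "UNIV - {e}" 2] by (simp add: P_def choose_two)
  have sub: "range U \<subseteq> P"
  proof
    fix X assume "X \<in> range U"
    then obtain k where k: "X = U k" by auto
    have "e \<notin> U k"
    proof
      assume "e \<in> U k"
      then obtain w where "U k = {e, w}" using card_2_memE[OF card2] by metis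
      then have "w \<in> nbs e" unfolding nbs_def by (metis (mono_tags) mem_Collect_eq rangeI)
      then show False using e by simp
    qed
    then show "X \<in> P" using k card2 by (auto simp: P_def)
  qed
  have "card (range U) = 5" using inj by (simp add: card_image)
  then have "range U \<noteq> P" using \<open>card P = 6\<close> by auto
  then obtain X where X: "X \<in> P" "X \<notin> range U" using sub by blast
  then obtain c d where cd: "X = {c, d}" "c \<noteq> d" by (auto simp: P_def card_2_iff)
  have ce: "c \<noteq> e" "d \<noteq> e" using X cd by (auto simp: P_def)
  then have "card (UNIV - {c, d, e}) = 2" using cd by (simp add: card_Diff_subset)
  then obtain a b where ab: "UNIV - {c, d, e} = {a, b}" "a \<noteq> b" by (auto simp: card_2_iff)
  then have "a \<notin> {c, d, e}" "b \<notin> {c, d, e}" by blast+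
  then have dist: "distinct [a, b, c, d, e]" using ab cd ce by auto
  have "finite P" by simp
  have eq: "range U = P - {X}"
  proof (rule card_subset_eq)
    show "card (range U) = card (P - {X})"
      using \<open>card (range U) = 5\<close> \<open>card P = 6\<close> X(1) \<open>finite P\<close> by (simp add: card_Diff_singleton)
  qed (use sub X in auto)
  have mem: "{x, y} \<in> range U" if "x \<noteq> y" "x \<noteq> e" "y \<noteq> e" "{x, y} \<noteq> {c, d}" for x y
    unfolding eq cd using that by (auto simp: P_def)
  have "label_values s = image_mset (sum r) (mset [{a, b}, {a, c}, {a, d}, {b, c}, {b, d}])"
  proof (rule values_of_edges)
    show "set [{a, b}, {a, c}, {a, d}, {b, c}, {b, d}] \<subseteq> range U"
      using dist by (auto intro!: mem simp: doubleton_eq_iff)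
  qed (use dist in \<open>auto simp: doubleton_eq_iff\<close>)
  then show thesis using dist by (intro that[OF dist]) simp
qed

text \<open>The star at \<open>a\<close> uses four of the five edges; the last one joins two of its
  leaves, named \<open>b\<close> and \<open>c\<close>.\<close>

lemma dominating_vertex:
  assumes a: "card (nbs a) = 4"
  obtains b c d e where "distinct [a, b, c, d, e]"
    "label_values s = {# r a + r b, r a + r c, r a + r d, r a + r e, r b + r c #}"
    "\<And>k. U k = {a, b} \<or> U k = {a, c} \<or> U k = {a, d} \<or> U k = {a, e} \<or> U k = {b, c}"
proof -
  have nbs: "nbs a = UNIV - {a}"
    by (rule card_subset_eq) (use a nbs_irrefl[of a] in auto)
  have "card (UNIV - {k. a \<in> U k}) = 1" using a by (simp add: card_nbs card_Diff_subset)
  then obtain k0 where k0: "UNIV - {k. a \<in> U k} = {k0}" by (auto simp: card_1_singleton_iff)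
  then have ak0: "a \<notin> U k0" by blast
  obtain b c where bc: "U k0 = {b, c}" "b \<noteq> c" using card2[of k0] by (auto simp: card_2_iff)
  have abc: "a \<noteq> b" "a \<noteq> c" using ak0 bc by auto
  then have "card (UNIV - {a, b, c}) = 2" using bc by (simp add: card_Diff_subset)
  then obtain d e where de: "UNIV - {a, b, c} = {d, e}" "d \<noteq> e" by (auto simp: card_2_iff)
  then have "d \<notin> {a, b, c}" "e \<notin> {a, b, c}" by blast+
  then have dist: "distinct [a, b, c, d, e]" using bc abc de by auto
  have mem: "{a, x} \<in> range U" if "x \<noteq> a" for x using nbs that by (auto simp: nbs_def)
  let ?Es = "[{a, b}, {a, c}, {a, d}, {a, e}, {b, c}]"
  have sub: "set ?Es \<subseteq> range U" using dist mem bc(1)[symmetric] by auto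
  have dEs: "distinct ?Es" using dist by (auto simp: doubleton_eq_iff)
  have "label_values s = image_mset (sum r) (mset ?Es)"
    by (rule values_of_edges[OF sub dEs]) simp
  moreover have "range U = set ?Es"
    using sub dEs inj by (intro card_subset_eq[symmetric]) (simp_all add: card_image distinct_card del: set_simps)
  then have "U k \<in> set ?Es" for k by blast
  ultimately show thesis using dist by (intro that[OF dist]) auto
qed

end

lemma sum_label_values: "sum_mset (label_values s) = - sum s UNIV"
  unfolding label_values_def sum_unfold_sum_mset[symmetric] by (rule sum_negf)

text \<open>The weighted degree relation is \<open>r a + r b = 2 * r e\<close>. The label values at
  \<open>x\<close> and \<open>y\<close> come from a second labelling in which \<open>e\<close> is
  not isolated. Equating each of them with one of the five known values forces one of seven linear
  relations, and each of these is realised by an explicit 5-cycle.\<close>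

lemma diamond_pentagon:
  assumes dist: "distinct [a, b, c, d, e]"
    and lv: "label_values s = {# r a + r b, r a + r c, r a + r d, r b + r c, r b + r d #}"
    and total: "2 * sum r UNIV + sum s UNIV = 0"
    and x: "x \<noteq> e" "r e + r x \<in># label_values s" and y: "y \<noteq> e" "y \<noteq> x" "r e + r y \<in># label_values s"
  shows "has_pentagon r s"
proof -
  have "2 * (r a + r b + r c + r d + r e) = sum_mset (label_values s)"
    using total unfolding sum_label_values sum_UNIV_5[OF dist] by simp
  then have rel: "r b = 2 * r e - r a" unfolding lv by simp
  have "has_pentagon r s" if h: "r a = r e"
  proof (rule has_pentagonI2)
    show "distinct [e, c, b, a, d]" using dist by auto
    show "label_values s = {# r a + r c, r b + r c, r a + r b, r a + r d, r b + r d #}" unfolding lv by (simp add: add_mset_commute)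
  qed (use h rel in arith)+
  moreover
  have "has_pentagon r s" if h: "r c = r e"
  proof (rule has_pentagonI2)
    show "distinct [e, a, d, b, c]" using dist by auto
    show "label_values s = {# r a + r c, r a + r d, r b + r d, r b + r c, r a + r b #}" unfolding lv by (simp add: add_mset_commute)
  qed (use h rel in arith)+
  moreover
  have "has_pentagon r s" if h: "r d = r e"
  proof (rule has_pentagonI2)
    show "distinct [e, a, c, b, d]" using dist by auto
    show "label_values s = {# r a + r d, r a + r c, r b + r c, r b + r d, r a + r b #}" unfolding lv by (simp add: add_mset_commute)
  qed (use h rel in arith)+
  moreover
  have "has_pentagon r s" if h: "r c - r d = r a - r e"
  proof (rule has_pentagonI2)
    show "distinct [e, c, a, b, d]" using dist by auto
    show "label_values s = {# r a + r d, r a + r c, r a + r b, r b + r d, r b + r c #}" unfolding lv by (simp add: add_mset_commute)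
  qed (use h rel in arith)+
  moreover
  have "has_pentagon r s" if h: "r d - r c = r a - r e"
  proof (rule has_pentagonI2)
    show "distinct [e, d, a, b, c]" using dist by auto
    show "label_values s = {# r a + r c, r a + r d, r a + r b, r b + r c, r b + r d #}" unfolding lv by (simp add: add_mset_commute)
  qed (use h rel in arith)+
  moreover
  have "has_pentagon r s" if h: "r c - r e = 2 * (r a - r e) \<and> r d - r e = - 2 * (r a - r e)"
  proof (rule has_pentagonI2)
    show "distinct [e, a, c, d, b]" using dist by auto
    show "label_values s = {# r b + r c, r a + r c, r a + r b, r b + r d, r a + r d #}" unfolding lv by (simp add: add_mset_commute)
  qed (use h rel in arith)+
  moreover
  have "has_pentagon r s" if h: "r c - r e = - 2 * (r a - r e) \<and> r d - r e = 2 * (r a - r e)"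
  proof (rule has_pentagonI2)
    show "distinct [e, a, d, c, b]" using dist by auto
    show "label_values s = {# r b + r d, r a + r d, r a + r b, r b + r c, r a + r c #}" unfolding lv by (simp add: add_mset_commute)
  qed (use h rel in arith)+
  moreover
  have "(r a = r e) \<or> (r c = r e) \<or> (r d = r e) \<or> (r c - r d = r a - r e) \<or> (r d - r c = r a - r e) \<or> (r c - r e = 2 * (r a - r e) \<and> r d - r e = - 2 * (r a - r e)) \<or> (r c - r e = - 2 * (r a - r e) \<and> r d - r e = 2 * (r a - r e))"
  proof -
    have "x \<in> {a, b, c, d, e}" "y \<in> {a, b, c, d, e}" using UNIV_distinct5[OF dist] by (metis UNIV_I)+
    then have xy: "x = a \<or> x = b \<or> x = c \<or> x = d" "y = a \<or> y = b \<or> y = c \<or> y = d"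
      using x(1) y(1) by auto
    have mem: "z = r a + r b \<or> z = r a + r c \<or> z = r a + r d \<or> z = r b + r c \<or> z = r b + r d"
      if "z \<in># label_values s" for z
      using that unfolding lv by auto
    show ?thesis
      using mem[OF x(2)] mem[OF y(3)] xy y(2) rel by (elim disjE; simp; linarith)
  qed
  ultimately show ?thesis by blast
qed

text \<open>The weighted degree relation is \<open>r d + r e = 2 * r a\<close>. At least three
  labels of \<open>W\<close> lie on edges avoiding \<open>a\<close>. Without a pentagon they must be
  the labels that \<open>U\<close> puts on \<open>{b, c}\<close>, \<open>{a, d}\<close> and
  \<open>{a, e}\<close>, and no placement of these three on edges among \<open>b, c, d, e\<close> is
  possible.\<close>

lemma cricket_pentagon:
  assumes U: "edge_labelling r s U" and W: "edge_labelling r s W"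
    and dist: "distinct [a, b, c, d, e]"
    and lv: "label_values s = {# r a + r b, r a + r c, r a + r d, r a + r e, r b + r c #}"
    and Uk: "\<And>k. U k = {a, b} \<or> U k = {a, c} \<or> U k = {a, d} \<or> U k = {a, e} \<or> U k = {b, c}"
    and Wa: "card {k. a \<in> W k} \<le> 2"
  shows "has_pentagon r s"
proof (rule ccontr)
  assume no: "\<not> has_pentagon r s"
  interpret U: edge_labelling r s U by fact
  interpret W: edge_labelling r s W by fact
  have "2 * (r a + r b + r c + r d + r e) = sum_mset (label_values s)"
    using U.total unfolding sum_label_values sum_UNIV_5[OF dist] by simp
  then have rel: "r e = 2 * r a - r d" unfolding lv by simp
  have K0: "has_pentagon r s" if h: "r d = r a"
  proof (rule has_pentagonI2)
    show "distinct [a, d, b, c, e]" using dist by auto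
    show "label_values s = {# r a + r d, r a + r b, r b + r c, r a + r c, r a + r e #}" unfolding lv by (simp add: add_mset_commute)
  qed (use h rel in arith)+
  have K1: "has_pentagon r s" if h: "r b = r a"
  proof (rule has_pentagonI2)
    show "distinct [c, a, d, e, b]" using dist by auto
    show "label_values s = {# r a + r c, r a + r d, r a + r b, r a + r e, r b + r c #}" unfolding lv by (simp add: add_mset_commute)
  qed (use h rel in arith)+
  have K2: "has_pentagon r s" if h: "r c = r a"
  proof (rule has_pentagonI2)
    show "distinct [b, a, d, e, c]" using dist by auto
    show "label_values s = {# r a + r b, r a + r d, r a + r c, r a + r e, r b + r c #}" unfolding lv by (simp add: add_mset_commute)
  qed (use h rel in arith)+
  have K3: "has_pentagon r s" if h: "r c - r b = r d - r a"
  proof (rule has_pentagonI2)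
    show "distinct [a, d, b, c, e]" using dist by auto
    show "label_values s = {# r a + r d, r a + r c, r b + r c, r a + r b, r a + r e #}" unfolding lv by (simp add: add_mset_commute)
  qed (use h rel in arith)+
  have K4: "has_pentagon r s" if h: "r b - r c = r d - r a"
  proof (rule has_pentagonI2)
    show "distinct [a, d, c, b, e]" using dist by auto
    show "label_values s = {# r a + r d, r a + r b, r b + r c, r a + r c, r a + r e #}" unfolding lv by (simp add: add_mset_commute)
  qed (use h rel in arith)+
  have K5: "has_pentagon r s" if h: "r b - r a = 2 * (r d - r a) \<and> r c - r a = - 2 * (r d - r a)"
  proof (rule has_pentagonI2)
    show "distinct [a, b, e, d, c]" using dist by auto
    show "label_values s = {# r a + r b, r a + r d, r b + r c, r a + r e, r a + r c #}" unfolding lv by (simp add: add_mset_commute)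
  qed (use h rel in arith)+
  have K6: "has_pentagon r s" if h: "r b - r a = - 2 * (r d - r a) \<and> r c - r a = 2 * (r d - r a)"
  proof (rule has_pentagonI2)
    show "distinct [a, b, d, e, c]" using dist by auto
    show "label_values s = {# r a + r b, r a + r e, r b + r c, r a + r d, r a + r c #}" unfolding lv by (simp add: add_mset_commute)
  qed (use h rel in arith)+
  have n0: "\<not> (r d = r a)" using no K0 by blast
  have n1: "\<not> (r b = r a)" using no K1 by blast
  have n2: "\<not> (r c = r a)" using no K2 by blast
  have n3: "\<not> (r c - r b = r d - r a)" using no K3 by blast
  have n4: "\<not> (r b - r c = r d - r a)" using no K4 by blast
  have n5: "\<not> (r b - r a = 2 * (r d - r a) \<and> r c - r a = - 2 * (r d - r a))" using no K5 by blast
  have n6: "\<not> (r b - r a = - 2 * (r d - r a) \<and> r c - r a = 2 * (r d - r a))" using no K6 by blast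
  define S where "S = {k. a \<notin> W k}"
  have "card S = 5 - card {k. a \<in> W k}"
    using card_Diff_subset[of "{k. a \<in> W k}" UNIV] by (simp add: S_def set_diff_eq)
  then have S3: "3 \<le> card S" using Wa by simp
  have Wk: "W k = {b, c} \<or> W k = {b, d} \<or> W k = {b, e} \<or> W k = {c, d} \<or> W k = {c, e} \<or> W k = {d, e}" if "k \<in> S" for k
  proof -
    obtain p q where pq: "W k = {p, q}" "p \<noteq> q" using W.card2[of k] by (auto simp: card_2_iff)
    have "p \<in> {a, b, c, d, e}" "q \<in> {a, b, c, d, e}" using UNIV_distinct5[OF dist] by (metis UNIV_I)+
    then show ?thesis using pq that by (auto simp: S_def)
  qed
  have s: "sum r {b, c} = r b + r c" "sum r {b, d} = r b + r d" "sum r {b, e} = r b + r e"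
    "sum r {c, d} = r c + r d" "sum r {c, e} = r c + r e" "sum r {d, e} = r d + r e"
    using dist by simp_all
  have eq: "sum r (W k) = sum r (U k)" for k using U.val[of k] W.val[of k] by simp
  \<comment> \<open>If the value \<open>r a + r b\<close> or \<open>r a + r c\<close> occurred on an
    edge avoiding \<open>a\<close>, the resulting equation would amount to one of the relations
    excluded by \<open>n0\<close> to \<open>n4\<close>.\<close>
  have key: "U k = {b, c} \<or> U k = {a, d} \<or> U k = {a, e}" if "k \<in> S" for k
  proof (rule ccontr)
    assume "\<not> (U k = {b, c} \<or> U k = {a, d} \<or> U k = {a, e})"
    then have "U k = {a, b} \<or> U k = {a, c}" using Uk[of k] by blast
    then have "sum r (U k) = r a + r b \<or> sum r (U k) = r a + r c" using dist by auto
    moreover have "sum r (W k) = r b + r c \<or> sum r (W k) = r b + r d \<or> sum r (W k) = r b + r e \<or>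
        sum r (W k) = r c + r d \<or> sum r (W k) = r c + r e \<or> sum r (W k) = r d + r e"
      using Wk[OF that] by (elim disjE) (simp_all add: s)
    ultimately show False using eq[of k] rel n0 n1 n2 n3 n4 by (elim disjE; simp; linarith)
  qed
  have "U ` S \<subseteq> {{b, c}, {a, d}, {a, e}}" using key by blast
  moreover have "card (U ` S) = card S" using U.inj by (intro card_image) (auto simp: inj_on_def)
  ultimately have "U ` S = {{b, c}, {a, d}, {a, e}}"
    using S3 card_length[of "[{b, c}, {a, d}, {a, e}]"] card_mono[of "{{b, c}, {a, d}, {a, e}}" "U ` S"]
    by (intro card_seteq) auto
  then have "{b, c} \<in> U ` S" and "{a, d} \<in> U ` S" and "{a, e} \<in> U ` S" by simp_all
  then obtain k1 k2 k3 where k: "k1 \<in> S" "U k1 = {b, c}" "k2 \<in> S" "U k2 = {a, d}" "k3 \<in> S" "U k3 = {a, e}"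
    by (elim imageE) simp
  have "k1 \<noteq> k2" "k1 \<noteq> k3" "k2 \<noteq> k3" using k(2,4,6) dist by (auto simp: doubleton_eq_iff)
  then have ne: "W k1 \<noteq> W k2" "W k1 \<noteq> W k3" "W k2 \<noteq> W k3" using W.inj by (auto simp: inj_def)
  have v1: "sum r (W k1) = r b + r c" and v2: "sum r (W k2) = r a + r d" and v3: "sum r (W k3) = r a + r e"
    using k(2,4,6) dist by (simp_all add: eq)
  \<comment> \<open>With \<open>u = r d - r a\<close> one has \<open>r e - r a = - u\<close>, and
    \<open>u\<close> is nonzero by \<open>n0\<close>. Every combination of the cases for
    \<open>k1\<close>, \<open>k2\<close>, \<open>k3\<close> makes a nonzero multiple of
    \<open>u\<close> vanish, uses an edge twice, or is excluded by \<open>n5\<close> or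
    \<open>n6\<close>.\<close>
  have 2: "W k2 = {b, c} \<and> r b + r c = r a + r d \<or> W k2 = {b, e} \<and> r b - r a = 2 * (r d - r a) \<or>
     W k2 = {c, e} \<and> r c - r a = 2 * (r d - r a)"
    using Wk[OF k(3)] v2 rel n0 n1 n2 n3 n4 by (elim disjE; simp add: s; linarith)
  have 3: "W k3 = {b, c} \<and> r b + r c = r a + r e \<or> W k3 = {b, d} \<and> r b - r a = - 2 * (r d - r a) \<or>
     W k3 = {c, d} \<and> r c - r a = - 2 * (r d - r a)"
    using Wk[OF k(5)] v3 rel n0 n1 n2 n3 n4 by (elim disjE; simp add: s; linarith)
  have 1: "W k1 = {b, c} \<or> W k1 = {b, d} \<and> r c = r d \<or> W k1 = {b, e} \<and> r c = r e \<or>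
     W k1 = {c, d} \<and> r b = r d \<or> W k1 = {c, e} \<and> r b = r e \<or> W k1 = {d, e} \<and> r b + r c = r d + r e"
    using Wk[OF k(1)] v1 by (elim disjE; simp add: s)
  show False
    using 2
  proof (elim disjE conjE)
    assume w2: "W k2 = {b, c}" "r b + r c = r a + r d"
    then show False using 3 1 ne rel n0 n1 n2 by (elim disjE conjE; simp; linarith)
  next
    assume w2: "W k2 = {b, e}" "r b - r a = 2 * (r d - r a)"
    from 3 show False
    proof (elim disjE conjE)
      assume w3: "W k3 = {b, c}" "r b + r c = r a + r e"
      from 1 show False
      proof (elim disjE conjE)
        assume "W k1 = {b, c}"
        then show False using w3(1) ne(2) by simp
      next
        assume h: "r c = r d"
        show False using h w2(2) w3(2) rel n0 by presburger
      next
        assume h: "r c = r e" "W k1 = {b, e}"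
        show False using h(2) w2(1) ne(1) by simp
      next
        assume h: "r b = r d"
        show False using h w2(2) w3(2) rel n0 by presburger
      next
        assume h: "r b = r e" "W k1 = {c, e}"
        show False using h(1) w2(2) w3(2) rel n0 by presburger
      next
        assume h: "r b + r c = r d + r e"
        show False using h w2(2) w3(2) rel n0 by presburger
      qed
    next
      assume h: "r b - r a = - 2 * (r d - r a)"
      show False using h w2(2) rel n0 by presburger
    next
      assume h: "r c - r a = - 2 * (r d - r a)"
      show False using h w2(2) n5 by blast
    qed
  next
    assume w2: "W k2 = {c, e}" "r c - r a = 2 * (r d - r a)"
    from 3 show False
    proof (elim disjE conjE)
      assume w3: "W k3 = {b, c}" "r b + r c = r a + r e"
      from 1 show False
      proof (elim disjE conjE)
        assume "W k1 = {b, c}"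
        then show False using w3(1) ne(2) by simp
      next
        assume h: "r c = r d"
        show False using h w2(2) w3(2) rel n0 by presburger
      next
        assume h: "r c = r e" "W k1 = {b, e}"
        show False using h(1) w2(2) w3(2) rel n0 by presburger
      next
        assume h: "r b = r d"
        show False using h w2(2) w3(2) rel n0 by presburger
      next
        assume h: "r b = r e" "W k1 = {c, e}"
        show False using h(2) w2(1) ne(1) by simp
      next
        assume h: "r b + r c = r d + r e"
        show False using h w2(2) w3(2) rel n0 by presburger
      qed
    next
      assume h: "r b - r a = - 2 * (r d - r a)"
      show False using h w2(2) n6 by blast
    next
      assume h: "r c - r a = - 2 * (r d - r a)"
      show False using h w2(2) rel n0 by presburger
    qed
  qed
qed

text \<open>Exchanging edges settles the degrees 1 to 3. At a vertex of degree 0 or 4,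
  \<open>sel\<close> is applied with \<open>y\<close> concentrated there and provides a second
  labelling with the same label values: \<open>y = 1\<close> at an isolated vertex forces degree at
  least 2, and \<open>y = - 1\<close> at a vertex of degree 4 forces degree at most 2.\<close>

lemma pentagon_exists:
  assumes total: "2 * sum r UNIV + sum s UNIV = 0"
    and sel: "\<And>y :: 5 \<Rightarrow> int. \<exists>U. edge_labelling r s U \<and> (\<Sum>k\<in>UNIV. sum y (U k)) \<ge> 2 * sum y UNIV"
  shows "has_pentagon r s"
proof -
  obtain U where U: "edge_labelling r s U" using sel by blast
  interpret U: edge_labelling r s U by fact
  have ind: "(\<Sum>v\<in>UNIV. int (f v) * (if v = u then c else 0)) = int (f u) * c" for f and u :: 5 and c :: int
    by (simp add: if_distrib[of "\<lambda>z. _ * z"] cong: if_cong)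
  consider e where "card (U.nbs e) = 0" | a where "card (U.nbs a) = 4"
    | "\<And>v. 1 \<le> card (U.nbs v)" "\<And>v. card (U.nbs v) \<le> 3"
    using U.degree_le_4 by (metis One_nat_def Suc_leI le_Suc_eq numeral_3_eq_3 numeral_eq_Suc pred_numeral_simps(2) semiring_norm(26) semiring_norm(27) zero_less_iff_neq_zero)
  then show ?thesis
  proof cases
    case 1
    then have "U.nbs e = {}" by simp
    then obtain a b c d where D: "distinct [a, b, c, d, e]"
      "label_values s = {# r a + r b, r a + r c, r a + r d, r b + r c, r b + r d #}"
      using U.isolated_vertex by metis
    obtain W where W: "edge_labelling r s W"
      "(\<Sum>k\<in>UNIV. sum (\<lambda>v. if v = e then 1 else 0) (W k)) \<ge> 2 * (\<Sum>v\<in>UNIV. if v = e then 1 else (0::int))"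
      using sel[of "\<lambda>v. if v = e then 1 else 0"] by blast
    interpret W: edge_labelling r s W by fact
    have "2 \<le> card (W.nbs e)"
      using W(2) unfolding W.sum_edges ind by simp
    then obtain x y where xy: "x \<in> W.nbs e" "y \<in> W.nbs e" "x \<noteq> y"
      by (metis card_le_Suc0_iff_eq finite numeral_2_eq_2 not_less_eq_eq)
    then have "x \<noteq> e" "y \<noteq> e" using W.nbs_irrefl by auto
    then show ?thesis
      using diamond_pentagon[OF D total, of x y] W.label_mem xy by auto
  next
    case 2
    then obtain b c d e where K: "distinct [a, b, c, d, e]"
      "label_values s = {# r a + r b, r a + r c, r a + r d, r a + r e, r b + r c #}"
      "\<And>k. U k = {a, b} \<or> U k = {a, c} \<or> U k = {a, d} \<or> U k = {a, e} \<or> U k = {b, c}"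
      using U.dominating_vertex[OF 2] by blast
    obtain W where W: "edge_labelling r s W"
      "(\<Sum>k\<in>UNIV. sum (\<lambda>v. if v = a then - 1 else 0) (W k)) \<ge> 2 * (\<Sum>v\<in>UNIV. if v = a then - 1 else (0::int))"
      using sel[of "\<lambda>v. if v = a then - 1 else 0"] by blast
    interpret W: edge_labelling r s W by fact
    have "card (W.nbs a) \<le> 2" using W(2) unfolding W.sum_edges ind by simp
    then show ?thesis using cricket_pentagon[OF U W(1) K] by (simp add: W.card_nbs)
  next
    case 3
    then show ?thesis by (rule U.middle_degrees)
  qed
qed

section \<open>Weights when there is no pentagon\<close>

abbreviation neg_part :: "int \<Rightarrow> int" where "neg_part a \<equiv> max 0 (- a)"

lemma mono_weight_nonneg: "(\<And>v. 0 \<le> t v) \<Longrightarrow> 0 \<le> mono_weight t m"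
  unfolding mono_weight_def by (intro sum_nonneg mult_nonneg_nonneg) auto

lemma mono_weight_eq_0D:
  assumes "mono_weight t m = 0" "\<And>v. v \<in> Poly_Mapping.keys m \<Longrightarrow> 0 \<le> t v" "v \<in> Poly_Mapping.keys m"
  shows "t v = 0"
proof -
  have "\<forall>v\<in>Poly_Mapping.keys m. int (Poly_Mapping.lookup m v) * t v = 0"
    using assms(1,2) unfolding mono_weight_def by (subst sum_nonneg_eq_0_iff[symmetric]) auto
  then show ?thesis using assms(3) by (auto simp: in_keys_iff)
qed

text \<open>If the negative parts vanish on \<open>m\<close>, its weights are nonnegative, and as
  they sum to zero they are all zero. The invariant is then nonzero at a model supported on
  coefficients of weight 0, and the edges selected there for each \<open>y\<close> are the
  labellings that produce a pentagon.\<close>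

lemma no_pentagon_weight:
  assumes inv: "invariant_of_weight w p" "p \<in> model_polys" and w: "w > 0"
    and total: "2 * sum r UNIV + sum s UNIV = 0" and no: "\<not> has_pentagon r s"
    and m: "m \<in> Poly_Mapping.keys p"
  shows "1 \<le> mono_weight (\<lambda>v. neg_part (coord_weight r s v)) m"
proof (rule ccontr)
  let ?t = "coord_weight r s"
  assume "\<not> 1 \<le> mono_weight (\<lambda>v. neg_part (?t v)) m"
  then have "mono_weight (\<lambda>v. neg_part (?t v)) m = 0"
    using mono_weight_nonneg[of "\<lambda>v. neg_part (?t v)" m] by simp
  then have nonneg: "0 \<le> ?t v" if "v \<in> Poly_Mapping.keys m" for v
    using mono_weight_eq_0D[of "\<lambda>v. neg_part (?t v)" m v] that by auto
  have "mono_weight ?t m = 0"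
    using invariant_weight[OF inv m] total by simp
  then have "?t v = 0" if "v \<in> Poly_Mapping.keys m" for v
    using that by (intro mono_weight_eq_0D[of ?t m v] nonneg)
  then have "Poly_Mapping.keys m \<subseteq> {v. ?t v = 0}" by blast
  from exists_supported_nonzero[OF m this] obtain \<psi> :: "5 \<times> 5 \<times> 5 \<Rightarrow> complex"
    where \<psi>: "\<And>v. ?t v \<noteq> 0 \<Longrightarrow> \<psi> v = 0" "int_eval \<psi> p \<noteq> 0" by auto
  have "has_pentagon r s"
  proof (rule pentagon_exists[OF total])
    fix y :: "5 \<Rightarrow> int"
    obtain H where H: "inj H" "\<And>k. fst (H k) < snd (H k)" "\<And>k. \<psi> (fst (H k), snd (H k), k) \<noteq> 0"
      "2 * sum y UNIV \<le> (\<Sum>k\<in>UNIV. y (fst (H k)) + y (snd (H k)))"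
      by (rule edge_selection[OF inv w \<psi>(2), of y]) blast
    define U where "U k = {fst (H k), snd (H k)}" for k
    have ne: "fst (H k) \<noteq> snd (H k)" for k using H(2)[of k] by simp
    have "edge_labelling r s U"
    proof
      show "inj U"
      proof (rule injI)
        fix k l assume "U k = U l"
        then have "H k = H l" using H(2)[of k] H(2)[of l]
          by (auto simp: U_def doubleton_eq_iff prod_eq_iff)
        then show "k = l" using H(1) by (simp add: inj_eq)
      qed
      show "card (U k) = 2" for k using ne by (simp add: U_def)
      show "sum r (U k) = - s k" for k
      proof -
        have "?t (fst (H k), snd (H k), k) = 0" using \<psi>(1) H(3)[of k] by blast
        then show ?thesis using ne[of k] by (simp add: U_def coord_weight_def)
      qed
    qed (rule total)
    moreover have "(\<Sum>k\<in>UNIV. sum y (U k)) = (\<Sum>k\<in>UNIV. y (fst (H k)) + y (snd (H k)))"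
      using ne by (simp add: U_def)
    ultimately show "\<exists>U. edge_labelling r s U \<and> 2 * sum y UNIV \<le> (\<Sum>k\<in>UNIV. sum y (U k))"
      using H(4) by auto
  qed
  with no show False by simp
qed

lemma weight_mult_ge:
  assumes "\<And>m. m \<in> Poly_Mapping.keys p \<Longrightarrow> a \<le> mono_weight t m"
    and "\<And>m. m \<in> Poly_Mapping.keys q \<Longrightarrow> b \<le> mono_weight t m"
    and "m \<in> Poly_Mapping.keys (p * q)"
  shows "a + b \<le> mono_weight t m"
proof -
  obtain m1 m2 where "m = m1 + m2" "m1 \<in> Poly_Mapping.keys p" "m2 \<in> Poly_Mapping.keys q"
    using assms(3) keys_mult[of p q] by blast
  then show ?thesis using assms(1)[of m1] assms(2)[of m2] by (simp add: mono_weight_add)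
qed

lemma lookup_of_int_mult:
  "Poly_Mapping.lookup (of_int c * p) m = c * Poly_Mapping.lookup (p :: ('x, int) mvpoly) m"
  unfolding of_int_mvpoly mult_map_scale_conv_mult[symmetric]
  by (simp add: Poly_Mapping.map.rep_eq when_def)

lemma discriminant_weight_no_pentagon:
  assumes D: "is_discriminant D"
    and total: "2 * sum r UNIV + sum s UNIV = 0" and no: "\<not> has_pentagon r s"
    and m: "m \<in> Poly_Mapping.keys D"
  shows "2 \<le> mono_weight (\<lambda>v. neg_part (coord_weight r s v)) m"
proof -
  let ?W = "mono_weight (\<lambda>v. neg_part (coord_weight r s v))"
  obtain c4 c6 where c: "c4 \<in> model_polys" "c6 \<in> model_polys" "invariant_of_weight 4 c4"
    "invariant_of_weight 6 c6" "c4 ^ 3 - c6 ^ 2 = 1728 * D"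
    using D unfolding is_discriminant_def by blast
  have 4: "1 \<le> ?W n" if "n \<in> Poly_Mapping.keys c4" for n
    by (rule no_pentagon_weight[OF c(3,1) _ total no that]) simp
  have 6: "1 \<le> ?W n" if "n \<in> Poly_Mapping.keys c6" for n
    by (rule no_pentagon_weight[OF c(4,2) _ total no that]) simp
  \<comment> \<open>The coefficients are integers, so multiplication by 1728 preserves the
    monomials. This is why residue characteristics 2 and 3 need no separate argument.\<close>
  have "m \<in> Poly_Mapping.keys (1728 * D)"
    using m lookup_of_int_mult[of 1728 D m] by (simp add: in_keys_iff)
  then have "m \<in> Poly_Mapping.keys (c4 * (c4 * c4)) \<or> m \<in> Poly_Mapping.keys (c6 * c6)"
    using keys_diff[of "c4 ^ 3" "c6 ^ 2"] unfolding c(5)[symmetric]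
    by (auto simp: power3_eq_cube power2_eq_square mult.assoc)
  then show ?thesis
  proof
    assume "m \<in> Poly_Mapping.keys (c4 * (c4 * c4))"
    moreover have "2 \<le> ?W n" if "n \<in> Poly_Mapping.keys (c4 * c4)" for n
      using weight_mult_ge[OF 4 4 that] by simp
    ultimately have "1 + 2 \<le> ?W m" by (intro weight_mult_ge[of c4 1 _ "c4 * c4" 2 m] 4)
    then show ?thesis by simp
  next
    assume "m \<in> Poly_Mapping.keys (c6 * c6)"
    from weight_mult_ge[OF 6 6 this] show ?thesis by simp
  qed
qed

section \<open>First-order expansion\<close>

lemma coeff_0_prod: "coeff (\<Prod>v\<in>S. f v) 0 = (\<Prod>v\<in>S. coeff (f v) 0)"
  by (induction S rule: infinite_finite_induct) (auto simp: coeff_mult)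

lemma coeff_1_mult: "coeff (p * q) 1 = coeff p 0 * coeff q 1 + coeff p 1 * coeff q 0"
  by (simp add: coeff_mult)

lemma coeff_0_mult: "coeff (p * q) 0 = coeff p 0 * coeff q 0"
  by (simp add: coeff_mult)

lemma coeff_1_prod:
  assumes "finite S"
  shows "coeff (\<Prod>v\<in>S. f v) 1 = (\<Sum>v\<in>S. coeff (f v) 1 * (\<Prod>u\<in>S - {v}. coeff (f u) 0))"
  using assms
proof (induction S)
  case (insert w S)
  have "(\<Prod>u\<in>insert w S - {v}. coeff (f u) 0) = coeff (f w) 0 * (\<Prod>u\<in>S - {v}. coeff (f u) 0)" if "v \<in> S" for v
  proof -
    have "insert w S - {v} = insert w (S - {v})" using insert.hyps that by auto
    then show ?thesis using insert.hyps by simp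
  qed
  then show ?case using insert
    by (simp add: coeff_1_mult[simplified] coeff_0_prod[simplified] sum_distrib_left mult_ac add.commute)
qed auto

lemma coeff_0_linear_power: "coeff ([:x, y:] ^ n) 0 = x ^ n"
  by (induction n) (auto simp: coeff_0_mult)

lemma coeff_1_linear_power: "coeff ([:x, y:] ^ n) 1 = of_nat n * x ^ (n - 1) * y"
proof (induction n)
  case (Suc n)
  have "coeff ([:x, y:] ^ Suc n) 1 = x * coeff ([:x, y:] ^ n) 1 + y * coeff ([:x, y:] ^ n) 0"
    unfolding power_Suc by (subst coeff_1_mult) (simp add: coeff_0_linear_power)
  also have "\<dots> = of_nat (Suc n) * x ^ (Suc n - 1) * y"
    unfolding Suc.IH coeff_0_linear_power by (cases n) (simp_all add: algebra_simps)
  finally show ?case .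
qed simp

lemma mono_eval_UNIV:
  fixes m :: "'x::finite \<Rightarrow>\<^sub>0 nat"
  shows "mono_eval x m = (\<Prod>v\<in>UNIV. x v ^ Poly_Mapping.lookup m v)"
  by (rule mono_eval_superset) auto

lemma coeff_1_mono_eval:
  fixes m :: "'x::finite \<Rightarrow>\<^sub>0 nat"
  shows "coeff (mono_eval (\<lambda>v. [:x v, \<eta> v:]) m) 1 =
    (\<Sum>v\<in>UNIV. \<eta> v * (of_nat (Poly_Mapping.lookup m v) * mono_eval x (m - Poly_Mapping.single v 1)))"
proof -
  have "mono_eval x (m - Poly_Mapping.single v 1) =
      x v ^ (Poly_Mapping.lookup m v - 1) * (\<Prod>u\<in>UNIV - {v}. x u ^ Poly_Mapping.lookup m u)" for v
    unfolding mono_eval_UNIV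
    by (subst prod.remove[of _ v]) (auto simp: lookup_minus lookup_single when_def intro!: prod.cong arg_cong2[of _ _ _ _ "(*)"])
  then show ?thesis
    unfolding mono_eval_UNIV by (subst coeff_1_prod) (simp_all only: coeff_1_linear_power coeff_0_linear_power finite mult_ac)
qed

lemma int_eval_partial_deriv:
  fixes p :: "('x, int) mvpoly"
  shows "int_eval x (partial_deriv v p) = (\<Sum>m\<in>Poly_Mapping.keys p.
    of_int (Poly_Mapping.lookup p m) * (of_nat (Poly_Mapping.lookup m v) * mono_eval x (m - Poly_Mapping.single v 1)))"
  by (simp add: partial_deriv_def int_eval_single mult_ac)

text \<open>Linear polynomials serve as first-order deformations: the sum on the right is the
  derivative at \<open>x\<close> in the direction \<open>\<eta>\<close>.\<close>

lemma coeff_1_int_eval: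
  fixes p :: "('x::finite, int) mvpoly" and x :: "'x \<Rightarrow> 'b::comm_ring_1"
  shows "coeff (int_eval (\<lambda>v. [:x v, \<eta> v:]) p) 1 = (\<Sum>v\<in>UNIV. \<eta> v * int_eval x (partial_deriv v p))"
proof -
  have *: "coeff (of_int c * q) 1 = of_int c * coeff q 1" for c :: int and q :: "'b poly"
    by (simp add: of_int_poly)
  have "coeff (int_eval (\<lambda>v. [:x v, \<eta> v:]) p) 1 = (\<Sum>m\<in>Poly_Mapping.keys p. \<Sum>v\<in>UNIV.
     \<eta> v * (of_int (Poly_Mapping.lookup p m) * (of_nat (Poly_Mapping.lookup m v) * mono_eval x (m - Poly_Mapping.single v 1))))"
    unfolding int_eval_alt coeff_sum * coeff_1_mono_eval by (simp add: sum_distrib_left mult_ac)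
  also have "\<dots> = (\<Sum>v\<in>UNIV. \<eta> v * int_eval x (partial_deriv v p))"
    unfolding int_eval_partial_deriv by (subst sum.swap) (simp add: sum_distrib_left)
  finally show ?thesis .
qed

lemma lookup_partial_deriv:
  fixes p :: "('x, int) mvpoly"
  shows "Poly_Mapping.lookup (partial_deriv v p) n =
    (int (Poly_Mapping.lookup n v) + 1) * Poly_Mapping.lookup p (n + Poly_Mapping.single v 1)"
proof -
  have iff: "m - Poly_Mapping.single v 1 = n \<longleftrightarrow> m = n + Poly_Mapping.single v 1"
    if "Poly_Mapping.lookup m v \<noteq> 0" for m :: "'x \<Rightarrow>\<^sub>0 nat"
  proof
    assume n: "m - Poly_Mapping.single v 1 = n"
    show "m = n + Poly_Mapping.single v 1"
    proof (rule poly_mapping_eqI)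
      fix u show "Poly_Mapping.lookup m u = Poly_Mapping.lookup (n + Poly_Mapping.single v 1) u"
        using that by (cases "u = v") (auto simp: n[symmetric] lookup_minus lookup_add lookup_single when_def)
    qed
  qed simp
  have "Poly_Mapping.lookup (partial_deriv v p) n = (\<Sum>m\<in>Poly_Mapping.keys p.
      if m = n + Poly_Mapping.single v 1 then int (Poly_Mapping.lookup m v) * Poly_Mapping.lookup p m else 0)"
    unfolding partial_deriv_def lookup_sum
  proof (rule sum.cong)
    fix m assume "m \<in> Poly_Mapping.keys p"
    show "Poly_Mapping.lookup (Poly_Mapping.single (m - Poly_Mapping.single v 1) (of_nat (Poly_Mapping.lookup m v) * Poly_Mapping.lookup p m)) n =
      (if m = n + Poly_Mapping.single v 1 then int (Poly_Mapping.lookup m v) * Poly_Mapping.lookup p m else 0)"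
    proof (cases "Poly_Mapping.lookup m v = 0")
      case True
      then have "m \<noteq> n + Poly_Mapping.single v 1" by (auto simp: lookup_add)
      then show ?thesis using True by simp
    next
      case False
      then show ?thesis using iff[OF False] by (simp add: lookup_single when_def)
    qed
  qed simp
  then show ?thesis by (auto simp: in_keys_iff lookup_add)
qed

text \<open>Comparing coefficients in a first-order invariance: the constant part \<open>\<eta>\<^sub>0\<close> lowers the degree by one,
  while the linear part \<open>L\<close> only involves coefficients of \<open>p\<close> of degree at most \<open>d\<close> and weight less than 4, which vanish.\<close>

lemma derivation_step:
  fixes p :: "('x::finite, int) mvpoly" and t :: "'x \<Rightarrow> int"
  assumes id: "coeff (int_eval (\<lambda>v. [:var v, of_int (\<eta>0 v) + L v:]) p) 1 = of_int \<kappa> * p"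
    and IH: "\<And>m. m \<in> Poly_Mapping.keys p \<Longrightarrow> mono_weight (\<lambda>_. 1) m \<le> d \<Longrightarrow> 4 \<le> mono_weight (\<lambda>v. \<bar>t v\<bar>) m"
    and L: "\<And>v k. k \<in> Poly_Mapping.keys (L v) \<Longrightarrow> \<exists>u. k = Poly_Mapping.single u 1 \<and> \<bar>t v\<bar> \<le> \<bar>t u\<bar> + \<tau>"
    and n: "mono_weight (\<lambda>_. 1) n \<le> d" "mono_weight (\<lambda>v. \<bar>t v\<bar>) n + \<tau> < 4" and \<tau>: "0 \<le> \<tau>"
  shows "(\<Sum>v\<in>UNIV. \<eta>0 v * ((int (Poly_Mapping.lookup n v) + 1) * Poly_Mapping.lookup p (n + Poly_Mapping.single v 1))) = 0"
proof -
  \<comment> \<open>A contribution to \<open>n\<close> comes from a variable \<open>u\<close> of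
    \<open>L v\<close> and a monomial of the derivative. Trading \<open>u\<close> for
    \<open>v\<close> keeps the degree and raises the weight by at most \<open>\<tau>\<close>, so the
    monomial of \<open>p\<close> behind it would still have weight below 4.\<close>
  have Lz: "Poly_Mapping.lookup (L v * partial_deriv v p) n = 0" for v
  proof (rule ccontr)
    assume "Poly_Mapping.lookup (L v * partial_deriv v p) n \<noteq> 0"
    then have "n \<in> Poly_Mapping.keys (L v * partial_deriv v p)" by (simp add: in_keys_iff)
    then obtain k n' where kn: "n = k + n'" "k \<in> Poly_Mapping.keys (L v)" "n' \<in> Poly_Mapping.keys (partial_deriv v p)"
      using keys_mult[of "L v" "partial_deriv v p"] by blast
    then obtain u where u: "k = Poly_Mapping.single u 1" "\<bar>t v\<bar> \<le> \<bar>t u\<bar> + \<tau>" using L by blast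
    have "n' + Poly_Mapping.single v 1 \<in> Poly_Mapping.keys p"
      using kn(3) by (auto simp: in_keys_iff lookup_partial_deriv)
    moreover have "mono_weight (\<lambda>_. 1) (n' + Poly_Mapping.single v 1) \<le> d"
      using n(1) by (simp add: kn(1) u(1) mono_weight_add)
    ultimately have "4 \<le> mono_weight (\<lambda>v. \<bar>t v\<bar>) (n' + Poly_Mapping.single v 1)" by (rule IH)
    moreover have "mono_weight (\<lambda>v. \<bar>t v\<bar>) n = \<bar>t u\<bar> + mono_weight (\<lambda>v. \<bar>t v\<bar>) n'"
      by (simp add: kn(1) u(1) mono_weight_add)
    ultimately show False using u(2) n(2) by (simp add: mono_weight_add)
  qed
  \<comment> \<open>This disposes of the right-hand side, a multiple of \<open>p\<close>
    itself.\<close>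
  have "Poly_Mapping.lookup p n = 0"
  proof (rule ccontr)
    assume "Poly_Mapping.lookup p n \<noteq> 0"
    then have "4 \<le> mono_weight (\<lambda>v. \<bar>t v\<bar>) n" using n(1) by (intro IH) (auto simp: in_keys_iff)
    then show False using n(2) \<tau> by simp
  qed
  then have "0 = Poly_Mapping.lookup (of_int \<kappa> * p) n" by (simp add: lookup_of_int_mult)
  also have "\<dots> = Poly_Mapping.lookup (\<Sum>v\<in>UNIV. (of_int (\<eta>0 v) + L v) * partial_deriv v p) n"
    unfolding id[symmetric] coeff_1_int_eval int_eval_var_id ..
  also have "\<dots> = (\<Sum>v\<in>UNIV. \<eta>0 v * ((int (Poly_Mapping.lookup n v) + 1) * Poly_Mapping.lookup p (n + Poly_Mapping.single v 1)))"
    by (simp add: lookup_sum distrib_right lookup_add Lz lookup_of_int_mult lookup_partial_deriv)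
  finally show ?thesis by simp
qed

section \<open>Elementary matrices\<close>

lemma less_5 [simp]:
  "(0::5) < 1" "(0::5) < 2" "(0::5) < 3" "(0::5) < 4" "(1::5) < 2" "(1::5) < 3" "(1::5) < 4"
  "(2::5) < 3" "(2::5) < 4" "(3::5) < 4"
  "\<not> (1::5) < 0" "\<not> (2::5) < 0" "\<not> (3::5) < 0" "\<not> (4::5) < 0" "\<not> (2::5) < 1" "\<not> (3::5) < 1" "\<not> (4::5) < 1"
  "\<not> (3::5) < 2" "\<not> (4::5) < 2" "\<not> (4::5) < 3"
  by (simp_all add: less_bit1_def bit1.Rep_numeral bit1.Rep_0 bit1.Rep_1)

lemma forall_5: "(\<forall>i::5. P i) \<longleftrightarrow> P 0 \<and> P 1 \<and> P 2 \<and> P 3 \<and> P 4"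
proof -
  have "(\<forall>i::5. P i) \<longleftrightarrow> (\<forall>i\<in>{0, 1, 2, 3, 4}. P i)" by (simp only: UNIV_5[symmetric] ball_UNIV)
  then show ?thesis by simp
qed

text \<open>With a polynomial variable for \<open>s\<close> this is an infinitesimal transformation.
  The case \<open>x = b\<close> is meant to be included: it scales by \<open>1 + s\<close>.\<close>

definition elem_mat :: "5 \<Rightarrow> 5 \<Rightarrow> 'a::comm_ring_1 \<Rightarrow> 'a^5^5"
  where "elem_mat x b s = (\<chi> i j. (if i = j then 1 else 0) + (if i = x \<and> j = b then s else 0))"

lemma sum_elem_mat: "(\<Sum>a\<in>UNIV. elem_mat x b s $ i $ a * f a) = f i + (if i = x then s * f b else 0)"
proof -
  have "(\<Sum>a\<in>UNIV. elem_mat x b s $ i $ a * f a) =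
    (\<Sum>a\<in>UNIV. if i = a then f a else 0) + (\<Sum>a\<in>UNIV. if a = b then if i = x then s * f a else 0 else 0)"
    unfolding sum.distrib[symmetric] by (intro sum.cong) (auto simp: elem_mat_def distrib_right)
  then show ?thesis by simp
qed

lemma mat_1_eq_elem_mat: "mat 1 = elem_mat 0 0 0"
  by (simp add: mat_def elem_mat_def)

lemma act_nth_nested:
  "act A B \<Phi> $ i $ j $ k = (\<Sum>l\<in>UNIV. B $ k $ l * (\<Sum>a\<in>UNIV. A $ i $ a * (\<Sum>b\<in>UNIV. A $ j $ b * \<Phi> $ a $ b $ l)))"
  by (simp add: act_nth sum_distrib_left mult.assoc)

text \<open>The term with the square of \<open>s\<close> would multiply the diagonal entry
  \<open>\<Phi> $ b $ b\<close>, which is zero. So the first-order formula is exact.\<close>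

lemma act_elem_mat_left:
  assumes "\<Phi> \<in> X\<^sub>5 R"
  shows "act (elem_mat x b s) (mat 1) \<Phi> $ i $ j $ k =
    \<Phi> $ i $ j $ k + (if i = x then s * \<Phi> $ b $ j $ k else 0) + (if j = x then s * \<Phi> $ i $ b $ k else 0)"
  unfolding act_nth_nested mat_1_eq_elem_mat sum_elem_mat
  using X5_alternating(1)[OF assms] by (simp add: algebra_simps)

lemma act_elem_mat_right:
  "act (mat 1) (elem_mat x b s) \<Phi> $ i $ j $ k = \<Phi> $ i $ j $ k + (if k = x then s * \<Phi> $ i $ j $ b else 0)"
  unfolding act_nth_nested mat_1_eq_elem_mat sum_elem_mat by simp

lemma det_elem_mat: "det (elem_mat x b s) = (if x = b then 1 + s else 1)"
proof (cases "x = b")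
  case True
  have "elem_mat x b s = diag_mat (\<lambda>i. if i = x then 1 + s else 1)"
    using True by (simp add: elem_mat_def diag_mat_def vec_eq_iff)
  then show ?thesis using True by (simp add: det_diag_mat)
next
  case False
  have "elem_mat x b s = (\<chi> k. if k = x then row x (mat 1) + s *s row b (mat 1) else row k (mat 1))"
    by (simp add: elem_mat_def row_def mat_def vec_eq_iff)
  then show ?thesis using False det_row_operation[OF False, of "mat 1" s] by simp
qed

section \<open>Expansion of the discriminant at the pentagon\<close>

text \<open>The model with \<open>\<Phi>\<^bsub>i,i+1\<^esub> = x\<^sub>i\<close> for \<open>i\<close> modulo 5; its curve is a cycle of five lines.\<close>

definition pent :: "5 \<times> 5 \<times> 5 \<Rightarrow> int"
  where "pent = (\<lambda>(i, j, k). if i < j then if j = i + 1 \<and> k = i then 1 else if i = j + 1 \<and> k = j then - 1 else 0 else 0)"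

text \<open>The Taylor expansion at the pentagon; its constant coefficient is the value
  there.\<close>

definition pent_expansion :: "model_poly \<Rightarrow> model_poly"
  where "pent_expansion D = int_eval (\<lambda>v. var v + of_int (pent v)) D"

lemma int_eval_pent_expansion:
  "int_eval x (pent_expansion D) = int_eval (\<lambda>v. x v + of_int (pent v)) D"
  by (simp add: pent_expansion_def int_eval_compose)

text \<open>The weights of the variables are determined by \<open>r\<close> through the requirement
  that the one-parameter subgroup fix the pentagon.\<close>

definition pent_weight :: "(5 \<Rightarrow> int) \<Rightarrow> 5 \<times> 5 \<times> 5 \<Rightarrow> int"
  where "pent_weight r = coord_weight r (\<lambda>i. - (r i + r (i + 1)))"

lemma pent_weight_pent: "pent v \<noteq> 0 \<Longrightarrow> pent_weight r v = 0"
  by (auto simp: pent_def pent_weight_def coord_weight_def split: if_splits prod.splits)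

text \<open>Expressed by a weight: scaling the coordinates without \<open>i < j\<close> has no
  effect on the value, so their total exponent in a monomial is 0.\<close>

lemma pent_expansion_support:
  assumes "D \<in> model_polys" "m \<in> Poly_Mapping.keys (pent_expansion D)" "(i, j, k) \<in> Poly_Mapping.keys m"
  shows "i < j"
proof -
  let ?t = "\<lambda>(i, j, k). of_bool (\<not> i < j) :: int"
  have "mono_weight ?t m = 0"
  proof (rule weight_of_semi_invariant[OF _ assms(2)])
    fix x :: "5 \<times> 5 \<times> 5 \<Rightarrow> complex"
    have "mono_eval (\<lambda>v. 2 powi ?t v * x v + of_int (pent v)) n = mono_eval (\<lambda>v. x v + of_int (pent v)) n"
      if "n \<in> Poly_Mapping.keys D" for n
      unfolding mono_eval_def
    proof (intro prod.cong refl)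
      fix v assume "v \<in> Poly_Mapping.keys n"
      then have "v \<in> {(i, j, k). i < j}" using assms(1) that by (auto simp: model_polys_def)
      then have "?t v = 0" by auto
      then show "(2 powi ?t v * x v + of_int (pent v)) ^ Poly_Mapping.lookup n v = (x v + of_int (pent v)) ^ Poly_Mapping.lookup n v"
        by (simp only: power_int_0_right mult_1)
    qed
    then show "int_eval (\<lambda>v. 2 powi ?t v * x v) (pent_expansion D) = 2 powi 0 * int_eval x (pent_expansion D)"
      unfolding int_eval_pent_expansion unfolding int_eval_alt by simp
  qed
  from mono_weight_eq_0D[OF this _ assms(3)] show ?thesis by auto
qed

text \<open>The subgroup fixes the pentagon, so passing to coordinates centred there keeps the
  semi-invariance; its weight is 0 because each \<open>r i\<close> is counted twice in the
  variables.\<close>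

lemma pent_expansion_weight:
  assumes inv: "invariant_of_weight w D" "D \<in> model_polys" and m: "m \<in> Poly_Mapping.keys (pent_expansion D)"
  shows "mono_weight (pent_weight r) m = 0"
proof (rule weight_of_semi_invariant[OF _ m])
  fix x :: "5 \<times> 5 \<times> 5 \<Rightarrow> complex"
  let ?s = "\<lambda>i. - (r i + r (i + 1))"
  have "bij (\<lambda>i::5. i + 1)" by (rule bij_plus_right)
  then have "(\<Sum>i\<in>UNIV. r (i + 1)) = (\<Sum>i\<in>UNIV. r i)" by (rule sum.reindex_bij_betw)
  then have total: "2 * sum r UNIV + sum ?s UNIV = 0" by (simp add: sum_negf sum.distrib sum_subtractf)
  have "2 powi pent_weight r v * x v + of_int (pent v) = 2 powi pent_weight r v * (x v + of_int (pent v))" for v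
    using pent_weight_pent[of v r] by (cases "pent v = 0") (auto simp: distrib_left)
  then have "int_eval (\<lambda>v. 2 powi pent_weight r v * x v) (pent_expansion D) =
      int_eval (\<lambda>v. 2 powi coord_weight r ?s v * (x v + of_int (pent v))) D"
    by (simp only: int_eval_pent_expansion pent_weight_def)
  also have "\<dots> = 2 powi (int w * (2 * sum r UNIV + sum ?s UNIV)) * int_eval (\<lambda>v. x v + of_int (pent v)) D"
    by (rule torus_action[OF inv]) simp
  finally show "int_eval (\<lambda>v. 2 powi pent_weight r v * x v) (pent_expansion D) = 2 powi 0 * int_eval x (pent_expansion D)"
    by (simp only: total int_eval_pent_expansion mult_zero_right)
qed

section \<open>Infinitesimal row operations and changes of variables\<close>

lemma coeff_0_int_eval: "coeff (int_eval f p) 0 = int_eval (\<lambda>v. coeff (f v) 0) p"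
  by (simp add: int_eval_alt coeff_sum mono_eval_def coeff_0_mult coeff_0_prod coeff_0_power of_int_poly)

text \<open>Invariance over polynomials in one deformation parameter, compared at first order. The
  factor \<open>12 * e\<close> is the linear coefficient of
  \<open>[:1, of_int e:] ^ 12\<close>.\<close>

lemma pent_expansion_first_order:
  assumes inv: "invariant_of_weight 12 D" "D \<in> model_polys"
    and act: "act A B (coord_model (\<lambda>v. [:var v + of_int (pent v):])) = coord_model (\<lambda>v. [:var v + of_int (pent v), \<eta> v:])"
    and det: "act_det A B = [:1, of_int e:]"
  shows "coeff (int_eval (\<lambda>v. [:var v, \<eta> v:]) (pent_expansion D)) 1 = of_int (12 * e) * pent_expansion D"
proof -
  have "int_eval (\<lambda>v. [:var v, \<eta> v:]) (pent_expansion D) = int_eval (\<lambda>v. [:var v + of_int (pent v), \<eta> v:]) D"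
    by (simp add: int_eval_pent_expansion of_int_poly)
  also have "\<dots> = [:1, of_int e:] ^ 12 * int_eval (\<lambda>v. [:var v + of_int (pent v), 0:]) D"
    using invariance_any_ring[OF inv(1) coord_model_in[of "\<lambda>v. [:var v + of_int (pent v):]"], of A B]
    by (simp add: act det eval_model_coord[OF inv(2)])
  finally show ?thesis
    by (simp only: coeff_1_mult coeff_1_int_eval coeff_0_int_eval coeff_1_linear_power coeff_0_linear_power coeff_pCons_0)
      (simp add: pent_expansion_def)
qed

text \<open>The derivative of the action of \<open>elem_mat x b\<close> on the rows. At
  \<open>pent\<close> it is a tangent vector of the orbit and serves as constant part in
  \<open>derivation_step\<close>; at \<open>var\<close> it is the linear part.
  \<open>pent_col\<close> plays the same role for changes of variables.\<close>

definition pent_row :: "5 \<Rightarrow> 5 \<Rightarrow> (5 \<times> 5 \<times> 5 \<Rightarrow> 'a::comm_ring_1) \<Rightarrow> 5 \<times> 5 \<times> 5 \<Rightarrow> 'a"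
  where "pent_row x b \<psi> = (\<lambda>(i, j, k). if i < j then
     (if i = x then coord_model \<psi> $ b $ j $ k else 0) + (if j = x then coord_model \<psi> $ i $ b $ k else 0) else 0)"

definition pent_col :: "5 \<Rightarrow> 5 \<Rightarrow> (5 \<times> 5 \<times> 5 \<Rightarrow> 'a::comm_ring_1) \<Rightarrow> 5 \<times> 5 \<times> 5 \<Rightarrow> 'a"
  where "pent_col x b \<psi> = (\<lambda>(i, j, k). if k = x then \<psi> (i, j, b) else 0)"

lemma pent_expansion_row:
  assumes "invariant_of_weight 12 D" "D \<in> model_polys" "x \<noteq> b"
  shows "coeff (int_eval (\<lambda>v. [:var v, of_int (pent_row x b pent v) + pent_row x b var v:]) (pent_expansion D)) 1
     = of_int 0 * pent_expansion D"
proof -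
  have "coeff (int_eval (\<lambda>v. [:var v, of_int (pent_row x b pent v) + pent_row x b var v:]) (pent_expansion D)) 1
     = of_int (12 * 0) * pent_expansion D"
  proof (rule pent_expansion_first_order[OF assms(1,2)])
    show "act (elem_mat x b [:0, 1:]) (mat 1) (coord_model (\<lambda>v. [:var v + of_int (pent v):])) =
      coord_model (\<lambda>v. [:var v + of_int (pent v), of_int (pent_row x b pent v) + pent_row x b var v:])"
      by (simp only: vec_eq_iff act_elem_mat_left[OF coord_model_in]) (auto simp: pent_row_def assms(3))
    show "act_det (elem_mat x b [:0, 1 :: model_poly:]) (mat 1) = [:1, of_int 0:]"
      using assms(3) unfolding act_det_def det_elem_mat det_I by (simp add: one_pCons power2_eq_square)
  qed
  then show ?thesis by simp
qed

lemma pent_expansion_col: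
  assumes "invariant_of_weight 12 D" "D \<in> model_polys"
  shows "coeff (int_eval (\<lambda>v. [:var v, of_int (pent_col x b pent v) + pent_col x b var v:]) (pent_expansion D)) 1
     = of_int (12 * of_bool (x = b)) * pent_expansion D"
proof (rule pent_expansion_first_order[OF assms(1,2)])
  show "act (mat 1) (elem_mat x b [:0, 1:]) (coord_model (\<lambda>v. [:var v + of_int (pent v):])) =
    coord_model (\<lambda>v. [:var v + of_int (pent v), of_int (pent_col x b pent v) + pent_col x b var v:])"
    by (simp only: vec_eq_iff act_elem_mat_right) (auto simp: pent_col_def)
  show "act_det (mat 1) (elem_mat x b [:0, 1 :: model_poly:]) = [:1, of_int (of_bool (x = b)):]"
    unfolding act_det_def det_elem_mat det_I by (simp add: one_pCons power2_eq_square)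
qed

lemma numeral_5_simps: "(5::5) = 0" "(6::5) = 1" "(7::5) = 2" "(8::5) = 3" "(9::5) = 4" "(- 1 :: 5) = 4"
  by simp_all

lemma pent_neq_0_iff:
  "pent (i, j, k) \<noteq> 0 \<longleftrightarrow> i < j \<and> (j = i + 1 \<and> k = i \<or> i = j + 1 \<and> k = j)"
  by (simp add: pent_def)

lemma pent_unique_edge:
  assumes "pent (i, j, c) \<noteq> 0" "pent (i', j', c) \<noteq> 0" shows "i' = i \<and> j' = j"
  using assms by (auto simp: pent_neq_0_iff)

lemma pent_row_neq_0D:
  assumes "pent_row x b pent (i, j, k) \<noteq> 0"
  shows "i < j \<and> (i, j, k) \<in> {(x, b + 1, b), (x, b - 1, b - 1), (b + 1, x, b), (b - 1, x, b - 1)}"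
proof -
  have *: "coord_model pent $ p $ q $ l \<noteq> 0 \<Longrightarrow> q = p + 1 \<and> l = p \<or> p = q + 1 \<and> l = q" for p q l
    by (auto simp: pent_def split: if_splits)
  have "i < j" using assms by (auto simp: pent_row_def split: if_splits)
  moreover have "i = x \<and> coord_model pent $ b $ j $ k \<noteq> 0 \<or> j = x \<and> coord_model pent $ i $ b $ k \<noteq> 0"
    using assms by (auto simp: pent_row_def simp del: coord_model_nth split: if_splits)
  ultimately show ?thesis using *[of b j k] *[of i b k] by auto
qed

text \<open>For \<open>\<mu>\<close> from 0 to 4, the coefficient of the variable
  \<open>\<mu> + 2\<close> in the entry with indices \<open>\<mu> + 1\<close> and
  \<open>\<mu> - 1\<close>, sorted. Such a term adds a multiple of the square of that variable to
  the Pfaffian that is the product of the variables \<open>\<mu> + 1\<close> and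
  \<open>\<mu> + 3\<close>, so it smooths the node at a coordinate point.\<close>

definition pent_directions :: "(5 \<times> 5 \<times> 5) set"
  where "pent_directions = {(1, 4, 2), (0, 2, 3), (1, 3, 4), (2, 4, 0), (0, 3, 1)}"

text \<open>Apart from these five normal directions, all coordinate directions are tangent to the orbit of
  the pentagon: the remaining ones on an edge by a change of variables, the others by a row operation.\<close>

lemma pent_row_reaches:
  assumes "i < j" "\<And>c. pent (i, j, c) = 0" "(i, j, k) \<notin> pent_directions"
  obtains x b where "x \<noteq> b" "pent_row x b pent (i, j, k) \<noteq> 0"
    "\<And>i' j' k'. pent_row x b pent (i', j', k') \<noteq> 0 \<Longrightarrow> (i', j', k') = (i, j, k) \<or> (\<exists>c. pent (i', j', c) \<noteq> 0)"
proof -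
  define ok where "ok x b \<longleftrightarrow> x \<noteq> b \<and> pent_row x b pent (i, j, k) \<noteq> 0 \<and>
    (\<forall>v\<in>{(x, b + 1, b), (x, b - 1, b - 1), (b + 1, x, b), (b - 1, x, b - 1)}.
      fst v < fst (snd v) \<longrightarrow> v = (i, j, k) \<or> fst (snd v) = fst v + 1 \<or> fst v = fst (snd v) + 1)" for x b :: 5
  have "\<exists>x b. ok x b"
  proof -
    have nonedge: "j \<noteq> i + 1" "i \<noteq> j + 1" using assms(1) assms(2)[of i] assms(2)[of j] by (auto simp: pent_def)
    have "\<forall>i j. i < j \<longrightarrow> j \<noteq> i + 1 \<longrightarrow> i \<noteq> j + 1 \<longrightarrow>
       (i = 1 \<and> j = 4 \<or> i = 0 \<and> j = 2 \<or> i = 1 \<and> j = 3 \<or> i = 2 \<and> j = 4 \<or> i = (0::5) \<and> j = 3)"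
      by (simp add: forall_5)
    from this[rule_format, OF assms(1) nonedge]
    have ij: "i = 1 \<and> j = 4 \<or> i = 0 \<and> j = 2 \<or> i = 1 \<and> j = 3 \<or> i = 2 \<and> j = 4 \<or> i = 0 \<and> j = 3"
      .
    have "k \<in> {0, 1, 2, 3, 4}" using UNIV_I[of k] unfolding UNIV_5 .
    then have k: "k = 0 \<or> k = 1 \<or> k = 2 \<or> k = 3 \<or> k = 4" by simp
    \<comment> \<open>Every pair that is not an edge of the 5-cycle consists of the two neighbours
      of one vertex, here \<open>\<mu>\<close>.\<close>
    define \<mu> where "\<mu> = (if i = 1 \<and> j = 4 then 0 else if i = 0 \<and> j = 2 then 1 else if i = 1 \<and> j = 3 then 2 else if i = 2 \<and> j = 4 then 3 else (4::5))"
    show ?thesis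
    \<comment> \<open>\<open>x\<close> is one vertex of the pair, and \<open>b\<close> is joined to
      the other one by the edge carrying the variable \<open>k\<close>. The remaining value
      \<open>k = \<mu> + 2\<close> belongs to the normal directions, so the last branches are
      arbitrary for it.\<close>
    proof (rule exI[of _ "if k = \<mu> + 4 \<or> k = \<mu> + 3 then \<mu> + 1 else \<mu> + 4"], rule exI[of _ "if k = \<mu> + 4 \<or> k = \<mu> then \<mu> else if k = \<mu> + 1 then \<mu> + 2 else \<mu> + 3"])
      show "ok (if k = \<mu> + 4 \<or> k = \<mu> + 3 then \<mu> + 1 else \<mu> + 4) (if k = \<mu> + 4 \<or> k = \<mu> then \<mu> else if k = \<mu> + 1 then \<mu> + 2 else \<mu> + 3)"
        using ij k assms(3)
        by (elim disjE conjE; simp add: ok_def \<mu>_def pent_row_def pent_def pent_directions_def numeral_5_simps)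
    qed
  qed
  then obtain x b where xb: "ok x b" by blast
  show thesis
  proof (rule that[of x b])
    fix i' j' k' assume "pent_row x b pent (i', j', k') \<noteq> 0"
    then have "i' < j'" and mem: "(i', j', k') \<in> {(x, b + 1, b), (x, b - 1, b - 1), (b + 1, x, b), (b - 1, x, b - 1)}"
      using pent_row_neq_0D by blast+
    have "\<forall>v\<in>{(x, b + 1, b), (x, b - 1, b - 1), (b + 1, x, b), (b - 1, x, b - 1)}.
        fst v < fst (snd v) \<longrightarrow> v = (i, j, k) \<or> fst (snd v) = fst v + 1 \<or> fst v = fst (snd v) + 1"
      using xb unfolding ok_def by (elim conjE)
    from bspec[OF this mem] \<open>i' < j'\<close> have "(i', j', k') = (i, j, k) \<or> j' = i' + 1 \<or> i' = j' + 1"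
      by (simp only: fst_conv snd_conv simp_thms)
    then show "(i', j', k') = (i, j, k) \<or> (\<exists>c. pent (i', j', c) \<noteq> 0)"
      using \<open>i' < j'\<close> by (auto simp: pent_neq_0_iff)
  qed (use xb in \<open>auto simp: ok_def\<close>)
qed

lemma keys_coord_model_var:
  assumes "u \<in> Poly_Mapping.keys (coord_model var $ p $ q $ l)"
  shows "u = Poly_Mapping.single (p, q, l) 1 \<or> u = Poly_Mapping.single (q, p, l) 1"
  using assms by (auto simp: var_def split: if_splits)

lemma keys_pent_row_var:
  assumes "u \<in> Poly_Mapping.keys (pent_row x b var v)"
  shows "\<exists>z. u = Poly_Mapping.single z 1 \<and> pent_weight r v = pent_weight r z + (r x - r b)"
proof -
  obtain i j k where v: "v = (i, j, k)" by (cases v)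
  have "i < j" using assms by (auto simp: v pent_row_def split: if_splits)
  then have "u \<in> Poly_Mapping.keys ((if i = x then coord_model var $ b $ j $ k else 0) + (if j = x then coord_model var $ i $ b $ k else 0))"
    using assms by (simp only: v pent_row_def prod.case if_True)
  then have "u \<in> Poly_Mapping.keys (if i = x then coord_model var $ b $ j $ k else 0) \<or> u \<in> Poly_Mapping.keys (if j = x then coord_model var $ i $ b $ k else 0)"
    by (rule subsetD[OF keys_add, THEN UnE]) auto
  then consider "i = x" "u \<in> Poly_Mapping.keys (coord_model var $ b $ j $ k)" | "j = x" "u \<in> Poly_Mapping.keys (coord_model var $ i $ b $ k)"
    by (auto simp del: coord_model_nth split: if_splits)
  then show ?thesis
  proof cases
    case 1
    have "pent_weight r v = pent_weight r (b, j, k) + (r x - r b)" "pent_weight r (j, b, k) = pent_weight r (b, j, k)"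
      using 1(1) by (simp_all add: v pent_weight_def coord_weight_def)
    then show ?thesis using keys_coord_model_var[OF 1(2)] by metis
  next
    case 2
    have "pent_weight r v = pent_weight r (i, b, k) + (r x - r b)" "pent_weight r (b, i, k) = pent_weight r (i, b, k)"
      using 2(1) by (simp_all add: v pent_weight_def coord_weight_def)
    then show ?thesis using keys_coord_model_var[OF 2(2)] by metis
  qed
qed

lemma pent_row_weight:
  assumes "pent_row x b pent v \<noteq> 0"
  shows "pent_weight r v = r x - r b"
proof -
  obtain i j k where v: "v = (i, j, k)" by (cases v)
  show ?thesis using pent_row_neq_0D[of x b i j k] assms by (auto simp: v pent_weight_def coord_weight_def)
qed

lemma keys_pent_col_var:
  assumes "u \<in> Poly_Mapping.keys (pent_col x b var v)"
  shows "\<exists>z. u = Poly_Mapping.single z 1 \<and>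
    pent_weight r v = pent_weight r z + (r b + r (b + 1) - r x - r (x + 1))"
proof -
  obtain i j k where v: "v = (i, j, k)" by (cases v)
  have "k = x" "u = Poly_Mapping.single (i, j, b) 1"
    using assms by (auto simp: v pent_col_def var_def split: if_splits)
  then show ?thesis by (intro exI[of _ "(i, j, b)"]) (simp add: v pent_weight_def coord_weight_def)
qed

text \<open>The five numbers sum to zero, so the sum of their absolute values is even; the linear map
  sending \<open>r\<close> to them has square \<open>5 r\<close> minus the sum of \<open>r\<close>.\<close>

lemma spread_ge_4:
  fixes a b c d e :: int
  assumes small: "\<bar>b + e - c - d\<bar> + \<bar>a + c - d - e\<bar> + \<bar>b + d - e - a\<bar> + \<bar>c + e - a - b\<bar> + \<bar>a + d - b - c\<bar> < 4"
  shows "a = b \<and> b = c \<and> c = d \<and> d = e"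
proof -
  define p0 p1 p2 p3 p4 where p: "p0 = b + e - c - d" "p1 = a + c - d - e" "p2 = b + d - e - a"
    "p3 = c + e - a - b" "p4 = a + d - b - c"
  have abs: "\<exists>h. \<bar>x\<bar> = x + 2 * h" for x :: int by (cases "x \<ge> 0") (auto intro: exI[of _ 0] exI[of _ "- x"])
  obtain h0 h1 h2 h3 h4 where h: "\<bar>p0\<bar> = p0 + 2 * h0" "\<bar>p1\<bar> = p1 + 2 * h1" "\<bar>p2\<bar> = p2 + 2 * h2"
    "\<bar>p3\<bar> = p3 + 2 * h3" "\<bar>p4\<bar> = p4 + 2 * h4"
    using abs by metis
  have "p0 + p1 + p2 + p3 + p4 = 0" by (simp add: p)
  then have sum: "\<bar>p0\<bar> + \<bar>p1\<bar> + \<bar>p2\<bar> + \<bar>p3\<bar> + \<bar>p4\<bar> = 2 * (h0 + h1 + h2 + h3 + h4)"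
    unfolding h by presburger
  moreover have "\<bar>p0\<bar> + \<bar>p1\<bar> + \<bar>p2\<bar> + \<bar>p3\<bar> + \<bar>p4\<bar> < 4" using small by (simp only: p)
  ultimately have "2 * (h0 + h1 + h2 + h3 + h4) < 4" by simp
  then have "2 * (h0 + h1 + h2 + h3 + h4) \<le> 2" by presburger
  then have le: "\<bar>p0\<bar> + \<bar>p1\<bar> + \<bar>p2\<bar> + \<bar>p3\<bar> + \<bar>p4\<bar> \<le> 2" by (simp only: sum)
  have bound: "\<bar>k0 * p0 + k1 * p1 + k2 * p2 + k3 * p3 + k4 * p4\<bar> < 5"
    if "\<bar>k0\<bar> \<le> 2" "\<bar>k1\<bar> \<le> 2" "\<bar>k2\<bar> \<le> 2" "\<bar>k3\<bar> \<le> 2" "\<bar>k4\<bar> \<le> 2" for k0 k1 k2 k3 k4 :: int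
  proof -
    have *: "\<bar>k * x\<bar> \<le> 2 * \<bar>x\<bar>" if "\<bar>k\<bar> \<le> 2" for k x :: int
      unfolding abs_mult using that by (rule mult_right_mono) simp
    show ?thesis
      using *[OF that(1), of p0] *[OF that(2), of p1] *[OF that(3), of p2] *[OF that(4), of p3] *[OF that(5), of p4] le
      by linarith
  qed
  \<comment> \<open>Differences of consecutive rows of the same linear map, applied once more to
    \<open>p0\<close> up to \<open>p4\<close>; the sum of \<open>r\<close> cancels. With
    coefficients of size at most 2 and \<open>le\<close>, the left sides are at most 4 in absolute
    value.\<close>
  have e: "5 * (a - b) = (- 1) * p0 + 1 * p1 + (- 2) * p2 + 0 * p3 + 2 * p4"
    "5 * (b - c) = 2 * p0 + (- 1) * p1 + 1 * p2 + (- 2) * p3 + 0 * p4"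
    "5 * (c - d) = 0 * p0 + 2 * p1 + (- 1) * p2 + 1 * p3 + (- 2) * p4"
    "5 * (d - e) = (- 2) * p0 + 0 * p1 + 2 * p2 + (- 1) * p3 + 1 * p4"
    by (simp_all add: p)
  have "\<bar>5 * (a - b)\<bar> < 5" unfolding e(1) by (rule bound) simp_all
  moreover have "\<bar>5 * (b - c)\<bar> < 5" unfolding e(2) by (rule bound) simp_all
  moreover have "\<bar>5 * (c - d)\<bar> < 5" unfolding e(3) by (rule bound) simp_all
  moreover have "\<bar>5 * (d - e)\<bar> < 5" unfolding e(4) by (rule bound) simp_all
  moreover have "x = y" if "\<bar>5 * (x - y)\<bar> < 5" for x y :: int using that by presburger
  ultimately show ?thesis by blast
qed

section \<open>Weights in the presence of a pentagon\<close>

lemma directions_weight: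
  fixes m :: "5 \<times> 5 \<times> 5 \<Rightarrow>\<^sub>0 nat"
  assumes "Poly_Mapping.keys m \<subseteq> pent_directions"
  shows "mono_weight t m = int (Poly_Mapping.lookup m (1, 4, 2)) * t (1, 4, 2) + int (Poly_Mapping.lookup m (0, 2, 3)) * t (0, 2, 3)
    + int (Poly_Mapping.lookup m (1, 3, 4)) * t (1, 3, 4) + int (Poly_Mapping.lookup m (2, 4, 0)) * t (2, 4, 0)
    + int (Poly_Mapping.lookup m (0, 3, 1)) * t (0, 3, 1)"
proof -
  have "mono_weight t m = (\<Sum>v\<in>pent_directions. int (Poly_Mapping.lookup m v) * t v)"
    by (rule mono_weight_superset[OF _ assms]) (simp add: pent_directions_def)
  then show ?thesis by (simp add: pent_directions_def)
qed

lemma pent_expansion_directions: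
  assumes inv: "invariant_of_weight 12 D" "D \<in> model_polys" and m: "m \<in> Poly_Mapping.keys (pent_expansion D)"
    and sub: "Poly_Mapping.keys m \<subseteq> pent_directions" and "m \<noteq> 0" and r: "r i \<noteq> r j"
  shows "4 \<le> mono_weight (\<lambda>v. \<bar>pent_weight r v\<bar>) m"
proof -
  define k0 k1 k2 k3 k4 where k: "k0 = int (Poly_Mapping.lookup m (1, 4, 2))" "k1 = int (Poly_Mapping.lookup m (0, 2, 3))"
    "k2 = int (Poly_Mapping.lookup m (1, 3, 4))" "k3 = int (Poly_Mapping.lookup m (2, 4, 0))" "k4 = int (Poly_Mapping.lookup m (0, 3, 1))"
  have W: "mono_weight t m = k0 * t (1, 4, 2) + k1 * t (0, 2, 3) + k2 * t (1, 3, 4) + k3 * t (2, 4, 0) + k4 * t (0, 3, 1)" for t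
    unfolding k by (rule directions_weight[OF sub])
  have eq: "k0 * pent_weight (\<lambda>i. of_bool (i = j)) (1, 4, 2) + k1 * pent_weight (\<lambda>i. of_bool (i = j)) (0, 2, 3)
     + k2 * pent_weight (\<lambda>i. of_bool (i = j)) (1, 3, 4) + k3 * pent_weight (\<lambda>i. of_bool (i = j)) (2, 4, 0)
     + k4 * pent_weight (\<lambda>i. of_bool (i = j)) (0, 3, 1) = 0" for j
    unfolding W[symmetric] by (rule pent_expansion_weight[OF inv m])
  \<comment> \<open>The five indicator weights give a circulant system for the exponents, and its
    kernel consists of the constant vectors.\<close>
  have "k1 = k0" "k2 = k0" "k3 = k0" "k4 = k0"
    using eq[of 0] eq[of 1] eq[of 2] eq[of 3] eq[of 4]
    by (simp_all add: pent_weight_def coord_weight_def numeral_5_simps)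
  moreover have "k0 \<ge> 0" by (simp add: k)
  moreover have "k0 \<noteq> 0"
  proof
    assume "k0 = 0"
    with \<open>k1 = k0\<close> \<open>k2 = k0\<close> \<open>k3 = k0\<close> \<open>k4 = k0\<close> have "v \<notin> Poly_Mapping.keys m" if "v \<in> pent_directions" for v
      using that by (auto simp: k pent_directions_def in_keys_iff)
    then have "Poly_Mapping.keys m = {}" using sub by blast
    then show False using \<open>m \<noteq> 0\<close> by (auto simp: poly_mapping_eq_iff fun_eq_iff in_keys_iff)
  qed
  ultimately have "1 \<le> k0" by simp
  let ?S = "\<bar>r 1 + r 4 - r 2 - r 3\<bar> + \<bar>r 0 + r 2 - r 3 - r 4\<bar> + \<bar>r 1 + r 3 - r 4 - r 0\<bar> + \<bar>r 2 + r 4 - r 0 - r 1\<bar> + \<bar>r 0 + r 3 - r 1 - r 2\<bar>"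
  have "4 \<le> ?S"
  proof (rule ccontr)
    assume "\<not> 4 \<le> ?S"
    then have "r 0 = r 1 \<and> r 1 = r 2 \<and> r 2 = r 3 \<and> r 3 = r 4" by (intro spread_ge_4) simp
    then have "\<forall>i. r i = r 0" by (simp add: forall_5)
    then show False using r by metis
  qed
  also have "?S \<le> k0 * ?S" using \<open>1 \<le> k0\<close> by (intro mult_le_cancel_right1[THEN iffD2]) auto
  also have "k0 * ?S = mono_weight (\<lambda>v. \<bar>pent_weight r v\<bar>) m"
    unfolding W \<open>k1 = k0\<close> \<open>k2 = k0\<close> \<open>k3 = k0\<close> \<open>k4 = k0\<close>
    by (simp add: pent_weight_def coord_weight_def numeral_5_simps algebra_simps)
  finally show ?thesis .
qed

text \<open>Induction on the degree. If a monomial of weight below 4 contains a coordinate on an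
  edge, a change of variables shows that its coefficient vanishes; if it contains another coordinate
  outside the five directions, a row operation does. Only monomials in the five directions remain,
  and the constant term is zero by assumption.\<close>

lemma pent_expansion_spread:
  assumes inv: "invariant_of_weight 12 D" "D \<in> model_polys"
    and zero: "Poly_Mapping.lookup (pent_expansion D) 0 = 0" and r: "r i0 \<noteq> r j0"
    and "m \<in> Poly_Mapping.keys (pent_expansion D)"
  shows "4 \<le> mono_weight (\<lambda>v. \<bar>pent_weight r v\<bar>) m"
proof -
  let ?p = "pent_expansion D" and ?t = "pent_weight r"
  let ?W = "mono_weight (\<lambda>v. \<bar>?t v\<bar>)" and ?deg = "mono_weight (\<lambda>_. 1)"
  have split: "m = (m - Poly_Mapping.single v 1) + Poly_Mapping.single v 1" if "v \<in> Poly_Mapping.keys m"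
    for m :: "5 \<times> 5 \<times> 5 \<Rightarrow>\<^sub>0 nat" and v
  proof (rule poly_mapping_eqI)
    fix u show "Poly_Mapping.lookup m u = Poly_Mapping.lookup (m - Poly_Mapping.single v 1 + Poly_Mapping.single v 1) u"
      using that by (cases "u = v") (auto simp: lookup_add lookup_minus lookup_single when_def in_keys_iff)
  qed
  have "\<forall>m\<in>Poly_Mapping.keys ?p. ?deg m \<le> int d \<longrightarrow> 4 \<le> ?W m" for d
  proof (induction d)
    case 0
    have "m = 0" if "?deg m \<le> 0" for m :: "5 \<times> 5 \<times> 5 \<Rightarrow>\<^sub>0 nat"
    proof -
      have "?deg m = 0" using that mono_weight_nonneg[of "\<lambda>_. 1" m] by simp
      then have "v \<notin> Poly_Mapping.keys m" for v using mono_weight_eq_0D[of "\<lambda>_. 1" m v] by auto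
      then show ?thesis by (auto simp: poly_mapping_eq_iff fun_eq_iff in_keys_iff)
    qed
    then show ?case using zero by (auto simp: in_keys_iff)
  next
    case (Suc d)
    have IH: "4 \<le> ?W m" if "m \<in> Poly_Mapping.keys ?p" "?deg m \<le> int d" for m using Suc that by blast
    have edge: False if m: "m \<in> Poly_Mapping.keys ?p" "?deg m \<le> int d + 1" "?W m < 4"
      and v: "(i, j, k) \<in> Poly_Mapping.keys m" and c: "pent (i, j, c) \<noteq> 0" for m i j k c
    proof -
      define n where "n = m - Poly_Mapping.single (i, j, k) 1"
      have mn: "m = n + Poly_Mapping.single (i, j, k) 1" unfolding n_def by (rule split[OF v])
      have tc: "?t (i, j, k) = r c + r (c + 1) - r k - r (k + 1)"
        using pent_weight_pent[OF c, of r] by (simp add: pent_weight_def coord_weight_def)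
      \<comment> \<open>The transformation changes weights by exactly that of the removed coordinate
        \<open>(i, j, k)\<close>. With this number as \<open>\<tau>\<close>, the weight of
        \<open>n\<close> plus \<open>\<tau>\<close> is the weight of \<open>m\<close>.\<close>
      have "(\<Sum>u\<in>UNIV. pent_col k c pent u * ((int (Poly_Mapping.lookup n u) + 1) * Poly_Mapping.lookup ?p (n + Poly_Mapping.single u 1))) = 0"
      proof (rule derivation_step[OF pent_expansion_col[OF inv] IH, where \<tau> = "\<bar>?t (i, j, k)\<bar>"])
        fix u z assume "z \<in> Poly_Mapping.keys (pent_col k c var u)"
        from keys_pent_col_var[OF this, of r]
        show "\<exists>w. z = Poly_Mapping.single w 1 \<and> \<bar>?t u\<bar> \<le> \<bar>?t w\<bar> + \<bar>?t (i, j, k)\<bar>"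
          unfolding tc by (metis abs_triangle_ineq)
      qed (use m in \<open>auto simp: mn mono_weight_add\<close>)
      also have "(\<Sum>u\<in>UNIV. pent_col k c pent u * ((int (Poly_Mapping.lookup n u) + 1) * Poly_Mapping.lookup ?p (n + Poly_Mapping.single u 1))) =
         (\<Sum>u\<in>UNIV. if u = (i, j, k) then pent (i, j, c) * ((int (Poly_Mapping.lookup n u) + 1) * Poly_Mapping.lookup ?p m) else 0)"
        using pent_unique_edge[OF c] by (intro sum.cong) (auto simp: pent_col_def mn split: if_splits)
      finally have "pent (i, j, c) * ((int (Poly_Mapping.lookup n (i, j, k)) + 1) * Poly_Mapping.lookup ?p m) = 0" by simp
      then show False using c m(1) by (auto simp: in_keys_iff)
    qed
    have nonedge: False if m: "m \<in> Poly_Mapping.keys ?p" "?deg m \<le> int d + 1" "?W m < 4"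
      and v: "(i, j, k) \<in> Poly_Mapping.keys m" and nd: "(i, j, k) \<notin> pent_directions" for m i j k
    proof -
      have ij: "i < j" by (rule pent_expansion_support[OF inv(2) m(1) v])
      have c0: "pent (i, j, c) = 0" for c using edge[OF m v] by blast
      obtain x b where xb: "x \<noteq> b" "pent_row x b pent (i, j, k) \<noteq> 0"
        "\<And>i' j' k'. pent_row x b pent (i', j', k') \<noteq> 0 \<Longrightarrow> (i', j', k') = (i, j, k) \<or> (\<exists>c. pent (i', j', c) \<noteq> 0)"
        by (rule pent_row_reaches[OF ij c0 nd]) blast
      define n where "n = m - Poly_Mapping.single (i, j, k) 1"
      have mn: "m = n + Poly_Mapping.single (i, j, k) 1" unfolding n_def by (rule split[OF v])
      have tx: "?t (i, j, k) = r x - r b" by (rule pent_row_weight[OF xb(2)])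
      \<comment> \<open>The other components of the tangent vector lie on edges and have the same
        weight as \<open>(i, j, k)\<close>, so \<open>edge\<close> excludes the monomials that they
        produce.\<close>
      have other: "Poly_Mapping.lookup ?p (n + Poly_Mapping.single u 1) = 0" if u: "pent_row x b pent u \<noteq> 0" "u \<noteq> (i, j, k)" for u
      proof (rule ccontr)
        obtain i' j' k' where u': "u = (i', j', k')" by (cases u)
        assume "Poly_Mapping.lookup ?p (n + Poly_Mapping.single u 1) \<noteq> 0"
        then have key: "n + Poly_Mapping.single u 1 \<in> Poly_Mapping.keys ?p" by (simp add: in_keys_iff)
        obtain c where c: "pent (i', j', c) \<noteq> 0" using xb(3)[of i' j' k'] u by (auto simp: u')
        have "?W (n + Poly_Mapping.single u 1) < 4"
          using m(3) pent_row_weight[OF u(1), of r] by (simp add: mn mono_weight_add tx)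
        moreover have "?deg (n + Poly_Mapping.single u 1) \<le> int d + 1" using m(2) by (simp add: mn mono_weight_add)
        moreover have "(i', j', k') \<in> Poly_Mapping.keys (n + Poly_Mapping.single u 1)"
          by (simp add: in_keys_iff lookup_add u')
        ultimately show False using edge[OF key _ _ _ c] by blast
      qed
      have "(\<Sum>u\<in>UNIV. pent_row x b pent u * ((int (Poly_Mapping.lookup n u) + 1) * Poly_Mapping.lookup ?p (n + Poly_Mapping.single u 1))) = 0"
      proof (rule derivation_step[OF pent_expansion_row[OF inv xb(1)] IH, where \<tau> = "\<bar>?t (i, j, k)\<bar>"])
        fix u z assume "z \<in> Poly_Mapping.keys (pent_row x b var u)"
        from keys_pent_row_var[OF this, of r]
        show "\<exists>w. z = Poly_Mapping.single w 1 \<and> \<bar>?t u\<bar> \<le> \<bar>?t w\<bar> + \<bar>?t (i, j, k)\<bar>"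
          unfolding tx by (metis abs_triangle_ineq)
      qed (use m in \<open>auto simp: mn mono_weight_add\<close>)
      also have "(\<Sum>u\<in>UNIV. pent_row x b pent u * ((int (Poly_Mapping.lookup n u) + 1) * Poly_Mapping.lookup ?p (n + Poly_Mapping.single u 1))) =
         (\<Sum>u\<in>UNIV. if u = (i, j, k) then pent_row x b pent u * ((int (Poly_Mapping.lookup n u) + 1) * Poly_Mapping.lookup ?p m) else 0)"
        using other by (intro sum.cong) (auto simp: mn)
      finally have "pent_row x b pent (i, j, k) * ((int (Poly_Mapping.lookup n (i, j, k)) + 1) * Poly_Mapping.lookup ?p m) = 0" by simp
      then show False using xb(2) m(1) by (auto simp: in_keys_iff)
    qed
    show ?case
    proof (intro ballI impI, rule ccontr)
      fix m assume m: "m \<in> Poly_Mapping.keys ?p" "?deg m \<le> int (Suc d)" "\<not> 4 \<le> ?W m"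
      have "Poly_Mapping.keys m \<subseteq> pent_directions"
        using nonedge[OF m(1)] m(2,3) by force
      moreover have "m \<noteq> 0" using m(1) zero by (auto simp: in_keys_iff)
      ultimately have "4 \<le> ?W m" by (intro pent_expansion_directions[OF inv m(1) _ _ r])
      with m(3) show False by simp
    qed
  qed
  from this[of "nat (?deg m)"] show ?thesis
    using assms(5) mono_weight_nonneg[of "\<lambda>_. 1" m] by simp
qed

lemma X5_mem: "\<Phi> \<in> X\<^sub>5 R \<Longrightarrow> \<Phi> $ i $ j $ k \<in> R"
  unfolding pfaffian_models_def by blast

lemma X5_I: "\<Phi> \<in> X\<^sub>5 S \<Longrightarrow> (\<And>i j k. \<Phi> $ i $ j $ k \<in> R) \<Longrightarrow> \<Phi> \<in> X\<^sub>5 R"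
  unfolding pfaffian_models_def by blast

section \<open>Monomial matrices\<close>

definition monomial_mat :: "(5 \<Rightarrow> 5) \<Rightarrow> (5 \<Rightarrow> 'a::comm_ring_1) \<Rightarrow> 'a^5^5"
  where "monomial_mat \<sigma> \<alpha> = (\<chi> i a. if a = \<sigma> i then \<alpha> i else 0)"

lemma sum_monomial_mat: "(\<Sum>a\<in>UNIV. monomial_mat \<sigma> \<alpha> $ i $ a * f a) = \<alpha> i * f (\<sigma> i)"
  by (simp add: monomial_mat_def if_distrib[of "\<lambda>u. u * _"] cong: if_cong)

lemma act_monomial_mat:
  "act (monomial_mat \<sigma> \<alpha>) (monomial_mat \<tau> \<beta>) \<Phi> $ i $ j $ k = \<alpha> i * \<alpha> j * \<beta> k * \<Phi> $ \<sigma> i $ \<sigma> j $ \<tau> k"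
  unfolding act_nth_nested sum_monomial_mat by (simp add: mult_ac)

section \<open>The discriminant of the pentagon\<close>

lemma int_eval_zero: "int_eval (\<lambda>_. 0) p = of_int (Poly_Mapping.lookup p 0)"
proof -
  have "mono_eval (\<lambda>_. 0 :: 'a) m = (if m = 0 then 1 else 0)" for m :: "'b \<Rightarrow>\<^sub>0 nat"
  proof (cases "m = 0")
    case False
    then obtain v where "Poly_Mapping.lookup m v \<noteq> 0" by (metis poly_mapping_eqI lookup_zero)
    then have "v \<in> Poly_Mapping.keys m" by (simp add: in_keys_iff)
    then have "(\<Prod>i\<in>Poly_Mapping.keys m. (0 :: 'a) ^ Poly_Mapping.lookup m i) = 0"
      by (intro prod_zero) (auto simp: in_keys_iff zero_power intro!: bexI[of _ v])
    then show ?thesis using False by (simp add: mono_eval_def)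
  qed simp
  then show ?thesis
    unfolding int_eval_alt by (simp add: in_keys_iff if_distrib[of "\<lambda>u. _ * u"] cong: if_cong)
qed

text \<open>The powers of \<open>z\<close> that accompany the terms outside the pentagon are
  positive, so the family extends to \<open>z = 0\<close> and has the pentagon as its value
  there.\<close>

definition node_family :: "complex \<Rightarrow> 5 \<times> 5 \<times> 5 \<Rightarrow> complex"
  where "node_family z u = of_int (pent u) + (if u = (0, 2, 1) then z else if u = (1, 3, 1) then - z
     else if u = (1, 2, 4) \<or> u = (1, 4, 2) then - (z ^ 4) else 0)"

text \<open>The nodal cubic \<open>y\<^sup>2 + x y = x\<^sup>3\<close> degenerates to the pentagon along a one-parameter subgroup.\<close>

lemma node_family_equivalent:
  assumes "z \<noteq> 0"
  obtains A B where "coord_model (node_family z) = act A B (weierstrass_model 1 0 0 0 0)"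
proof -
  define \<sigma> \<tau> :: "5 \<Rightarrow> 5" where "\<sigma> i = (if i = 1 then 2 else if i = 2 then 3 else if i = 3 then 1 else i)"
    and "\<tau> i = (if i = 2 then 3 else if i = 3 then 4 else if i = 4 then 2 else i)" for i
  \<comment> \<open>The exponents give weight 0 to the five terms of the Weierstrass model that form
    the pentagon and weights 1, 1, 4, 4 to the other four; \<open>\<epsilon>\<close> corrects the
    signs.\<close>
  define r s :: "5 \<Rightarrow> int" where "r i = (if i = 0 then 1 else if i = 1 then 0 else if i = 2 then - 10 else if i = 3 then - 9 else - 15)"
    and "s i = (if i = 0 then - 1 else if i = 1 then 10 else if i = 2 then 19 else if i = 3 then 24 else 14)" for i
  define \<epsilon> :: "5 \<Rightarrow> complex" where "\<epsilon> i = (if i = 2 \<or> i = 4 then - 1 else 1)" for i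
  let ?A = "monomial_mat \<sigma> (\<lambda>i. z powi r i)" and ?B = "monomial_mat \<tau> (\<lambda>k. \<epsilon> k * z powi s k)"
  let ?W = "weierstrass_model 1 0 0 0 0 :: complex model"
  have "?W \<in> X\<^sub>5 UNIV" unfolding weierstrass_model_def pfaffian_models_def Let_def by simp
  then have "act ?A ?B ?W \<in> X\<^sub>5 UNIV" by (rule act_in_X5)
  from coord_model_coords[OF this] have "act ?A ?B ?W = coord_model (\<lambda>(i, j, k). act ?A ?B ?W $ i $ j $ k)" ..
  also have "\<dots> = coord_model (node_family z)"
  proof -
    have entry: "act ?A ?B ?W $ i $ j $ k = \<epsilon> k * z powi (r i + r j + s k) * ?W $ \<sigma> i $ \<sigma> j $ \<tau> k" for i j k
      using assms by (simp add: act_monomial_mat power_int_add mult_ac)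
    have "\<forall>i j k. i < j \<longrightarrow> act ?A ?B ?W $ i $ j $ k = node_family z (i, j, k)"
      unfolding entry forall_5
      by (simp add: \<epsilon>_def r_def s_def \<sigma>_def \<tau>_def weierstrass_model_def axis_def node_family_def pent_def numeral_5_simps Let_def)
    then show ?thesis by (simp add: vec_eq_iff)
  qed
  finally show thesis using that[of ?A ?B] by simp
qed

text \<open>The nodal cubic has discriminant zero, hence so has every member of the family with
  \<open>z \<noteq> 0\<close>. A polynomial is continuous, so the value at \<open>z = 0\<close> is
  zero as well.\<close>

lemma discriminant_pent:
  assumes "is_discriminant D"
  shows "Poly_Mapping.lookup (pent_expansion D) 0 = 0"
proof -
  have D: "invariant_of_weight 12 D" "D \<in> model_polys"
    "eval_model D (weierstrass_model 1 0 0 0 0 :: complex model) = weierstrass_discriminant 1 0 0 0 0"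
    using assms unfolding is_discriminant_def by blast+
  define f where "f z = int_eval (node_family z) D" for z
  have W: "(weierstrass_model 1 0 0 0 0 :: complex model) \<in> X\<^sub>5 UNIV"
    unfolding weierstrass_model_def pfaffian_models_def Let_def by simp
  have f0: "f z = 0" if z: "z \<noteq> 0" for z
  proof -
    obtain A B where "coord_model (node_family z) = act A B (weierstrass_model 1 0 0 0 0)"
      by (rule node_family_equivalent[OF z])
    then have "f z = act_det A B ^ 12 * weierstrass_discriminant 1 0 0 0 0"
      using invariance_any_ring[OF D(1) W, of A B] by (simp add: f_def eval_model_coord[OF D(2), symmetric] D(3))
    also have "weierstrass_discriminant 1 0 0 0 0 = (0 :: complex)" by (simp add: weierstrass_discriminant_def Let_def)
    finally show ?thesis by simp
  qed
  have "isCont (\<lambda>z. node_family z u) 0" for u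
    by (cases "u = (0, 2, 1)"; cases "u = (1, 3, 1)"; cases "u = (1, 2, 4) \<or> u = (1, 4, 2)")
      (auto simp: node_family_def intro!: continuous_intros)
  then have "isCont f 0"
    unfolding f_def int_eval_alt mono_eval_def by (intro continuous_intros)
  then have "f \<midarrow>0\<rightarrow> f 0" by (simp add: isCont_def)
  moreover have "f \<midarrow>0\<rightarrow> 0"
    by (rule tendsto_eventually) (use f0 in \<open>auto simp: eventually_at_filter\<close>)
  ultimately have "f 0 = 0" by (rule tendsto_unique[OF at_neq_bot])
  moreover have "node_family 0 = (\<lambda>u. of_int (pent u))" by (simp add: node_family_def fun_eq_iff)
  ultimately have "of_int (Poly_Mapping.lookup (pent_expansion D) 0) = (0 :: complex)"
    unfolding int_eval_zero[symmetric] int_eval_pent_expansion by (simp add: f_def)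
  then show ?thesis by simp
qed

section \<open>Valuations\<close>

locale discrete_valuation =
  fixes v :: "'k::field \<Rightarrow> int extended"
  assumes normalised: "normalised_discrete_valuation v"
begin

abbreviation \<O> :: "'k set" where "\<O> \<equiv> valuation_ring v"

definition at_least :: "int \<Rightarrow> 'k \<Rightarrow> bool" where "at_least n x \<longleftrightarrow> Fin n \<le> v x"

lemma v_0 [simp]: "v 0 = Pinf" and v_eq_Pinf_iff: "v x = Pinf \<longleftrightarrow> x = 0"
  and v_mult: "v (x * y) = v x + v y" and v_add: "min (v x) (v y) \<le> v (x + y)" and v_not_Minf: "v x \<noteq> Minf"
  using normalised unfolding normalised_discrete_valuation_def by blast+

lemma v_FinE: assumes "x \<noteq> 0" obtains n where "v x = Fin n"
  using assms v_eq_Pinf_iff[of x] v_not_Minf[of x] by (cases "v x") auto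

lemma at_least_0 [simp]: "at_least n 0"
  by (simp add: at_least_def)

lemma at_least_add: "at_least n x \<Longrightarrow> at_least n y \<Longrightarrow> at_least n (x + y)"
  using v_add[of x y] unfolding at_least_def by (meson min.bounded_iff order_trans)

lemma at_least_mult: "at_least a x \<Longrightarrow> at_least b y \<Longrightarrow> at_least (a + b) (x * y)"
  unfolding at_least_def v_mult using v_not_Minf[of x] v_not_Minf[of y]
  by (cases "v x"; cases "v y") auto

lemma at_least_mono: "at_least a x \<Longrightarrow> b \<le> a \<Longrightarrow> at_least b x"
  unfolding at_least_def by (meson less_eq_extended.simps(1) order_trans)

lemma v_1 [simp]: "v 1 = Fin 0"
proof -
  obtain n where "v 1 = Fin n" using v_FinE[of 1] by auto
  then show ?thesis using v_mult[of 1 1] by simp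
qed

lemma v_minus_1: "v (- 1) = Fin 0"
proof -
  obtain n where n: "v (- 1) = Fin n" using v_FinE[of "- 1"] by auto
  then show ?thesis using v_mult[of "- 1" "- 1"] by simp
qed

lemma at_least_minus: "at_least n x \<Longrightarrow> at_least n (- x)"
  using at_least_mult[of 0 "- 1" n x] v_minus_1 by (simp add: at_least_def)

lemma at_least_diff: "at_least n x \<Longrightarrow> at_least n y \<Longrightarrow> at_least n (x - y)"
  using at_least_add[of n x "- y"] at_least_minus[of n y] by simp

lemma mem_ring_iff: "x \<in> \<O> \<longleftrightarrow> at_least 0 x"
  by (simp add: valuation_ring_def at_least_def)

lemma at_least_1 [simp]: "at_least 0 1"
  by (simp add: at_least_def)

lemma at_least_of_int: "at_least 0 (of_int c)"
proof -
  have nat: "at_least 0 (of_nat n)" for n by (induction n) (auto intro: at_least_add)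
  show ?thesis
  proof (cases c)
    case (nonneg n) then show ?thesis using nat by simp
  next
    case (neg n)
    have "at_least 0 (- of_nat (Suc n))" by (rule at_least_minus[OF nat])
    then show ?thesis unfolding neg by simp
  qed
qed

lemma at_least_sum: "(\<And>i. i \<in> S \<Longrightarrow> at_least n (f i)) \<Longrightarrow> at_least n (\<Sum>i\<in>S. f i)"
  by (induction S rule: infinite_finite_induct) (auto intro: at_least_add)

lemma at_least_prod: "(\<And>i. i \<in> S \<Longrightarrow> at_least (w i) (f i)) \<Longrightarrow> at_least (\<Sum>i\<in>S. w i) (\<Prod>i\<in>S. f i)"
  by (induction S rule: infinite_finite_induct) (auto intro: at_least_mult)

lemma at_least_power: "at_least a x \<Longrightarrow> at_least (int n * a) (x ^ n)"
  by (induction n) (auto simp: distrib_right intro: at_least_mult)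

lemma at_least_mono_eval: "(\<And>u. at_least (w u) (x u)) \<Longrightarrow> at_least (mono_weight w m) (mono_eval x m)"
  unfolding mono_weight_def mono_eval_def by (intro at_least_prod at_least_power) auto

lemma at_least_int_eval:
  assumes "\<And>u. at_least (w u) (x u)" "\<And>m. m \<in> Poly_Mapping.keys p \<Longrightarrow> N \<le> mono_weight w m"
  shows "at_least N (int_eval x p)"
  unfolding int_eval_alt
proof (rule at_least_sum)
  fix m assume "m \<in> Poly_Mapping.keys p"
  then have "at_least N (mono_eval x m)" using at_least_mono[OF at_least_mono_eval[OF assms(1)] assms(2)] by blast
  then show "at_least N (of_int (Poly_Mapping.lookup p m) * mono_eval x m)"
    using at_least_mult[OF at_least_of_int] by fastforce
qed

lemma ring_closed [simp]: "0 \<in> \<O>" "1 \<in> \<O>"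
  by (simp_all add: mem_ring_iff)

lemma ring_closed_op: "x \<in> \<O> \<Longrightarrow> y \<in> \<O> \<Longrightarrow> x + y \<in> \<O>" "x \<in> \<O> \<Longrightarrow> y \<in> \<O> \<Longrightarrow> x * y \<in> \<O>" "x \<in> \<O> \<Longrightarrow> - x \<in> \<O>"
  using at_least_add[of 0 x y] at_least_mult[of 0 x 0 y] at_least_minus[of 0 x] by (auto simp: mem_ring_iff)

lemma ring_sum: "(\<And>i. i \<in> S \<Longrightarrow> f i \<in> \<O>) \<Longrightarrow> (\<Sum>i\<in>S. f i) \<in> \<O>"
  unfolding mem_ring_iff by (rule at_least_sum)

lemma ring_prod: "(\<And>i. i \<in> S \<Longrightarrow> f i \<in> \<O>) \<Longrightarrow> (\<Prod>i\<in>S. f i) \<in> \<O>"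
  unfolding mem_ring_iff using at_least_prod[of S "\<lambda>_. 0" f] by simp

section \<open>Integral matrices and their action\<close>

lemma det_in_ring: "(\<And>i j. A $ i $ j \<in> \<O>) \<Longrightarrow> det (A :: 'k^5^5) \<in> \<O>"
  unfolding det_def by (intro ring_sum ring_closed_op ring_prod) (auto simp: mem_ring_iff at_least_of_int)

lemma v_unit: "x \<in> \<O> \<Longrightarrow> y \<in> \<O> \<Longrightarrow> x * y = 1 \<Longrightarrow> v x = Fin 0"
  using v_mult[of x y] by (cases "v x"; cases "v y") (auto simp: valuation_ring_def)

lemma v_det_GL5: "A \<in> GL5 \<O> \<Longrightarrow> v (det A) = Fin 0"
proof -
  assume "A \<in> GL5 \<O>"
  then obtain A' where A: "\<And>i j. A $ i $ j \<in> \<O>" "\<And>i j. A' $ i $ j \<in> \<O>" "A ** A' = mat 1"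
    by (auto simp: GL5_def)
  then have "det A * det A' = 1" by (metis det_I det_mul)
  then show ?thesis using det_in_ring[of A] det_in_ring[of A'] A by (intro v_unit[of _ "det A'"]) auto
qed

lemma act_integral:
  assumes "\<And>i j. A $ i $ j \<in> \<O>" "\<And>i j. B $ i $ j \<in> \<O>" "\<Phi> \<in> X\<^sub>5 \<O>"
  shows "act A B \<Phi> \<in> X\<^sub>5 \<O>"
proof -
  have "\<Phi> $ i $ j $ k \<in> \<O>" for i j k using assms(3) by (rule X5_mem)
  then have "act A B \<Phi> $ i $ j $ k \<in> \<O>" for i j k
    unfolding act_nth by (intro ring_sum ring_closed_op assms)
  then show ?thesis by (rule X5_I[OF act_in_X5[OF assms(3)]])
qed

lemma v_power: "v x = Fin a \<Longrightarrow> v (x ^ n) = Fin (int n * a)"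
  by (induction n) (auto simp: v_mult distrib_right)

lemma monomial_mat_GL5:
  assumes "bij \<sigma>"
  shows "monomial_mat \<sigma> (\<lambda>_. 1) \<in> GL5 \<O>"
proof -
  let ?q = "inv_into UNIV \<sigma>"
  have q: "\<sigma> (?q i) = i" "?q (\<sigma> i) = i" for i
    using assms by (auto simp: bij_def surj_f_inv_f)
  have "monomial_mat \<sigma> (\<lambda>_. 1 :: 'k) ** monomial_mat ?q (\<lambda>_. 1) = mat 1"
    "monomial_mat ?q (\<lambda>_. 1 :: 'k) ** monomial_mat \<sigma> (\<lambda>_. 1) = mat 1"
    unfolding vec_eq_iff matrix_matrix_mult_def
    by (simp_all add: sum_monomial_mat) (simp_all add: monomial_mat_def mat_def q eq_commute)
  moreover have "monomial_mat \<rho> (\<lambda>_. 1) $ i $ j \<in> \<O>" for \<rho> i j by (simp add: monomial_mat_def)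
  ultimately show ?thesis unfolding GL5_def by blast
qed

theorem unstable_discriminant:
  assumes D: "is_discriminant D" and \<Phi>: "\<Phi> \<in> X\<^sub>5 \<O>"
    and total: "2 * sum r UNIV + sum s UNIV = 0"
    and val: "\<And>i j k. at_least (- (r i + r j + s k)) (\<Phi> $ i $ j $ k)"
    and small: "v (eval_model D \<Phi>) \<le> Fin 1"
  shows "(\<forall>i. r i = r 0) \<and> (\<forall>i. s i = s 0)"
proof -
  have inv: "invariant_of_weight 12 D" "D \<in> model_polys" using D by (auto simp: is_discriminant_def)
  have int: "at_least 0 (\<Phi> $ i $ j $ k)" for i j k using X5_mem[OF \<Phi>] by (simp add: mem_ring_iff)
  have not2: "\<not> at_least 2 (eval_model D \<Phi>)"
    using small unfolding at_least_def by (cases "v (eval_model D \<Phi>)") auto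
  have neg: "at_least (neg_part (coord_weight r s (i, j, k))) (\<Phi> $ i $ j $ k)" for i j k
    using val[of i j k] int[of i j k] by (auto simp: coord_weight_def max_def)
  have "has_pentagon r s"
  proof (rule ccontr)
    assume no: "\<not> has_pentagon r s"
    have "at_least 2 (eval_model D \<Phi>)"
      unfolding eval_model_alt
      by (rule at_least_int_eval[OF _ discriminant_weight_no_pentagon[OF D total no]]) (use neg in auto)
    then show False using not2 by simp
  qed
  then obtain \<sigma> \<tau> :: "5 \<Rightarrow> 5" where \<sigma>: "bij \<sigma>" "bij \<tau>" "\<And>i. r (\<sigma> i) + r (\<sigma> (i + 1)) + s (\<tau> i) = 0"
    by (auto simp: has_pentagon_def)
  define r2 where "r2 i = r (\<sigma> i)" for i
  let ?P = "monomial_mat \<sigma> (\<lambda>_. 1)" and ?Q = "monomial_mat \<tau> (\<lambda>_. 1)"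
  define \<Psi> where "\<Psi> = act ?P ?Q \<Phi>"
  have \<Psi>: "\<Psi> $ i $ j $ k = \<Phi> $ \<sigma> i $ \<sigma> j $ \<tau> k" for i j k by (simp add: \<Psi>_def act_monomial_mat)
  have t: "pent_weight r2 (i, j, k) = coord_weight r s (\<sigma> i, \<sigma> j, \<tau> k)" for i j k
    using \<sigma>(3)[of k] by (simp add: pent_weight_def coord_weight_def r2_def)
  have r2: "r2 i = r2 j" for i j
  proof (rule ccontr)
    assume ne: "r2 i \<noteq> r2 j"
    \<comment> \<open>Recentring at the pentagon does not spoil the lower bounds, because the
      nonzero entries of \<open>pent\<close> are integers in positions of weight 0.\<close>
    let ?x = "\<lambda>(i, j, k). \<Psi> $ i $ j $ k - of_int (pent (i, j, k))"
    have x: "at_least (neg_part (pent_weight r2 u)) (?x u)" for u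
    proof -
      obtain i j k where u: "u = (i, j, k)" by (cases u)
      have "at_least (neg_part (pent_weight r2 u)) (\<Psi> $ i $ j $ k)" unfolding u t \<Psi> by (rule neg)
      moreover have "at_least (neg_part (pent_weight r2 u)) (of_int (pent u))"
        using pent_weight_pent[of u r2] at_least_of_int by (cases "pent u = 0") auto
      ultimately show ?thesis unfolding u by (auto intro: at_least_diff)
    qed
    have w: "2 \<le> mono_weight (\<lambda>u. neg_part (pent_weight r2 u)) m" if "m \<in> Poly_Mapping.keys (pent_expansion D)" for m
    proof -
      have "4 \<le> mono_weight (\<lambda>u. \<bar>pent_weight r2 u\<bar>) m"
        by (rule pent_expansion_spread[OF inv discriminant_pent[OF D] ne that])
      \<comment> \<open>The absolute value of \<open>t\<close> is \<open>t + 2 * neg_part t\<close>,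
        and the signed weights of a monomial cancel, so the bound 4 turns into 2.\<close>
      also have "mono_weight (\<lambda>u. \<bar>pent_weight r2 u\<bar>) m = mono_weight (pent_weight r2) m + 2 * mono_weight (\<lambda>u. neg_part (pent_weight r2 u)) m"
        unfolding mono_weight_def sum_distrib_left sum.distrib[symmetric]
        by (intro sum.cong refl) (auto simp: max_def algebra_simps abs_if)
      finally show ?thesis using pent_expansion_weight[OF inv that, of r2] by simp
    qed
    have "eval_model D \<Psi> = int_eval ?x (pent_expansion D)"
      unfolding int_eval_pent_expansion eval_model_alt by (simp add: case_prod_unfold)
    then have "at_least 2 (eval_model D \<Psi>)"
      using at_least_int_eval[of "\<lambda>u. neg_part (pent_weight r2 u)" ?x "pent_expansion D" 2, OF x w] by simp
    moreover have "eval_model D \<Psi> = act_det ?P ?Q ^ 12 * eval_model D \<Phi>"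
      unfolding \<Psi>_def by (rule invariance_any_ring[OF inv(1) \<Phi>])
    moreover have "v (act_det ?P ?Q ^ 12) = Fin 0"
    proof -
      have "v (act_det ?P ?Q) = Fin 0"
        using v_det_GL5[OF monomial_mat_GL5[OF \<sigma>(1)]] v_det_GL5[OF monomial_mat_GL5[OF \<sigma>(2)]]
        by (simp add: act_det_def v_mult power2_eq_square)
      from v_power[OF this, of 12] show ?thesis by simp
    qed
    ultimately have "at_least 2 (eval_model D \<Phi>)"
      by (cases "v (eval_model D \<Phi>)") (auto simp: at_least_def v_mult)
    then show False using not2 by simp
  qed
  have r: "r i = r 0" for i
    using r2[of "inv_into UNIV \<sigma> i" "inv_into UNIV \<sigma> 0"] \<sigma>(1) by (simp add: r2_def bij_is_surj surj_f_inv_f)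
  have "s k = - 2 * r 0" for k
    using \<sigma>(3)[of "inv_into UNIV \<tau> k"] \<sigma>(2) r[of "\<sigma> (inv_into UNIV \<tau> k)"] r[of "\<sigma> (inv_into UNIV \<tau> k + 1)"]
    by (simp add: bij_is_surj surj_f_inv_f)
  then show ?thesis using r by metis
qed

end

section \<open>Smith normal form over a discrete valuation ring\<close>

lemma mat_mult_left: "(mat c ** A) $ i $ j = c * A $ i $ j"
  by (simp add: matrix_matrix_mult_def mat_def if_distrib[of "\<lambda>u. u * _"] cong: if_cong)

lemma mat_mult_right: "(A ** mat c) $ i $ j = A $ i $ j * (c :: 'a::comm_ring_1)"
  by (simp add: matrix_matrix_mult_def mat_def if_distrib[of "\<lambda>u. _ * u"] cong: if_cong)

lemma mat_commute: "A ** mat c = mat c ** (A :: 'a::comm_ring_1^5^5)"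
  by (simp add: vec_eq_iff mat_mult_left mat_mult_right mult.commute)

definition shear :: "5 \<Rightarrow> (5 \<Rightarrow> 'a::comm_ring_1) \<Rightarrow> 'a^5^5"
  where "shear i \<rho> = (\<chi> a b. (if a = b then 1 else 0) + (if b = i \<and> a \<noteq> i then \<rho> a else 0))"

lemma sum_shear: "(\<Sum>c\<in>UNIV. shear i \<rho> $ a $ c * f c) = f a + (if a \<noteq> i then \<rho> a * f i else 0)"
proof -
  have "(\<Sum>c\<in>UNIV. shear i \<rho> $ a $ c * f c) =
    (\<Sum>c\<in>UNIV. if a = c then f c else 0) + (\<Sum>c\<in>UNIV. if c = i then if a \<noteq> i then \<rho> a * f c else 0 else 0)"
    unfolding sum.distrib[symmetric] by (intro sum.cong) (auto simp: shear_def distrib_right)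
  then show ?thesis by simp
qed

lemma shear_mult: "(shear i \<rho> ** A) $ a $ b = A $ a $ b + (if a \<noteq> i then \<rho> a * A $ i $ b else 0)"
  unfolding matrix_matrix_mult_def by (simp add: sum_shear)

lemma mult_transpose_shear:
  "(A ** transpose (shear i \<rho>)) $ a $ b = A $ a $ b + (if b \<noteq> i then A $ a $ i * \<rho> b else (0 :: 'a::comm_ring_1))"
proof -
  have "A ** transpose (shear i \<rho>) = transpose (shear i \<rho> ** transpose A)"
    by (simp add: matrix_transpose_mul)
  then show ?thesis by (simp add: transpose_def shear_mult mult.commute)
qed

lemma shear_inverse: "shear i \<rho> ** shear i (\<lambda>a. - \<rho> a) = mat 1"
  unfolding vec_eq_iff shear_mult by (auto simp: shear_def mat_def)

lemma GL5_I:
  assumes "\<And>i j. A $ i $ j \<in> R" "\<And>i j. A' $ i $ j \<in> R" "A ** A' = mat 1" "A' ** A = mat 1"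
  shows "A \<in> GL5 R"
  using assms unfolding GL5_def by blast

lemma GL5_E:
  assumes "A \<in> GL5 R"
  obtains A' where "A' \<in> GL5 R" "A ** A' = mat 1" "A' ** A = mat 1"
  using assms unfolding GL5_def by blast

lemma GL5_entry: "A \<in> GL5 R \<Longrightarrow> A $ i $ j \<in> R"
  unfolding GL5_def by blast

context discrete_valuation begin

lemma matrix_mult_entry:
  assumes "\<And>i j. A $ i $ j \<in> \<O>" "\<And>i j. B $ i $ j \<in> \<O>"
  shows "((A :: 'k^5^5) ** B) $ i $ j \<in> \<O>"
  unfolding matrix_matrix_mult_def using assms by (simp add: ring_sum ring_closed_op)

lemma GL5_mult:
  assumes "A \<in> GL5 \<O>" "B \<in> GL5 \<O>"
  shows "A ** B \<in> GL5 \<O>"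
proof -
  obtain A' B' where A: "A' \<in> GL5 \<O>" "A ** A' = mat 1" "A' ** A = mat 1"
    and B: "B' \<in> GL5 \<O>" "B ** B' = mat 1" "B' ** B = mat 1"
    using assms by (metis GL5_E)
  show ?thesis
  proof (rule GL5_I[of _ _ "B' ** A'"])
    have "(A ** B) ** (B' ** A') = A ** (B ** B') ** A'" by (simp add: matrix_mul_assoc)
    then show "(A ** B) ** (B' ** A') = mat 1" by (simp add: A B)
    have "(B' ** A') ** (A ** B) = B' ** (A' ** A) ** B" by (simp add: matrix_mul_assoc)
    then show "(B' ** A') ** (A ** B) = mat 1" by (simp add: A B)
  qed (use assms A B in \<open>auto intro!: matrix_mult_entry intro: GL5_entry\<close>)
qed

lemma GL5_transpose:
  assumes "A \<in> GL5 \<O>" shows "transpose A \<in> GL5 \<O>"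
proof -
  obtain A' where A: "A' \<in> GL5 \<O>" "A ** A' = mat 1" "A' ** A = mat 1" using assms by (metis GL5_E)
  show ?thesis
  proof (rule GL5_I[of _ _ "transpose A'"])
    show "transpose A ** transpose A' = mat 1" "transpose A' ** transpose A = mat 1"
      using A by (simp_all flip: matrix_transpose_mul)
  qed (use assms A in \<open>auto simp: transpose_def intro: GL5_entry\<close>)
qed

lemma GL5_one: "mat 1 \<in> GL5 \<O>"
proof (rule GL5_I[of _ _ "mat 1"])
  show "(mat 1 :: 'k^5^5) $ i $ j \<in> \<O>" for i j by (simp add: mat_def)
  then show "(mat 1 :: 'k^5^5) $ i $ j \<in> \<O>" for i j .
qed simp_all

lemma shear_GL5:
  assumes "\<And>a. \<rho> a \<in> \<O>" shows "shear i \<rho> \<in> GL5 \<O>"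
proof (rule GL5_I[of _ _ "shear i (\<lambda>a. - \<rho> a)"])
  show "shear i (\<lambda>a. - \<rho> a) ** shear i \<rho> = mat 1"
    using shear_inverse[of i "\<lambda>a. - \<rho> a"] by simp
  show "shear i \<rho> ** shear i (\<lambda>a. - \<rho> a) = mat 1" by (rule shear_inverse)
qed (use assms in \<open>auto simp: shear_def intro!: ring_closed_op\<close>)

lemma v_inverse: "v x = Fin n \<Longrightarrow> v (inverse x) = Fin (- n)"
proof -
  assume n: "v x = Fin n"
  then have "x \<noteq> 0" by auto
  then obtain m where m: "v (inverse x) = Fin m" using v_FinE[of "inverse x"] by auto
  have "v (x * inverse x) = Fin 0" using \<open>x \<noteq> 0\<close> by simp
  then show ?thesis unfolding v_mult n m by simp
qed

lemma v_powi: "v x = Fin a \<Longrightarrow> v (x powi n) = Fin (n * a)"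
proof -
  assume a: "v x = Fin a"
  show ?thesis
  proof (cases "n \<ge> 0")
    case True then show ?thesis using v_power[OF a, of "nat n"] by (simp add: power_int_def)
  next
    case False
    then show ?thesis using v_power[OF v_inverse[OF a], of "nat (- n)"] by (simp add: power_int_def)
  qed
qed

lemma unit_mem: "v x = Fin 0 \<Longrightarrow> x \<in> \<O> \<and> inverse x \<in> \<O>"
  using v_inverse[of x 0] by (simp add: valuation_ring_def)

lemma diag_GL5:
  assumes "\<And>i. v (u i) = Fin 0" shows "diag_mat u \<in> GL5 \<O>"
proof (rule GL5_I[of _ _ "diag_mat (\<lambda>i. inverse (u i))"])
  have "u i \<noteq> 0" for i using assms[of i] by auto
  then show "diag_mat u ** diag_mat (\<lambda>i. inverse (u i)) = mat 1" "diag_mat (\<lambda>i. inverse (u i)) ** diag_mat u = mat 1"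
    by (simp_all add: vec_eq_iff matrix_matrix_mult_def diag_mat_def mat_def if_distrib[of "\<lambda>u. u * _"] cong: if_cong)
qed (use unit_mem[OF assms] in \<open>auto simp: diag_mat_def\<close>)

lemma divide_mem:
  assumes "y \<noteq> 0 \<Longrightarrow> v x \<le> v y" "x \<noteq> 0"
  shows "y / x \<in> \<O>"
proof (cases "y = 0")
  case False
  obtain a b where ab: "v x = Fin a" "v y = Fin b" using assms(2) False by (metis v_FinE)
  have "v (y / x) = Fin (b - a)" unfolding divide_inverse v_mult v_inverse[OF ab(1)] ab(2) by simp
  then show ?thesis using assms(1)[OF False] ab by (simp add: valuation_ring_def)
qed simp

text \<open>An entry of minimal valuation outside \<open>S\<close> is moved to the diagonal by
  exchanging two columns, and its row and column are cleared. The multipliers are integral by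
  minimality. The rows and columns in \<open>S\<close> vanish off the diagonal and stay so.\<close>

lemma smith_step:
  fixes A :: "'k^5^5"
  assumes det: "det A \<noteq> 0" and S: "\<And>a b. a \<in> S \<Longrightarrow> b \<noteq> a \<Longrightarrow> A $ a $ b = 0 \<and> A $ b $ a = 0"
    and "S \<noteq> UNIV"
  obtains i P Q A' where "i \<notin> S" "P \<in> GL5 \<O>" "Q \<in> GL5 \<O>" "A = P ** A' ** Q"
    "\<And>a b. a \<in> insert i S \<Longrightarrow> b \<noteq> a \<Longrightarrow> A' $ a $ b = 0 \<and> A' $ b $ a = 0"
proof -
  define M where "M = {(a, b). a \<notin> S \<and> b \<notin> S \<and> A $ a $ b \<noteq> 0}"
  obtain a0 where a0: "a0 \<notin> S" using assms(3) by blast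
  have "\<exists>b. A $ a0 $ b \<noteq> 0"
  proof (rule ccontr)
    assume "\<nexists>b. A $ a0 $ b \<noteq> 0"
    then have "(\<Prod>i\<in>UNIV. A $ i $ p i) = 0" for p by (intro prod_zero) auto
    then have "det A = 0" unfolding det_def by (simp only: mult_zero_right sum.neutral_const)
    then show False using det by simp
  qed
  then obtain b0 where b0: "A $ a0 $ b0 \<noteq> 0" by blast
  have "b0 \<notin> S" using S[of b0 a0] a0 b0 by auto
  then have "M \<noteq> {}" using a0 b0 by (auto simp: M_def)
  have "finite M" by simp
  let ?f = "\<lambda>(a, b). v (A $ a $ b)"
  have "Min (?f ` M) \<in> ?f ` M" using \<open>M \<noteq> {}\<close> \<open>finite M\<close> by (intro Min_in) auto
  then obtain i j where ij: "(i, j) \<in> M" "v (A $ i $ j) = Min (?f ` M)" by auto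
  have min: "v (A $ i $ j) \<le> v (A $ a $ b)" if "(a, b) \<in> M" for a b
    unfolding ij(2) using that \<open>finite M\<close> by (intro Min_le) auto
  have iS: "i \<notin> S" "j \<notin> S" and piv: "A $ i $ j \<noteq> 0" using ij by (auto simp: M_def)
  define \<tau> where "\<tau> b = (if b = i then j else if b = j then i else b)" for b
  have \<tau>\<tau>: "\<tau> (\<tau> b) = b" for b by (auto simp: \<tau>_def)
  then have "bij \<tau>" by (rule involuntory_imp_bij)
  define T where "T = monomial_mat \<tau> (\<lambda>_. 1 :: 'k)"
  have T: "T \<in> GL5 \<O>" unfolding T_def by (rule monomial_mat_GL5[OF \<open>bij \<tau>\<close>])
  have Tnth: "T $ c $ b = (if c = \<tau> b then 1 else 0)" for c b
  proof -
    have "b = \<tau> c \<longleftrightarrow> c = \<tau> b" using \<tau>\<tau>[of b] \<tau>\<tau>[of c] by metis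
    then show ?thesis by (simp add: T_def monomial_mat_def)
  qed
  have multT: "(B ** T) $ a $ b = B $ a $ \<tau> b" for B a b
    unfolding matrix_matrix_mult_def by (simp add: Tnth if_distrib[of "\<lambda>u. _ * u"] cong: if_cong)
  have TT: "T ** T = mat 1" unfolding vec_eq_iff multT by (simp add: Tnth \<tau>\<tau> mat_def)
  define A1 where "A1 = A ** T"
  have A1: "A1 $ a $ b = A $ a $ \<tau> b" for a b unfolding A1_def by (rule multT)
  have A1ii: "A1 $ i $ i = A $ i $ j" by (simp add: A1 \<tau>_def)
  have AA1: "A = A1 ** T" unfolding A1_def by (simp add: matrix_mul_assoc[symmetric] TT)
  define \<rho> where "\<rho> a = A1 $ a $ i / A1 $ i $ i" for a
  define \<kappa> where "\<kappa> b = A1 $ i $ b / A1 $ i $ i" for b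
  have \<tau>S: "\<tau> a = a" if "a \<in> S" for a using that iS by (auto simp: \<tau>_def)
  have \<tau>S': "\<tau> b \<noteq> a" if "a \<in> S" "b \<noteq> a" for a b using that iS by (auto simp: \<tau>_def)
  have zero: "A1 $ a $ b = 0" "A1 $ b $ a = 0" if "a \<in> S" "b \<noteq> a" for a b
    using S[OF that(1) \<tau>S'[OF that]] S[OF that] by (auto simp: A1 \<tau>S[OF that(1)])
  have \<rho>O: "\<rho> a \<in> \<O>" for a
    unfolding \<rho>_def A1ii
  proof (rule divide_mem[OF _ piv])
    assume nz: "A1 $ a $ i \<noteq> 0"
    then have "a \<notin> S" using zero(1)[of a i] iS by auto
    then have "(a, j) \<in> M" using nz iS by (simp add: M_def A1 \<tau>_def)
    then show "v (A $ i $ j) \<le> v (A1 $ a $ i)" using min[of a j] by (simp add: A1 \<tau>_def)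
  qed
  have \<kappa>O: "\<kappa> b \<in> \<O>" for b
    unfolding \<kappa>_def A1ii
  proof (rule divide_mem[OF _ piv])
    assume nz: "A1 $ i $ b \<noteq> 0"
    then have "\<tau> b \<notin> S" using S[of "\<tau> b" i] iS by (auto simp: A1)
    then have "(i, \<tau> b) \<in> M" using nz iS by (simp add: M_def A1)
    then show "v (A $ i $ j) \<le> v (A1 $ i $ b)" using min[of i "\<tau> b"] by (simp add: A1)
  qed
  define A2 where "A2 = shear i (\<lambda>a. - \<rho> a) ** A1"
  have A2: "A2 $ a $ b = A1 $ a $ b - (if a \<noteq> i then \<rho> a * A1 $ i $ b else 0)" for a b
    unfolding A2_def shear_mult by simp
  define A3 where "A3 = A2 ** transpose (shear i (\<lambda>a. - \<kappa> a))"
  have A3: "A3 $ a $ b = A2 $ a $ b - (if b \<noteq> i then A2 $ a $ i * \<kappa> b else 0)" for a b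
    unfolding A3_def mult_transpose_shear by simp
  have e1: "shear i \<rho> ** A2 = A1" unfolding A2_def matrix_mul_assoc shear_inverse by simp
  have e2: "A3 ** transpose (shear i \<kappa>) = A2"
    unfolding A3_def matrix_mul_assoc[symmetric] matrix_transpose_mul[symmetric] shear_inverse by simp
  have "A = (shear i \<rho> ** (A3 ** transpose (shear i \<kappa>))) ** T"
    unfolding e2 e1 by (rule AA1)
  then have eq: "A = shear i \<rho> ** A3 ** (transpose (shear i \<kappa>) ** T)"
    by (simp only: matrix_mul_assoc)
  have A1nz: "A1 $ i $ i \<noteq> 0" using piv A1ii by simp
  show thesis
  proof (rule that[OF iS(1) shear_GL5[OF \<rho>O] GL5_mult[OF GL5_transpose[OF shear_GL5[OF \<kappa>O]] T] eq])
    fix a b assume ab: "a \<in> insert i S" "b \<noteq> a"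
    have col: "A2 $ c $ i = 0" if "c \<noteq> i" for c using that A1nz by (simp add: A2 \<rho>_def)
    have row: "A2 $ i $ c = A1 $ i $ c" for c by (simp add: A2)
    show "A3 $ a $ b = 0 \<and> A3 $ b $ a = 0"
    proof (cases "a = i")
      case True
      then show ?thesis using ab(2) A1nz by (simp add: A3 col row \<kappa>_def)
    next
      case False
      then have aS: "a \<in> S" using ab by simp
      have "\<rho> a = 0" "\<kappa> a = 0" using zero[OF aS, of i] False by (simp_all add: \<rho>_def \<kappa>_def)
      moreover have "A1 $ i $ a = 0" using zero[OF aS, of i] False by simp
      ultimately show ?thesis using zero[OF aS ab(2)] False col[of a] by (simp add: A3 A2 col[unfolded A2])
    qed
  qed
qed

text \<open>Pivots accumulate until \<open>S\<close> is everything; each diagonal entry is a unit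
  times a power of \<open>\<pi>\<close>, and the units go into \<open>P\<close>. The exponents come
  in no particular order.\<close>

theorem smith_normal_form:
  fixes A :: "'k^5^5"
  assumes \<pi>: "v \<pi> = Fin 1" and det: "det A \<noteq> 0"
  obtains P Q r where "P \<in> GL5 \<O>" "Q \<in> GL5 \<O>" "A = P ** diag_mat (\<lambda>i. \<pi> powi r i) ** Q"
proof -
  have "\<exists>S P Q A'. card S = n \<and> P \<in> GL5 \<O> \<and> Q \<in> GL5 \<O> \<and> A = P ** A' ** Q \<and>
     (\<forall>a b. a \<in> S \<longrightarrow> b \<noteq> a \<longrightarrow> A' $ a $ b = 0 \<and> A' $ b $ a = 0)" if "n \<le> 5" for n
    using that
  proof (induction n)
    case 0
    then show ?case
      by (intro exI[of _ "{}"] exI[of _ "mat 1"] exI[of _ A]) (simp add: GL5_one)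
  next
    case (Suc n)
    then obtain S P Q A' where 1: "card S = n" "P \<in> GL5 \<O>" "Q \<in> GL5 \<O>" "A = P ** A' ** Q"
      "\<And>a b. a \<in> S \<Longrightarrow> b \<noteq> a \<Longrightarrow> A' $ a $ b = 0 \<and> A' $ b $ a = 0" by auto
    have "det A' \<noteq> 0" using det unfolding 1(4) det_mul by auto
    moreover have "S \<noteq> UNIV" using 1(1) Suc.prems by auto
    ultimately obtain i P' Q' A'' where 2: "i \<notin> S" "P' \<in> GL5 \<O>" "Q' \<in> GL5 \<O>" "A' = P' ** A'' ** Q'"
      "\<And>a b. a \<in> insert i S \<Longrightarrow> b \<noteq> a \<Longrightarrow> A'' $ a $ b = 0 \<and> A'' $ b $ a = 0"
      using smith_step[OF _ 1(5)] by metis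
    have "A = (P ** P') ** A'' ** (Q' ** Q)" unfolding 1(4) 2(4) by (simp add: matrix_mul_assoc)
    moreover have "card (insert i S) = Suc n" using 1(1) 2(1) by simp
    ultimately show ?case
      using GL5_mult[OF 1(2) 2(2)] GL5_mult[OF 2(3) 1(3)] 2(5) by blast
  qed
  from this[of 5] obtain S P Q A' where 1: "card S = 5" "P \<in> GL5 \<O>" "Q \<in> GL5 \<O>" "A = P ** A' ** Q"
    "\<And>a b. a \<in> S \<Longrightarrow> b \<noteq> a \<Longrightarrow> A' $ a $ b = 0 \<and> A' $ b $ a = 0" by auto
  have "S = UNIV" using 1(1) by (intro card_subset_eq) auto
  define d where "d i = A' $ i $ i" for i
  have A': "A' = diag_mat d"
    unfolding vec_eq_iff diag_mat_def d_def using 1(5) \<open>S = UNIV\<close> by auto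
  have "det A' \<noteq> 0" using det unfolding 1(4) det_mul by auto
  then have "d i \<noteq> 0" for i unfolding A' det_diag_mat by auto
  then have "\<forall>i. \<exists>n. v (d i) = Fin n" by (metis v_FinE)
  then obtain r where "\<forall>i. v (d i) = Fin (r i)" by (rule choice[THEN exE])
  then have r: "v (d i) = Fin (r i)" for i by blast
  have \<pi>0: "\<pi> \<noteq> 0" using \<pi> by auto
  define u where "u i = d i * \<pi> powi (- r i)" for i
  have "v (u i) = Fin 0" for i unfolding u_def v_mult r v_powi[OF \<pi>] by simp
  then have "diag_mat u \<in> GL5 \<O>" by (rule diag_GL5)
  moreover have "A' = diag_mat u ** diag_mat (\<lambda>i. \<pi> powi r i)"
    unfolding A' using \<pi>0
    by (simp add: vec_eq_iff matrix_matrix_mult_def diag_mat_def u_def power_int_minus if_distrib[of "\<lambda>u. u * _"] cong: if_cong)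
  then have "A = (P ** diag_mat u) ** diag_mat (\<lambda>i. \<pi> powi r i) ** Q"
    unfolding 1(4) by (simp add: matrix_mul_assoc)
  ultimately show thesis using that GL5_mult[OF 1(2)] 1(3) by blast
qed

section \<open>Transformations between models with small discriminant\<close>

lemma v_discriminant_act:
  assumes D: "is_discriminant D" and \<Phi>: "\<Phi> \<in> X\<^sub>5 R"
  shows "v (eval_model D (act A B \<Phi>)) = v (act_det A B ^ 12) + v (eval_model D \<Phi>)"
proof -
  have "invariant_of_weight 12 D" using D by (simp add: is_discriminant_def)
  from invariance_any_ring[OF this \<Phi>] show ?thesis by (simp add: v_mult)
qed

lemma eval_model_integral: "\<Phi> \<in> X\<^sub>5 \<O> \<Longrightarrow> Fin 0 \<le> v (eval_model D \<Phi>)"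
  using at_least_int_eval[of "\<lambda>_. 0" "\<lambda>(i, j, k). \<Phi> $ i $ j $ k" D 0] X5_mem[of \<Phi> \<O>]
  by (auto simp: eval_model_alt at_least_def mem_ring_iff mono_weight_def)

text \<open>Both discriminants have valuation 0 or 1, and these valuations differ by
  \<open>12 * e\<close>.\<close>

lemma v_act_det_zero:
  assumes D: "is_discriminant D" and \<Phi>: "\<Phi> \<in> X\<^sub>5 \<O>" "act A B \<Phi> \<in> X\<^sub>5 \<O>"
    and small: "v (eval_model D \<Phi>) \<le> Fin 1" "v (eval_model D (act A B \<Phi>)) \<le> Fin 1"
    and e: "v (act_det A B) = Fin e"
  shows "e = 0"
proof -
  obtain a where a: "v (eval_model D \<Phi>) = Fin a" "0 \<le> a" "a \<le> 1"
    using small(1) eval_model_integral[OF \<Phi>(1), of D] by (cases "v (eval_model D \<Phi>)") auto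
  obtain b where b: "v (eval_model D (act A B \<Phi>)) = Fin b" "0 \<le> b" "b \<le> 1"
    using small(2) eval_model_integral[OF \<Phi>(2), of D] by (cases "v (eval_model D (act A B \<Phi>))") auto
  have "b = 12 * e + a"
    using v_discriminant_act[OF D \<Phi>(1), of A B] v_power[OF e, of 12] a b by simp
  then show ?thesis using a b by linarith
qed

text \<open>The integral factors of the two normal forms are absorbed into the models, and the
  weight estimates apply to the diagonal matrices left over. Constant exponents make these scalar,
  and vanishing of the total exponent ties them together as \<open>n\<close> and
  \<open>- 2 * n\<close>.\<close>

theorem transformation_integral:
  assumes \<pi>: "v \<pi> = Fin 1" and D: "is_discriminant D" and \<Phi>: "\<Phi> \<in> X\<^sub>5 \<O>" "act A B \<Phi> \<in> X\<^sub>5 \<O>"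
    and small: "v (eval_model D \<Phi>) \<le> Fin 1" "v (eval_model D (act A B \<Phi>)) \<le> Fin 1"
    and AB: "A \<in> GL5 UNIV" "B \<in> GL5 UNIV"
  obtains n U V where "U \<in> GL5 \<O>" "V \<in> GL5 \<O>" "A = mat (\<pi> powi n) ** U" "B = mat (\<pi> powi (- 2 * n)) ** V"
proof -
  have \<pi>0: "\<pi> \<noteq> 0" using \<pi> by auto
  obtain P Q r where A: "P \<in> GL5 \<O>" "Q \<in> GL5 \<O>" "A = P ** diag_mat (\<lambda>i. \<pi> powi r i) ** Q"
    using smith_normal_form[OF \<pi>, of A] AB(1) by (auto simp: GL5_UNIV_iff_det)
  obtain P' Q' s where B: "P' \<in> GL5 \<O>" "Q' \<in> GL5 \<O>" "B = P' ** diag_mat (\<lambda>i. \<pi> powi s i) ** Q'"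
    using smith_normal_form[OF \<pi>, of B] AB(2) by (auto simp: GL5_UNIV_iff_det)
  let ?E = "diag_mat (\<lambda>i. \<pi> powi r i)" and ?F = "diag_mat (\<lambda>i. \<pi> powi s i)"
  define \<Psi> where "\<Psi> = act Q Q' \<Phi>"
  have \<Psi>: "\<Psi> \<in> X\<^sub>5 \<O>" unfolding \<Psi>_def by (intro act_integral GL5_entry A B \<Phi>)
  have act: "act A B \<Phi> = act P P' (act ?E ?F \<Psi>)"
    unfolding A(3) B(3) \<Psi>_def act_act by (simp add: matrix_mul_assoc)
  obtain Pi Pi' where Pi: "Pi \<in> GL5 \<O>" "Pi ** P = mat 1" and Pi': "Pi' \<in> GL5 \<O>" "Pi' ** P' = mat 1"
    using GL5_E[OF A(1)] GL5_E[OF B(1)] by metis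
  have act_1: "act (mat 1) (mat 1) \<Theta> = \<Theta>" for \<Theta> :: "'k model"
    unfolding vec_eq_iff act_nth_nested mat_1_eq_elem_mat sum_elem_mat by simp
  have E\<Psi>: "act ?E ?F \<Psi> = act Pi Pi' (act A B \<Phi>)"
    unfolding act act_act[of Pi Pi'] Pi(2) Pi'(2) act_1 ..
  have E\<Psi>_int: "act ?E ?F \<Psi> \<in> X\<^sub>5 \<O>"
    unfolding E\<Psi> by (intro act_integral GL5_entry Pi Pi' \<Phi>)
  have unit: "v (eval_model D (act X Y \<Theta>)) = v (eval_model D \<Theta>)" if "X \<in> GL5 \<O>" "Y \<in> GL5 \<O>" "\<Theta> \<in> X\<^sub>5 \<O>" for X Y \<Theta>
  proof -
    have "v (act_det X Y) = Fin 0"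
      using v_det_GL5[OF that(1)] v_det_GL5[OF that(2)] by (simp add: act_det_def v_mult power2_eq_square)
    from v_power[OF this, of 12] show ?thesis
      unfolding v_discriminant_act[OF D that(3)] by (cases "v (eval_model D \<Theta>)") auto
  qed
  have small\<Psi>: "v (eval_model D \<Psi>) \<le> Fin 1"
    using small(1) unit[OF A(2) B(2) \<Phi>(1)] by (simp add: \<Psi>_def)
  have small2: "v (eval_model D (act ?E ?F \<Psi>)) \<le> Fin 1"
    using small(2) unit[OF Pi(1) Pi'(1) \<Phi>(2)] by (simp add: E\<Psi>)
  have vprod: "v (\<Prod>i\<in>S. \<pi> powi f i) = Fin (\<Sum>i\<in>S. f i)" for S :: "5 set" and f
    by (induction S rule: infinite_finite_induct) (auto simp: v_mult v_powi[OF \<pi>])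
  have "v (act_det ?E ?F) = Fin (2 * sum r UNIV + sum s UNIV)"
    by (simp add: act_det_def det_diag_mat v_mult power2_eq_square vprod)
  then have total: "2 * sum r UNIV + sum s UNIV = 0"
    by (rule v_act_det_zero[OF D \<Psi> E\<Psi>_int small\<Psi> small2])
  have val: "at_least (- (r i + r j + s k)) (\<Psi> $ i $ j $ k)" for i j k
  proof -
    have "act ?E ?F \<Psi> $ i $ j $ k = \<pi> powi (r i + r j + s k) * \<Psi> $ i $ j $ k"
      unfolding act_diag using \<pi>0 by (simp add: power_int_add)
    then have "at_least 0 (\<pi> powi (r i + r j + s k) * \<Psi> $ i $ j $ k)"
      using X5_mem[OF E\<Psi>_int, of i j k] by (simp add: mem_ring_iff)
    then show ?thesis unfolding at_least_def v_mult v_powi[OF \<pi>] by (cases "v (\<Psi> $ i $ j $ k)") auto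
  qed
  have "(\<forall>i. r i = r 0) \<and> (\<forall>i. s i = s 0)"
    by (rule unstable_discriminant[OF D \<Psi> total val small\<Psi>])
  then have rs: "r i = r 0" "s i = s 0" for i by blast+
  have "s 0 = - 2 * r 0"
    using total rs by (simp add: sum.cong[OF refl rs(1)] sum.cong[OF refl rs(2)])
  have const: "diag_mat (\<lambda>_. c) = mat c" for c :: 'k by (simp add: diag_mat_def mat_def)
  have "?E = diag_mat (\<lambda>_. \<pi> powi r 0)" by (intro arg_cong[of _ _ diag_mat] ext) (rule arg_cong[OF rs(1)])
  moreover have "?F = diag_mat (\<lambda>_. \<pi> powi (- 2 * r 0))"
    by (intro arg_cong[of _ _ diag_mat] ext) (metis rs(2) \<open>s 0 = - 2 * r 0\<close>)
  moreover have "X ** mat c ** Y = mat c ** (X ** Y)" for X Y :: "'k^5^5" and c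
    unfolding mat_commute[of X] by (simp only: matrix_mul_assoc)
  ultimately have "A = mat (\<pi> powi r 0) ** (P ** Q)" "B = mat (\<pi> powi (- 2 * r 0)) ** (P' ** Q')"
    unfolding A(3) B(3) by (simp_all only: const)
  then show thesis using that GL5_mult[OF A(1,2)] GL5_mult[OF B(1,2)] by blast
qed

end

section \<open>Scalar pairs in the generated subgroup\<close>

lemma group_GL5: "group (GL5_group (UNIV :: 'k::field set))"
proof (rule groupI)
  fix A assume "A \<in> carrier (GL5_group (UNIV :: 'k set))"
  then obtain A' where "A' \<in> GL5 UNIV" "A' ** A = mat 1" by (auto simp: GL5_group_def elim: GL5_E)
  then show "\<exists>A'\<in>carrier (GL5_group UNIV). A' \<otimes>\<^bsub>GL5_group UNIV\<^esub> A = \<one>\<^bsub>GL5_group UNIV\<^esub>"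
    by (auto simp: GL5_group_def)
qed (auto simp: GL5_group_def GL5_UNIV_iff_det det_mul matrix_mul_assoc)

lemma mat_mat: "mat a ** mat b = mat (a * b :: 'a::comm_ring_1)"
  by (simp add: vec_eq_iff mat_mult_left) (simp add: mat_def)

text \<open>The pair with exponent \<open>n\<close> is the \<open>n\<close>-th power of the inverse
  of the given generator.\<close>

lemma scalar_pair_generate:
  fixes \<pi> :: "'k::field"
  assumes "\<pi> \<noteq> 0" and "(mat (inverse \<pi>), mat (\<pi>\<^sup>2)) \<in> H"
  shows "(mat (\<pi> powi n), mat (\<pi> powi (- 2 * n))) \<in> generate (GL5_group UNIV \<times>\<times> GL5_group UNIV) H"
proof -
  let ?G = "GL5_group (UNIV :: 'k set) \<times>\<times> GL5_group (UNIV :: 'k set)"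
  interpret G: group ?G by (intro DirProd_group group_GL5)
  have mem: "(mat a, mat b) \<in> carrier ?G" if "a \<noteq> 0" "b \<noteq> 0" for a b :: 'k
  proof -
    have "mat c \<in> GL5 UNIV" if "c \<noteq> 0" for c :: 'k
      using that by (intro GL5_I[of _ _ "mat (inverse c)"]) (auto simp: mat_mat)
    then show ?thesis using that by (simp add: GL5_group_def)
  qed
  have mult: "(mat a, mat b) \<otimes>\<^bsub>?G\<^esub> (mat c, mat d) = (mat (a * c), mat (b * d))" for a b c d :: 'k
    by (simp add: GL5_group_def mat_mat)
  let ?g = "(mat (inverse \<pi>), mat (\<pi>\<^sup>2))" and ?h = "(mat \<pi>, mat (inverse \<pi> ^ 2))"
  have g: "?g \<in> generate ?G H" by (rule generate.incl[OF assms(2)])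
  have "inv\<^bsub>?G\<^esub> ?g = ?h"
  proof (rule G.inv_equality)
    show "?h \<otimes>\<^bsub>?G\<^esub> ?g = \<one>\<^bsub>?G\<^esub>"
    proof -
      have "inverse \<pi> ^ 2 * \<pi>\<^sup>2 = 1" using assms(1) by (simp add: power_mult_distrib[symmetric])
      then show ?thesis unfolding mult using assms(1) by (simp add: GL5_group_def)
    qed
    show "?g \<in> carrier ?G" "?h \<in> carrier ?G" by (rule mem; use assms(1) in simp)+
  qed
  then have h: "?h \<in> generate ?G H" using generate.inv[OF assms(2), of ?G] by (simp only:)
  have pos: "(mat (\<pi> ^ m), mat (inverse \<pi> ^ (2 * m))) \<in> generate ?G H" for m
  proof (induction m)
    case 0
    have "\<one>\<^bsub>?G\<^esub> \<in> generate ?G H" by (rule generate.one)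
    then show ?case by (simp add: GL5_group_def)
  next
    case (Suc m)
    from generate.eng[OF h Suc] show ?case unfolding mult by (simp add: power2_eq_square mult.assoc)
  qed
  have neg: "(mat (inverse \<pi> ^ m), mat (\<pi> ^ (2 * m))) \<in> generate ?G H" for m
  proof (induction m)
    case 0
    have "\<one>\<^bsub>?G\<^esub> \<in> generate ?G H" by (rule generate.one)
    then show ?case by (simp add: GL5_group_def)
  next
    case (Suc m)
    from generate.eng[OF g Suc] show ?case unfolding mult by (simp add: power2_eq_square mult.assoc)
  qed
  show ?thesis
  proof (cases "n \<ge> 0")
    case True
    then obtain m where "n = int m" using zero_le_imp_eq_int by blast
    then show ?thesis using pos[of m] by (cases "m = 0") (auto simp: power_int_def power_inverse nat_mult_distrib)
  next
    case False
    then obtain m where "n = - int m" by (metis int_cases2 linear neg_0_le_iff_le of_nat_0_le_iff)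
    then show ?thesis using neg[of m] by (cases "m = 0") (auto simp: power_int_def nat_mult_distrib)
  qed
qed

theorem theorem1p1:
  fixes v :: "'k::field \<Rightarrow> int extended" and \<pi> :: 'k
    and D :: model_poly and \<Phi> \<Phi>' :: "'k model"
  assumes "normalised_discrete_valuation v" and "v \<pi> = Fin 1"
    and "is_discriminant D"
    and "\<Phi> \<in> X\<^sub>5 (valuation_ring v)" and "\<Phi>' \<in> X\<^sub>5 (valuation_ring v)"
    and "v (eval_model D \<Phi>) \<le> Fin 1" and "v (eval_model D \<Phi>') \<le> Fin 1"
  shows "(\<forall>A \<in> GL5 UNIV. \<forall>B \<in> GL5 UNIV. \<Phi>' = act A B \<Phi> \<longrightarrow>
            A \<in> scalar_GL5 (valuation_ring v) \<and> B \<in> scalar_GL5 (valuation_ring v))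
       \<and> (equivalent_over UNIV \<Phi> \<Phi>' \<longrightarrow> equivalent_over (valuation_ring v) \<Phi> \<Phi>')
       \<and> stabiliser UNIV \<Phi> \<subseteq>
           generate (GL5_group UNIV \<times>\<times> GL5_group UNIV)
             (GL5 (valuation_ring v) \<times> GL5 (valuation_ring v) \<union> {(mat (inverse \<pi>), mat (\<pi>\<^sup>2))})"
proof -
  interpret discrete_valuation v by unfold_locales (rule assms(1))
  have \<pi>0: "\<pi> \<noteq> 0" using assms(2) by auto
  \<comment> \<open>One exponent \<open>n\<close> governs both scalars. This makes them cancel in
    the action, which gives (i), and puts them into the cyclic group of the extra generator, which
    gives (ii).\<close>
  have main: "\<exists>n U V. U \<in> GL5 \<O> \<and> V \<in> GL5 \<O> \<and> A = mat (\<pi> powi n) ** U \<and> B = mat (\<pi> powi (- 2 * n)) ** V"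
    if "A \<in> GL5 UNIV" "B \<in> GL5 UNIV" "act A B \<Phi> \<in> X\<^sub>5 \<O>" "v (eval_model D (act A B \<Phi>)) \<le> Fin 1" for A B
    by (rule transformation_integral[OF assms(2,3,4) that(3) assms(6) that(4) that(1,2)]) blast
  \<comment> \<open>A coefficient of a model is multiplied by \<open>a\<close> twice, for its row
    and its column, and by \<open>b\<close> once, for its variable.\<close>
  have scal: "act (mat a ** U) (mat b ** V) \<Theta> = act U V \<Theta>" if "a\<^sup>2 * b = 1" for a b U V and \<Theta> :: "'k model"
  proof -
    have "act (mat a ** U) (mat b ** V) \<Theta> = act (mat a) (mat b) (act U V \<Theta>)" by (simp add: act_act)
    also have "\<dots> = act U V \<Theta>"
    proof -
      have "act (mat a) (mat b) \<Xi> $ i $ j $ k = \<Xi> $ i $ j $ k" for \<Xi> :: "'k model" and i j k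
        using act_diag[of "\<lambda>_. a" "\<lambda>_. b" \<Xi> i j k] that by (simp add: diag_mat_def mat_def power2_eq_square)
      then show ?thesis by (simp add: vec_eq_iff)
    qed
    finally show ?thesis .
  qed
  have one: "(\<pi> powi n)\<^sup>2 * \<pi> powi (- 2 * n) = 1" for n
    using \<pi>0 by (simp add: power2_eq_square power_int_add[symmetric])
  have scalar: "mat (\<pi> powi n) ** U \<in> scalar_GL5 \<O>" if "U \<in> GL5 \<O>" for n U
    using that \<pi>0 unfolding scalar_GL5_def by (auto intro!: exI[of _ "\<pi> powi n"] exI[of _ U])
  have "A \<in> scalar_GL5 \<O> \<and> B \<in> scalar_GL5 \<O>" if "A \<in> GL5 UNIV" "B \<in> GL5 UNIV" "\<Phi>' = act A B \<Phi>" for A B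
    using main[OF that(1,2)] assms(5,7) that(3) scalar by auto
  moreover have "equivalent_over \<O> \<Phi> \<Phi>'" if "equivalent_over UNIV \<Phi> \<Phi>'"
  proof -
    obtain A B where AB: "A \<in> GL5 UNIV" "B \<in> GL5 UNIV" "\<Phi>' = act A B \<Phi>"
      using \<open>equivalent_over UNIV \<Phi> \<Phi>'\<close> by (auto simp: equivalent_over_def)
    then obtain n U V where "U \<in> GL5 \<O>" "V \<in> GL5 \<O>" "A = mat (\<pi> powi n) ** U" "B = mat (\<pi> powi (- 2 * n)) ** V"
      using main[OF AB(1,2)] assms(5,7) by auto
    then show ?thesis using AB(3) scal[OF one] unfolding equivalent_over_def by auto
  qed
  moreover have "stabiliser UNIV \<Phi> \<subseteq> generate (GL5_group UNIV \<times>\<times> GL5_group UNIV)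
      (GL5 \<O> \<times> GL5 \<O> \<union> {(mat (inverse \<pi>), mat (\<pi>\<^sup>2))})" (is "_ \<subseteq> generate ?G ?H")
  proof (rule subrelI)
    fix A B assume "(A, B) \<in> stabiliser UNIV \<Phi>"
    then have AB: "A \<in> GL5 UNIV" "B \<in> GL5 UNIV" "act A B \<Phi> = \<Phi>" by (auto simp: stabiliser_def)
    then obtain n U V where UV: "U \<in> GL5 \<O>" "V \<in> GL5 \<O>" "A = mat (\<pi> powi n) ** U" "B = mat (\<pi> powi (- 2 * n)) ** V"
      using main[OF AB(1,2)] assms(4,6) by auto
    have "(mat (\<pi> powi n), mat (\<pi> powi (- 2 * n))) \<in> generate ?G ?H"
      by (intro scalar_pair_generate[OF \<pi>0]) auto
    moreover have "(U, V) \<in> generate ?G ?H" using UV by (intro generate.incl) auto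
    ultimately have "(mat (\<pi> powi n), mat (\<pi> powi (- 2 * n))) \<otimes>\<^bsub>?G\<^esub> (U, V) \<in> generate ?G ?H" by (rule generate.eng)
    then show "(A, B) \<in> generate ?G ?H" by (simp add: UV(3,4) GL5_group_def)
  qed
  ultimately show ?thesis by blast
qed

end
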